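(* For each $\varepsilon\in(0,1]$ let $\rho\in H^1(\mathcal{T}\times\mathcal{D})$, $j,w\in H^1(\mathcal{T}\times\mathcal{D}\times\Omega^+)$ be the exact solution of the one-dimensional multiscale parity decomposition system described in the context, and let $\rho_\theta,j_\theta,w_\theta$ be neural network approximations. Then, with a constant $C>0$ independent of $\varepsilon$, $$\mathcal{R}^\varepsilon_{\mathrm{total}}\le\frac{C}{\varepsilon}\,\mathcal{R}^\varepsilon_{\mathrm{APNN}}.$$
   Context: $\varepsilon$ is the Knudsen number, $\mathcal{T}=(0,T)$ is a bounded time interval, $\mathcal{D}=(x_L,x_R)$, $\Omega^+=[0,1]$, $\langle g\rangle=\int_0^1g\,\mathrm{d}v$, and $\lambda_1,\dots,\lambda_4>0$ are fixed penalty weights. The radiative transfer equation is $\varepsilon\partial_t f+v\partial_x f=\frac1\varepsilon(\frac12\int_{-1}^1 f\,\mathrm{d}v'-f)$, $v\in[-1,1]$, with periodic boundary condition $f(t,x_L,v)=f(t,x_R,v)$ and initial condition $f(0,x,v)=f_{\mathrm{IC}}(x,v)$. For $v\in\Omega^+$ set $r=\frac12[f(v)+f(-v)]$, $j=\frac1{2\varepsilon}[f(v)-f(-v)]$, $\rho=\langle r\rangle$, $r=\rho+\varepsilon^2 w$, so that $f=\rho+\varepsilon j+\varepsilon^2 w$ on $\Omega^+$. The multiscale parity decomposition system for $\rho(t,x),j(t,x,v),w(t,x,v)$ is $$\partial_t\rho+\langle v\partial_xj\rangle=0,\quad \varepsilon^2\partial_tj+v\partial_x\rho+\varepsilon^2v\partial_xw+j=0,\quad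 \varepsilon^2\partial_tw+w+v\partial_xj-\langle v\partial_xj\rangle=0,$$ with $\langle w\rangle=0$ and periodicity in $x$. Subscripts $\mathrm{IC}$ and $\mathrm{BC}$ denote the initial data (values at $t=0$) and boundary data (values on $\partial\mathcal{D}$) of the exact solution. Neural network approximations $\rho_\theta(t,x),j_\theta(t,x,v),w_\theta(t,x,v)$ are smooth functions depending on trainable parameters $\theta$; put $f_\theta=\rho_\theta+\varepsilon j_\theta+\varepsilon^2w_\theta$, $d^{(1)}_\theta=\partial_t\rho_\theta+\langle v\partial_xj_\theta\rangle$, $d^{(2)}_\theta=\varepsilon^2\partial_tj_\theta+v\partial_x\rho_\theta+\varepsilon^2v\partial_xw_\theta+j_\theta$, $d^{(3)}_\theta=\varepsilon^2\partial_tw_\theta+w_\theta+v\partial_xj_\theta-\langle v\partial_xj_\theta\rangle$. Then $\mathcal{R}^\varepsilon_{\mathrm{APNN}}=\mathcal{R}^\varepsilon_{\mathrm{residual}}+\mathcal{R}^\varepsilon_{\mathrm{initial}}+\mathcal{R}^\varepsilon_{\mathrm{boundary}}$ with $$\mathcal{R}^\varepsilon_{\mathrm{residual}}=\tfrac{1}{|\mathcal{T}\times\mathcal{D}|}\int_{\mathcal{T}}\int_{\mathcal{D}}|d^{(1)}_\theta|^2\,\mathrm{d}x\mathrm{d}t+\tfrac{1}{|\mathcal{T}\times\mathcal{D}\times\Omega^+|}\int_{\mathcal{T}}\int_{\mathcal{D}}\int_{\Omega^+}(|d^{(2)}_\theta|^2+|d^{(3)}_\theta|^2)\,\mathrm{d}v\mathrm{d}x\mathrm{d}t,$$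 $$\mathcal{R}^\varepsilon_{\mathrm{initial}}=\tfrac{\lambda_1}{|\mathcal{D}|}\int_{\mathcal{D}}|\rho_\theta-\rho_{\mathrm{IC}}|^2\mathrm{d}x+\tfrac{\lambda_2}{|\mathcal{D}\times\Omega^+|}\int_{\mathcal{D}}\int_{\Omega^+}\big(\varepsilon^2|j_\theta-j_{\mathrm{IC}}|^2+\varepsilon^4|w_\theta-w_{\mathrm{IC}}|^2\big)\mathrm{d}v\mathrm{d}x\quad(\text{at }t=0),$$ $$\mathcal{R}^\varepsilon_{\mathrm{boundary}}=\tfrac{\lambda_3}{|\mathcal{T}\times\partial\mathcal{D}|}\int_{\mathcal{T}}\int_{\partial\mathcal{D}}|\rho_\theta-\rho_{\mathrm{BC}}|^2\mathrm{d}s\mathrm{d}t+\tfrac{\lambda_4}{|\mathcal{T}\times\partial\mathcal{D}\times\Omega^+|}\int_{\mathcal{T}}\int_{\partial\mathcal{D}}\int_{\Omega^+}\big(|w_\theta-w_{\mathrm{BC}}|^2+|j_\theta-j_{\mathrm{BC}}|^2\big)\mathrm{d}v\mathrm{d}s\mathrm{d}t,$$ where $\mathrm{d}s$ on $\partial\mathcal{D}=\{x_L,x_R\}$ is counting measure. The total error is $\mathcal{R}^\varepsilon_{\mathrm{total}}=\|f-f_\theta\|^2_{L^2(\mathcal{T}\times\mathcal{D}\times\Omega^+)}$. The exact solution and the networks may depend on $\varepsilon$. *)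

theory Defs
  imports "HOL-Analysis.Analysis"
begin

section \<open>Smooth functions and test functions\<close>

definition pderiv_at :: "'a::euclidean_space \<Rightarrow> ('a \<Rightarrow> real) \<Rightarrow> 'a \<Rightarrow> real" where
  "pderiv_at b u z = frechet_derivative u (at z) b"

text \<open>Only meant for open sets \<open>S\<close>.\<close>

primrec Ck_on :: "nat \<Rightarrow> 'a::euclidean_space set \<Rightarrow> ('a \<Rightarrow> real) \<Rightarrow> bool" where
  "Ck_on 0 S u = continuous_on S u"
| "Ck_on (Suc k) S u =
     ((\<forall>z\<in>S. u differentiable (at z)) \<and> (\<forall>b\<in>Basis. Ck_on k S (pderiv_at b u)))"

definition smooth_on :: "'a::euclidean_space set \<Rightarrow> ('a \<Rightarrow> real) \<Rightarrow> bool" where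
  "smooth_on S u \<longleftrightarrow> (\<forall>k. Ck_on k S u)"

definition smooth_up_to_boundary :: "'a::euclidean_space set \<Rightarrow> ('a \<Rightarrow> real) \<Rightarrow> bool" where
  "smooth_up_to_boundary S u \<longleftrightarrow> (\<exists>U. open U \<and> closure S \<subseteq> U \<and> smooth_on U u)"

definition test_function :: "'a::euclidean_space set \<Rightarrow> ('a \<Rightarrow> real) \<Rightarrow> bool" where
  "test_function S \<phi> \<longleftrightarrow>
     smooth_on UNIV \<phi> \<and> compact (closure {z. \<phi> z \<noteq> 0}) \<and> closure {z. \<phi> z \<noteq> 0} \<subseteq> S"


section \<open>\<open>L\<^sup>2\<close>, weak derivatives, \<open>H\<^sup>1\<close> and traces\<close>

definition L2_on :: "'a::euclidean_space set \<Rightarrow> ('a \<Rightarrow> real) \<Rightarrow> bool" where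
  "L2_on S u \<longleftrightarrow> set_borel_measurable lborel S u \<and> set_integrable lborel S (\<lambda>z. (u z)\<^sup>2)"

definition L2_norm_on :: "'a::euclidean_space set \<Rightarrow> ('a \<Rightarrow> real) \<Rightarrow> real" where
  "L2_norm_on S u = sqrt (LINT z:S|lborel. (u z)\<^sup>2)"

text \<open>The sets \<open>S\<close> below need not be open (the velocity set \<open>[0,1]\<close> is closed); test functions
  are always supported in the interior.\<close>

definition is_weak_deriv ::
  "'a::euclidean_space set \<Rightarrow> 'a \<Rightarrow> ('a \<Rightarrow> real) \<Rightarrow> ('a \<Rightarrow> real) \<Rightarrow> bool" where
  "is_weak_deriv S b u g \<longleftrightarrow>
     (\<forall>\<phi>. test_function (interior S) \<phi> \<longrightarrow>
        (LINT z:S|lborel. u z * pderiv_at b \<phi> z) = - (LINT z:S|lborel. g z * \<phi> z))"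

definition in_H1 :: "'a::euclidean_space set \<Rightarrow> ('a \<Rightarrow> real) \<Rightarrow> bool" where
  "in_H1 S u \<longleftrightarrow> L2_on S u \<and> (\<forall>b\<in>Basis. \<exists>g. L2_on S g \<and> is_weak_deriv S b u g)"

text \<open>A representative of the weak derivative, which is unique up to null sets; used only for
  functions in \<open>H\<^sup>1\<close> and only under almost-everywhere statements and integrals.\<close>

definition weak_deriv :: "'a::euclidean_space set \<Rightarrow> 'a \<Rightarrow> ('a \<Rightarrow> real) \<Rightarrow> 'a \<Rightarrow> real" where
  "weak_deriv S b u = (SOME g. L2_on S g \<and> is_weak_deriv S b u g)"

definition H1_converges ::
  "'a::euclidean_space set \<Rightarrow> (nat \<Rightarrow> 'a \<Rightarrow> real) \<Rightarrow> ('a \<Rightarrow> real) \<Rightarrow> bool" where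
  "H1_converges S \<Phi> u \<longleftrightarrow>
     (\<lambda>n. L2_norm_on S (\<lambda>z. \<Phi> n z - u z)) \<longlonglongrightarrow> 0 \<and>
     (\<forall>b\<in>Basis. (\<lambda>n. L2_norm_on S (\<lambda>z. pderiv_at b (\<Phi> n) z - weak_deriv S b u z)) \<longlonglongrightarrow> 0)"

text \<open>The trace operator is the continuous extension to \<open>H\<^sup>1(S)\<close> of the restriction of smooth
  functions to a boundary face. The face is parametrised isometrically by \<open>\<gamma>\<close> on \<open>F\<close>, and \<open>g\<close> is
  the trace in this parametrisation. The approximating functions are restrictions of
  functions in \<open>C\<^sub>c\<^sup>\<infinity>\<close> of the whole space, so all norms involved are finite.\<close>

definition has_trace ::
  "'a::euclidean_space set \<Rightarrow> ('a \<Rightarrow> real) \<Rightarrow> ('b::euclidean_space \<Rightarrow> 'a) \<Rightarrow> 'b set \<Rightarrow> ('b \<Rightarrow> real) \<Rightarrow> bool"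
where
  "has_trace S u \<gamma> F g \<longleftrightarrow>
     in_H1 S u \<and> L2_on F g \<and>
     (\<exists>\<Phi>. (\<forall>n. test_function UNIV (\<Phi> n)) \<and> H1_converges S \<Phi> u \<and>
          (\<lambda>n. L2_norm_on F (\<lambda>y. \<Phi> n (\<gamma> y) - g y)) \<longlonglongrightarrow> 0)"


section \<open>The parity decomposition system\<close>

text \<open>Points are \<open>(t, x)\<close> or \<open>(t, x, v)\<close>.\<close>

abbreviation \<Omega>plus :: "real set" where
  "\<Omega>plus \<equiv> {0..1}"

definition TD :: "real \<Rightarrow> real \<Rightarrow> real \<Rightarrow> (real \<times> real) set" where
  "TD T xL xR = {0<..<T} \<times> {xL<..<xR}"

definition TDV :: "real \<Rightarrow> real \<Rightarrow> real \<Rightarrow> (real \<times> real \<times> real) set" where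
  "TDV T xL xR = {0<..<T} \<times> {xL<..<xR} \<times> \<Omega>plus"

abbreviation dt2 :: "real \<times> real" where "dt2 \<equiv> (1, 0)"
abbreviation dx2 :: "real \<times> real" where "dx2 \<equiv> (0, 1)"
abbreviation dt3 :: "real \<times> real \<times> real" where "dt3 \<equiv> (1, 0, 0)"
abbreviation dx3 :: "real \<times> real \<times> real" where "dx3 \<equiv> (0, 1, 0)"

definition vavg :: "(real \<Rightarrow> real) \<Rightarrow> real" where
  "vavg g = (LBINT v:\<Omega>plus. g v)"

text \<open>Left-hand sides of the three equations, as functions of the unknowns and their derivatives,
  so that they can be used both with weak derivatives (exact solution) and with classical
  derivatives (neural networks).\<close>

definition lhs1 ::
  "(real \<times> real \<Rightarrow> real) \<Rightarrow> (real \<times> real \<times> real \<Rightarrow> real) \<Rightarrow> real \<Rightarrow> real \<Rightarrow> real" where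
  "lhs1 \<rho>\<^sub>t j\<^sub>x t x = \<rho>\<^sub>t (t, x) + vavg (\<lambda>v. v * j\<^sub>x (t, x, v))"

definition lhs2 ::
  "real \<Rightarrow> (real \<times> real \<times> real \<Rightarrow> real) \<Rightarrow> (real \<times> real \<Rightarrow> real) \<Rightarrow> (real \<times> real \<times> real \<Rightarrow> real)
   \<Rightarrow> (real \<times> real \<times> real \<Rightarrow> real) \<Rightarrow> real \<Rightarrow> real \<Rightarrow> real \<Rightarrow> real" where
  "lhs2 \<epsilon> j\<^sub>t \<rho>\<^sub>x w\<^sub>x j t x v =
     \<epsilon>\<^sup>2 * j\<^sub>t (t, x, v) + v * \<rho>\<^sub>x (t, x) + \<epsilon>\<^sup>2 * v * w\<^sub>x (t, x, v) + j (t, x, v)"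

definition lhs3 ::
  "real \<Rightarrow> (real \<times> real \<times> real \<Rightarrow> real) \<Rightarrow> (real \<times> real \<times> real \<Rightarrow> real)
   \<Rightarrow> (real \<times> real \<times> real \<Rightarrow> real) \<Rightarrow> real \<Rightarrow> real \<Rightarrow> real \<Rightarrow> real" where
  "lhs3 \<epsilon> w\<^sub>t w j\<^sub>x t x v =
     \<epsilon>\<^sup>2 * w\<^sub>t (t, x, v) + w (t, x, v) + v * j\<^sub>x (t, x, v) - vavg (\<lambda>v'. v' * j\<^sub>x (t, x, v'))"

definition periodic2 :: "real \<Rightarrow> real \<Rightarrow> real \<Rightarrow> (real \<times> real \<Rightarrow> real) \<Rightarrow> bool" where
  "periodic2 T xL xR u \<longleftrightarrow>
     (\<exists>g. \<forall>s\<in>{xL, xR}. has_trace (TD T xL xR) u (\<lambda>t. (t, s)) {0<..<T} g)"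

definition periodic3 :: "real \<Rightarrow> real \<Rightarrow> real \<Rightarrow> (real \<times> real \<times> real \<Rightarrow> real) \<Rightarrow> bool" where
  "periodic3 T xL xR u \<longleftrightarrow>
     (\<exists>g. \<forall>s\<in>{xL, xR}. has_trace (TDV T xL xR) u (\<lambda>(t, v). (t, s, v)) ({0<..<T} \<times> \<Omega>plus) g)"

definition exact_solution ::
  "real \<Rightarrow> real \<Rightarrow> real \<Rightarrow> real \<Rightarrow> (real \<times> real \<Rightarrow> real) \<Rightarrow> (real \<times> real \<times> real \<Rightarrow> real)
   \<Rightarrow> (real \<times> real \<times> real \<Rightarrow> real) \<Rightarrow> bool" where
  "exact_solution T xL xR \<epsilon> \<rho> j w \<longleftrightarrow>
     in_H1 (TD T xL xR) \<rho> \<and> in_H1 (TDV T xL xR) j \<and> in_H1 (TDV T xL xR) w \<and>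
     (AE (t, x) in lborel. (t, x) \<in> TD T xL xR \<longrightarrow>
        lhs1 (weak_deriv (TD T xL xR) dt2 \<rho>) (weak_deriv (TDV T xL xR) dx3 j) t x = 0) \<and>
     (AE (t, x, v) in lborel. (t, x, v) \<in> TDV T xL xR \<longrightarrow>
        lhs2 \<epsilon> (weak_deriv (TDV T xL xR) dt3 j) (weak_deriv (TD T xL xR) dx2 \<rho>)
          (weak_deriv (TDV T xL xR) dx3 w) j t x v = 0) \<and>
     (AE (t, x, v) in lborel. (t, x, v) \<in> TDV T xL xR \<longrightarrow>
        lhs3 \<epsilon> (weak_deriv (TDV T xL xR) dt3 w) w (weak_deriv (TDV T xL xR) dx3 j) t x v = 0) \<and>
     (AE (t, x) in lborel. (t, x) \<in> TD T xL xR \<longrightarrow> vavg (\<lambda>v. w (t, x, v)) = 0) \<and>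
     periodic2 T xL xR \<rho> \<and> periodic3 T xL xR j \<and> periodic3 T xL xR w"

text \<open>Initial data are functions of \<open>x\<close> or \<open>(x, v)\<close>. Boundary data are functions of \<open>(t, s)\<close> or
  \<open>(t, s, v)\<close> and are relevant only for \<open>s \<in> {xL, xR}\<close>.\<close>

definition initial_data2 ::
  "real \<Rightarrow> real \<Rightarrow> real \<Rightarrow> (real \<times> real \<Rightarrow> real) \<Rightarrow> (real \<Rightarrow> real) \<Rightarrow> bool" where
  "initial_data2 T xL xR u g \<longleftrightarrow> has_trace (TD T xL xR) u (\<lambda>x. (0, x)) {xL<..<xR} g"

definition initial_data3 ::
  "real \<Rightarrow> real \<Rightarrow> real \<Rightarrow> (real \<times> real \<times> real \<Rightarrow> real) \<Rightarrow> (real \<times> real \<Rightarrow> real) \<Rightarrow> bool" where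
  "initial_data3 T xL xR u g \<longleftrightarrow>
     has_trace (TDV T xL xR) u (\<lambda>(x, v). (0, x, v)) ({xL<..<xR} \<times> \<Omega>plus) g"

definition boundary_data2 ::
  "real \<Rightarrow> real \<Rightarrow> real \<Rightarrow> (real \<times> real \<Rightarrow> real) \<Rightarrow> (real \<times> real \<Rightarrow> real) \<Rightarrow> bool" where
  "boundary_data2 T xL xR u g \<longleftrightarrow>
     (\<forall>s\<in>{xL, xR}. has_trace (TD T xL xR) u (\<lambda>t. (t, s)) {0<..<T} (\<lambda>t. g (t, s)))"

definition boundary_data3 ::
  "real \<Rightarrow> real \<Rightarrow> real \<Rightarrow> (real \<times> real \<times> real \<Rightarrow> real) \<Rightarrow> (real \<times> real \<times> real \<Rightarrow> real) \<Rightarrow> bool" where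
  "boundary_data3 T xL xR u g \<longleftrightarrow>
     (\<forall>s\<in>{xL, xR}. has_trace (TDV T xL xR) u (\<lambda>(t, v). (t, s, v)) ({0<..<T} \<times> \<Omega>plus)
        (\<lambda>(t, v). g (t, s, v)))"


section \<open>Loss and total error\<close>

definition d1 :: "(real \<times> real \<Rightarrow> real) \<Rightarrow> (real \<times> real \<times> real \<Rightarrow> real) \<Rightarrow> real \<Rightarrow> real \<Rightarrow> real" where
  "d1 \<rho> j = lhs1 (pderiv_at dt2 \<rho>) (pderiv_at dx3 j)"

definition d2 ::
  "real \<Rightarrow> (real \<times> real \<Rightarrow> real) \<Rightarrow> (real \<times> real \<times> real \<Rightarrow> real)
   \<Rightarrow> (real \<times> real \<times> real \<Rightarrow> real) \<Rightarrow> real \<Rightarrow> real \<Rightarrow> real \<Rightarrow> real" where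
  "d2 \<epsilon> \<rho> j w = lhs2 \<epsilon> (pderiv_at dt3 j) (pderiv_at dx2 \<rho>) (pderiv_at dx3 w) j"

definition d3 ::
  "real \<Rightarrow> (real \<times> real \<times> real \<Rightarrow> real) \<Rightarrow> (real \<times> real \<times> real \<Rightarrow> real)
   \<Rightarrow> real \<Rightarrow> real \<Rightarrow> real \<Rightarrow> real" where
  "d3 \<epsilon> j w = lhs3 \<epsilon> (pderiv_at dt3 w) w (pderiv_at dx3 j)"

definition R_residual ::
  "real \<Rightarrow> real \<Rightarrow> real \<Rightarrow> real \<Rightarrow> (real \<times> real \<Rightarrow> real) \<Rightarrow> (real \<times> real \<times> real \<Rightarrow> real)
   \<Rightarrow> (real \<times> real \<times> real \<Rightarrow> real) \<Rightarrow> real" where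
  "R_residual T xL xR \<epsilon> \<rho>N jN wN =
     1 / measure lborel (TD T xL xR) *
       (LBINT t:{0<..<T}. LBINT x:{xL<..<xR}. (d1 \<rho>N jN t x)\<^sup>2)
   + 1 / measure lborel (TDV T xL xR) *
       (LBINT t:{0<..<T}. LBINT x:{xL<..<xR}. LBINT v:\<Omega>plus.
          (d2 \<epsilon> \<rho>N jN wN t x v)\<^sup>2 + (d3 \<epsilon> jN wN t x v)\<^sup>2)"

definition R_initial ::
  "real \<Rightarrow> real \<Rightarrow> real \<Rightarrow> real \<Rightarrow> real
   \<Rightarrow> (real \<Rightarrow> real) \<Rightarrow> (real \<times> real \<Rightarrow> real) \<Rightarrow> (real \<times> real \<Rightarrow> real)
   \<Rightarrow> (real \<times> real \<Rightarrow> real) \<Rightarrow> (real \<times> real \<times> real \<Rightarrow> real) \<Rightarrow> (real \<times> real \<times> real \<Rightarrow> real) \<Rightarrow> real"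
where
  "R_initial xL xR lam1 lam2 \<epsilon> \<rho>IC jIC wIC \<rho>N jN wN =
     lam1 / measure lborel {xL<..<xR} * (LBINT x:{xL<..<xR}. (\<rho>N (0, x) - \<rho>IC x)\<^sup>2)
   + lam2 / measure lborel ({xL<..<xR} \<times> \<Omega>plus) *
       (LBINT x:{xL<..<xR}. LBINT v:\<Omega>plus.
          \<epsilon>\<^sup>2 * (jN (0, x, v) - jIC (x, v))\<^sup>2 + \<epsilon>^4 * (wN (0, x, v) - wIC (x, v))\<^sup>2)"

text \<open>The boundary \<open>{xL, xR}\<close> carries the counting measure.\<close>

definition R_boundary ::
  "real \<Rightarrow> real \<Rightarrow> real \<Rightarrow> real \<Rightarrow> real
   \<Rightarrow> (real \<times> real \<Rightarrow> real) \<Rightarrow> (real \<times> real \<times> real \<Rightarrow> real) \<Rightarrow> (real \<times> real \<times> real \<Rightarrow> real)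
   \<Rightarrow> (real \<times> real \<Rightarrow> real) \<Rightarrow> (real \<times> real \<times> real \<Rightarrow> real) \<Rightarrow> (real \<times> real \<times> real \<Rightarrow> real) \<Rightarrow> real"
where
  "R_boundary T xL xR lam3 lam4 \<rho>BC jBC wBC \<rho>N jN wN =
     lam3 / (measure lborel {0<..<T} * real (card {xL, xR})) *
       (LBINT t:{0<..<T}. \<Sum>s\<in>{xL, xR}. (\<rho>N (t, s) - \<rho>BC (t, s))\<^sup>2)
   + lam4 / (measure lborel {0<..<T} * real (card {xL, xR}) * measure lborel \<Omega>plus) *
       (LBINT t:{0<..<T}. \<Sum>s\<in>{xL, xR}. LBINT v:\<Omega>plus.
          (wN (t, s, v) - wBC (t, s, v))\<^sup>2 + (jN (t, s, v) - jBC (t, s, v))\<^sup>2)"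

definition R_APNN ::
  "real \<Rightarrow> real \<Rightarrow> real \<Rightarrow> real \<Rightarrow> real \<Rightarrow> real \<Rightarrow> real \<Rightarrow> real
   \<Rightarrow> (real \<Rightarrow> real) \<Rightarrow> (real \<times> real \<Rightarrow> real) \<Rightarrow> (real \<times> real \<Rightarrow> real)
   \<Rightarrow> (real \<times> real \<Rightarrow> real) \<Rightarrow> (real \<times> real \<times> real \<Rightarrow> real) \<Rightarrow> (real \<times> real \<times> real \<Rightarrow> real)
   \<Rightarrow> (real \<times> real \<Rightarrow> real) \<Rightarrow> (real \<times> real \<times> real \<Rightarrow> real) \<Rightarrow> (real \<times> real \<times> real \<Rightarrow> real) \<Rightarrow> real"
where
  "R_APNN T xL xR lam1 lam2 lam3 lam4 \<epsilon> \<rho>IC jIC wIC \<rho>BC jBC wBC \<rho>N jN wN =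
     R_residual T xL xR \<epsilon> \<rho>N jN wN
   + R_initial xL xR lam1 lam2 \<epsilon> \<rho>IC jIC wIC \<rho>N jN wN
   + R_boundary T xL xR lam3 lam4 \<rho>BC jBC wBC \<rho>N jN wN"

definition recon ::
  "real \<Rightarrow> (real \<times> real \<Rightarrow> real) \<Rightarrow> (real \<times> real \<times> real \<Rightarrow> real) \<Rightarrow> (real \<times> real \<times> real \<Rightarrow> real)
   \<Rightarrow> real \<times> real \<times> real \<Rightarrow> real" where
  "recon \<epsilon> \<rho> j w = (\<lambda>(t, x, v). \<rho> (t, x) + \<epsilon> * j (t, x, v) + \<epsilon>\<^sup>2 * w (t, x, v))"

definition R_total ::
  "real \<Rightarrow> real \<Rightarrow> real \<Rightarrow> real
   \<Rightarrow> (real \<times> real \<Rightarrow> real) \<Rightarrow> (real \<times> real \<times> real \<Rightarrow> real) \<Rightarrow> (real \<times> real \<times> real \<Rightarrow> real)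
   \<Rightarrow> (real \<times> real \<Rightarrow> real) \<Rightarrow> (real \<times> real \<times> real \<Rightarrow> real) \<Rightarrow> (real \<times> real \<times> real \<Rightarrow> real) \<Rightarrow> real"
where
  "R_total T xL xR \<epsilon> \<rho> j w \<rho>N jN wN =
     (L2_norm_on (TDV T xL xR) (\<lambda>z. recon \<epsilon> \<rho> j w z - recon \<epsilon> \<rho>N jN wN z))\<^sup>2"

end

theory Submission
  imports Defs
begin

text \<open>Let \<open>a\<close>, \<open>b\<close>, \<open>c\<close> be the errors in \<open>\<rho>\<close>, \<open>j\<close>, \<open>w\<close>; they solve the system with the negative
  residuals \<open>e1\<close>, \<open>e2\<close>, \<open>e3\<close> as sources. The even part \<open>R = a + \<epsilon>\<^sup>2 c\<close> and the odd part \<open>\<epsilon> b\<close> satisfy \<open>R\<^sub>t + v b\<^sub>x + c = e1 + e3\<close> and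
  \<open>\<epsilon>\<^sup>2 b\<^sub>t + v R\<^sub>x + b = e2\<close>, so the energy \<open>R\<^sup>2 + \<epsilon>\<^sup>2 b\<^sup>2\<close> is dissipated up to sources, boundary terms
  controlled by the loss, and a coupling of \<open>R\<close> with the velocity mean \<open>m\<close> of \<open>c\<close>. As
  \<open>\<epsilon>\<^sup>2 m\<^sub>t + m\<close> is a residual, \<open>m\<close> is an initial layer plus a controlled remainder, and suitable time weights
  absorb it uniformly in \<open>\<epsilon>\<close>. The resulting constant is uniform; the factor \<open>1 / \<epsilon>\<close> is only used
  through \<open>1 / \<epsilon> \<ge> 1\<close>.

  The estimate is proved for continuously differentiable fields and applied to smooth approximations of the
  exact solution minus the networks. Only \<open>(x + y)\<^sup>2 \<le> 2 x\<^sup>2 + 2 y\<^sup>2\<close> is needed to pass to the limit.\<close>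

section \<open>Square-integrable functions and iterated integrals\<close>

text \<open>The obstacle is the mean \<open>m\<close> of \<open>c\<close>. Multiplying the equation
  for \<open>R\<close> by \<open>R\<close> leaves \<open>- R * m\<close>, and apart from face terms
  the loss sees \<open>m\<close> only through \<open>\<epsilon>^4 * m^2\<close> at time 0 and
  through the average of \<open>e3\<close>. Adding \<open>s * \<epsilon>^2 * m^2 / 2\<close> to the
  energy, with a time weight \<open>s\<close>, produces the decay \<open>- s * m^2\<close>. The
  initial loss pays for \<open>s\<close> of order \<open>\<epsilon>^2\<close> only, whereas
  absorbing \<open>- R * m\<close> at a cost of order \<open>R^2\<close> requires \<open>s\<close>
  of order 1, so no constant weight works. The choice is \<open>s = 1 / (1 + q)\<close> with
  \<open>q = exp (- t / \<epsilon>^2) / \<epsilon>^2\<close>: it starts at order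
  \<open>\<epsilon>^2\<close> and approaches 1 after the layer. The absorption then costs
  \<open>(1 + q) * R^2\<close>, and since \<open>q\<close> has time integral at most 1, the
  exponential weight that pays for this varies by a factor depending on \<open>T\<close> only. In
  the code, \<open>s\<close> is \<open>kap * \<epsilon>^2\<close> and the exponential weight is
  \<open>chi\<close>.\<close>

lemma set_integrable_compact_subset:
  fixes f :: "'a::euclidean_space \<Rightarrow> real"
  assumes "compact K" "continuous_on K f" "S \<subseteq> K" "S \<in> sets borel"
  shows "set_integrable lborel S f"
proof -
  have "set_integrable lborel K f"
    unfolding set_integrable_def using borel_integrable_compact[OF assms(1,2)] by simp
  from set_integrable_subset[OF this] show ?thesis using assms(3,4) by simp
qed

lemma set_borel_measurable_compact_subset:
  fixes f :: "'a::euclidean_space \<Rightarrow> real"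
  assumes "compact K" "continuous_on K f" "S \<subseteq> K" "S \<in> sets borel"
  shows "set_borel_measurable lborel S f"
  using set_integrable_compact_subset[OF assms]
  unfolding set_integrable_def set_borel_measurable_def by auto

text \<open>Fubini in both orders for set integrals. The last two claims are kept because slices of
  an integrable function are integrable only for almost every base point.\<close>

lemma set_integral_Times:
  fixes f :: "'a::euclidean_space \<times> 'b::euclidean_space \<Rightarrow> real"
  assumes "set_integrable lborel (A \<times> B) f"
  shows "(LINT z:A\<times>B|lborel. f z) = (LINT x:A|lborel. LINT y:B|lborel. f (x, y))"
    and "(LINT z:A\<times>B|lborel. f z) = (LINT y:B|lborel. LINT x:A|lborel. f (x, y))"
    and "set_integrable lborel A (\<lambda>x. LINT y:B|lborel. f (x, y))"
    and "AE x in lborel. x \<in> A \<longrightarrow> set_integrable lborel B (\<lambda>y. f (x, y))"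
proof -
  let ?g = "\<lambda>z. indicator (A \<times> B) z *\<^sub>R f z"
  have g: "integrable (lborel \<Otimes>\<^sub>M lborel) ?g"
    using assms unfolding set_integrable_def lborel_prod .
  have g': "integrable (lborel \<Otimes>\<^sub>M lborel) (case_prod (\<lambda>x y. ?g (x, y)))"
    using g by (simp only: split_beta' prod.collapse)
  have 1: "(\<integral>y. ?g (x, y) \<partial>lborel) = indicator A x *\<^sub>R (LINT y:B|lborel. f (x, y))" for x
    by (simp add: set_lebesgue_integral_def indicator_times mult.assoc)
  have 2: "(\<integral>x. ?g (x, y) \<partial>lborel) = indicator B y *\<^sub>R (LINT x:A|lborel. f (x, y))" for y
    by (simp add: set_lebesgue_integral_def indicator_times mult.assoc
        mult.left_commute[of "indicator A _" "indicator B y"])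
  show "(LINT z:A\<times>B|lborel. f z) = (LINT x:A|lborel. LINT y:B|lborel. f (x, y))"
    using lborel_pair.integral_fst'[OF g] 1 by (simp add: set_lebesgue_integral_def lborel_prod)
  show "(LINT z:A\<times>B|lborel. f z) = (LINT y:B|lborel. LINT x:A|lborel. f (x, y))"
    using lborel_pair.integral_snd[OF g'] 2
    by (simp add: set_lebesgue_integral_def lborel_prod split_beta')
  show "set_integrable lborel A (\<lambda>x. LINT y:B|lborel. f (x, y))"
    using lborel_pair.integrable_fst'[OF g] unfolding 1 set_integrable_def .
  show "AE x in lborel. x \<in> A \<longrightarrow> set_integrable lborel B (\<lambda>y. f (x, y))"
    using lborel_pair.AE_integrable_fst'[OF g]
    by eventually_elim (auto simp: set_integrable_def indicator_times)
qed

section \<open>Regrouping of triple products and null sets\<close>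

lemma emeasure_lborel_Times:
  fixes A :: "'a::euclidean_space set" and B :: "'b::euclidean_space set"
  assumes "A \<in> sets borel" "B \<in> sets borel"
  shows "emeasure lborel (A \<times> B) = emeasure lborel A * emeasure lborel B"
  using lborel.emeasure_pair_measure_Times[of A lborel B] assms by (simp add: lborel_prod)

text \<open>Points are nested as \<open>(t, (x, v))\<close>, but a velocity average integrates the
  last variable over the base \<open>(t, x)\<close>. Regrouping preserves Lebesgue measure because
  it maps boxes to boxes of the same volume, which determines the measure.\<close>

lemma lborel_assoc:
  "distr (lborel :: (('a::euclidean_space \<times> 'b::euclidean_space) \<times> 'c::euclidean_space) measure) borel
     (\<lambda>((x, y), z). (x, y, z)) = lborel"
proof (rule lborel_eqI[symmetric])
  fix l u :: "'a \<times> 'b \<times> 'c"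
  assume lu: "\<And>b. b \<in> Basis \<Longrightarrow> l \<bullet> b \<le> u \<bullet> b"
  obtain l1 l2 l3 u1 u2 u3 where l: "l = (l1, l2, l3)" and u: "u = (u1, u2, u3)"
    by (metis prod.exhaust)
  have boxes: "(\<lambda>((x, y), z). (x, y, z)) -` box l u = (box l1 u1 \<times> box l2 u2) \<times> box l3 u3"
    by (auto simp: l u mem_box Basis_prod_def ball_Un)
  have m: "(\<lambda>((x, y), z). (x, y, z)) \<in> borel_measurable
      (lborel :: (('a \<times> 'b) \<times> 'c) measure)"
    unfolding split_beta' by (simp, intro borel_measurable_continuous_onI continuous_intros)
  have "emeasure lborel ((box l1 u1 \<times> box l2 u2) \<times> box l3 u3)
      = emeasure lborel (box l1 u1) * emeasure lborel (box l2 u2) * emeasure lborel (box l3 u3)"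
    by (simp add: emeasure_lborel_Times borel_Times open_Times)
  also have "\<dots> = emeasure lborel (box l1 u1 \<times> box l2 u2 \<times> box l3 u3)"
    by (simp add: emeasure_lborel_Times borel_Times open_Times mult.assoc)
  also have "box l1 u1 \<times> box l2 u2 \<times> box l3 u3 = box l u"
    by (auto simp: l u mem_box Basis_prod_def ball_Un)
  also have "emeasure lborel (box l u) = (\<Prod>b\<in>Basis. (u - l) \<bullet> b)"
    using lu by (simp add: emeasure_lborel_box)
  finally show "emeasure (distr lborel borel (\<lambda>((x, y), z). (x, y, z))) (box l u)
     = (\<Prod>b\<in>Basis. (u - l) \<bullet> b)"
    by (subst emeasure_distr[OF m]) (simp_all add: boxes)
qed auto

lemma set_integral_assoc:
  fixes f :: "'a::euclidean_space \<times> 'b::euclidean_space \<times> 'c::euclidean_space \<Rightarrow> real"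
  assumes "set_borel_measurable lborel (A \<times> B \<times> C) f"
  shows "set_integrable lborel (A \<times> B \<times> C) f
      \<longleftrightarrow> set_integrable lborel ((A \<times> B) \<times> C) (\<lambda>((x, y), z). f (x, y, z))"
    and "(LINT z:A\<times>B\<times>C|lborel. f z) = (LINT z:(A\<times>B)\<times>C|lborel. (\<lambda>((x, y), z). f (x, y, z)) z)"
proof -
  let ?h = "\<lambda>((x, y), z). (x :: 'a, y :: 'b, z :: 'c)"
  let ?g = "\<lambda>z. indicator (A \<times> B \<times> C) z *\<^sub>R f z"
  have m: "?h \<in> measurable lborel borel"
    unfolding split_beta' by (simp, intro borel_measurable_continuous_onI continuous_intros)
  have g: "?g \<in> borel_measurable borel"
    using assms by (simp add: set_borel_measurable_def)
  have eq: "?g (?h z) = indicator ((A \<times> B) \<times> C) z *\<^sub>R (\<lambda>((x, y), z). f (x, y, z)) z" for z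
    by (auto simp: indicator_def split: prod.splits)
  show "set_integrable lborel (A \<times> B \<times> C) f
      \<longleftrightarrow> set_integrable lborel ((A \<times> B) \<times> C) (\<lambda>((x, y), z). f (x, y, z))"
    using integrable_distr_eq[OF m g] unfolding lborel_assoc set_integrable_def eq .
  show "(LINT z:A\<times>B\<times>C|lborel. f z) = (LINT z:(A\<times>B)\<times>C|lborel. (\<lambda>((x, y), z). f (x, y, z)) z)"
    using integral_distr[OF m g] unfolding lborel_assoc set_lebesgue_integral_def eq .
qed

text \<open>A cylinder over a null set is a null set.\<close>

lemma AE_lborel_fst:
  assumes "AE x in (lborel :: 'a::euclidean_space measure). P x"
  shows "AE z in (lborel :: ('a \<times> 'b::euclidean_space) measure). P (fst z)"
proof -
  from assms obtain N where N: "{x. \<not> P x} \<subseteq> N" "N \<in> null_sets lborel"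
    by (auto elim: AE_E simp: null_setsI)
  have "N \<times> (UNIV :: 'b set) \<in> null_sets (lborel \<Otimes>\<^sub>M lborel)"
    using N(2) by (simp add: null_sets_def lborel.emeasure_pair_measure_Times)
  then show ?thesis
    unfolding lborel_prod by (rule AE_I') (use N(1) in auto)
qed

lemma AE_lborel_assoc:
  assumes "AE z in (lborel :: (('a::euclidean_space \<times> 'b::euclidean_space) \<times> 'c::euclidean_space) measure).
      P (fst (fst z), snd (fst z), snd z)"
  shows "AE z in lborel. P z"
proof -
  let ?h = "\<lambda>(x, y, z). ((x :: 'a, y :: 'b), z :: 'c)"
  let ?k = "\<lambda>((x, y), z). (x :: 'a, y :: 'b, z :: 'c)"
  from assms obtain N where N: "{z. \<not> P (?k z)} \<subseteq> N" "N \<in> null_sets lborel"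
    by (auto elim!: AE_E simp: null_setsI split_beta')
  have mh: "?h \<in> measurable borel borel" and mk: "?k \<in> measurable lborel borel"
    unfolding split_beta' by (simp_all, (intro borel_measurable_continuous_onI continuous_intros)+)
  have sets: "?h -` N \<in> sets borel"
    using measurable_sets[OF mh, of N] N(2) by auto
  have "emeasure lborel (?h -` N) = emeasure lborel (?k -` (?h -` N))"
    using emeasure_distr[OF mk sets] unfolding lborel_assoc by simp
  also have "?k -` (?h -` N) = N" by (auto split: prod.splits)
  finally have "?h -` N \<in> null_sets lborel"
    using N(2) sets by (simp add: null_sets_def)
  then show ?thesis
    by (rule AE_I') (use N(1) in force)
qed

section \<open>Squared norms and their quasi-triangle inequality\<close>

definition sqint :: "'a::euclidean_space set \<Rightarrow> ('a \<Rightarrow> real) \<Rightarrow> real" where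
  "sqint S f = (LINT z:S|lborel. (f z)\<^sup>2)"

lemma sqint_nonneg [simp]: "0 \<le> sqint S f"
  unfolding sqint_def set_lebesgue_integral_def by (rule Bochner_Integration.integral_nonneg) simp

lemma L2_norm_on_power2: "(L2_norm_on S f)\<^sup>2 = sqint S f"
  unfolding L2_norm_on_def sqint_def[symmetric] by simp

lemma sq_add_le: "((x::real) + y)\<^sup>2 \<le> 2 * x\<^sup>2 + 2 * y\<^sup>2"
  using zero_le_power2[of "x - y"] by (simp add: power2_sum power2_diff)

lemma L2_onD:
  assumes "L2_on S f"
  shows "(\<lambda>z. indicator S z * f z) \<in> borel_measurable lborel"
    and "set_integrable lborel S (\<lambda>z. (f z)\<^sup>2)"
  using assms by (auto simp: L2_on_def set_borel_measurable_def)

lemma L2_on_boundI: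
  assumes "(\<lambda>z. indicator S z * f z) \<in> borel_measurable lborel"
    and "set_integrable lborel S g" and "\<And>z. z \<in> S \<Longrightarrow> (f z)\<^sup>2 \<le> g z"
  shows "L2_on S f"
proof -
  have eq: "indicator S z *\<^sub>R (f z)\<^sup>2 = (indicator S z * f z)\<^sup>2" for z
    by (simp add: indicator_def)
  have "set_borel_measurable lborel S (\<lambda>z. (f z)\<^sup>2)"
    unfolding set_borel_measurable_def eq using assms(1) by (rule borel_measurable_power)
  then have "set_integrable lborel S (\<lambda>z. (f z)\<^sup>2)"
    using assms(3) by (intro set_integrable_bound[OF assms(2)]) (auto intro: order_trans[OF _ abs_ge_self])
  with assms(1) show ?thesis by (simp add: L2_on_def set_borel_measurable_def)
qed

lemma L2_on_add:
  assumes "L2_on S f" "L2_on S g"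
  shows "L2_on S (\<lambda>z. f z + g z)"
proof (rule L2_on_boundI)
  show "(\<lambda>z. indicator S z * (f z + g z)) \<in> borel_measurable lborel"
    using borel_measurable_add[OF L2_onD(1)[OF assms(1)] L2_onD(1)[OF assms(2)]]
    by (simp add: distrib_left)
  show "set_integrable lborel S (\<lambda>z. 2 * (f z)\<^sup>2 + 2 * (g z)\<^sup>2)"
    using assms by (intro set_integral_add set_integrable_mult_right L2_onD(2))
qed (rule sq_add_le)

lemma L2_on_cmult:
  assumes "L2_on S f" shows "L2_on S (\<lambda>z. c * f z)"
proof (rule L2_on_boundI)
  show "(\<lambda>z. indicator S z * (c * f z)) \<in> borel_measurable lborel"
    using borel_measurable_times[OF borel_measurable_const L2_onD(1)[OF assms(1)], of c]
    by (simp add: mult.left_commute)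
  show "set_integrable lborel S (\<lambda>z. c\<^sup>2 * (f z)\<^sup>2)"
    using assms by (intro set_integrable_mult_right L2_onD(2))
qed (simp add: power_mult_distrib)

lemma L2_on_diff:
  assumes "L2_on S f" "L2_on S g"
  shows "L2_on S (\<lambda>z. f z - g z)"
  using L2_on_add[OF assms(1) L2_on_cmult[OF assms(2), of "-1"]] by simp

lemma L2_on_compact_subset:
  assumes "compact K" "continuous_on K f" "S \<subseteq> K" "S \<in> sets borel"
  shows "L2_on S f"
  unfolding L2_on_def
  using assms by (auto intro!: set_borel_measurable_compact_subset set_integrable_compact_subset
      continuous_intros)

lemma L2_on_mult_bounded:
  assumes "L2_on S f" "h \<in> borel_measurable borel" "\<And>z. z \<in> S \<Longrightarrow> \<bar>h z\<bar> \<le> 1"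
  shows "L2_on S (\<lambda>z. h z * f z)" and "sqint S (\<lambda>z. h z * f z) \<le> sqint S f"
proof -
  have le: "(h z * f z)\<^sup>2 \<le> (f z)\<^sup>2" if "z \<in> S" for z
  proof -
    have "(h z)\<^sup>2 \<le> 1" using assms(3)[OF that] by (simp add: abs_square_le_1)
    then have "(h z)\<^sup>2 * (f z)\<^sup>2 \<le> 1 * (f z)\<^sup>2" by (rule mult_right_mono) simp
    then show ?thesis by (simp add: power_mult_distrib)
  qed
  have h: "h \<in> borel_measurable lborel" using assms(2) by simp
  show L: "L2_on S (\<lambda>z. h z * f z)"
  proof (rule L2_on_boundI[OF _ L2_onD(2)[OF assms(1)] le])
    show "(\<lambda>z. indicator S z * (h z * f z)) \<in> borel_measurable lborel"
      using borel_measurable_times[OF h L2_onD(1)[OF assms(1)]] by (simp add: mult.left_commute)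
  qed
  show "sqint S (\<lambda>z. h z * f z) \<le> sqint S f"
    unfolding sqint_def
    by (rule set_integral_mono[OF L2_onD(2)[OF L] L2_onD(2)[OF assms(1)] le])
qed

text \<open>Square integrability of both summands is essential: the integral of a non-integrable
  function is 0 by convention, which would make the right-hand side meaningless.\<close>

lemma sqint_add_le:
  assumes "L2_on S f" "L2_on S g"
  shows "sqint S (\<lambda>z. f z + g z) \<le> 2 * sqint S f + 2 * sqint S g"
proof -
  have "sqint S (\<lambda>z. f z + g z) \<le> (LINT z:S|lborel. 2 * (f z)\<^sup>2 + 2 * (g z)\<^sup>2)"
    unfolding sqint_def
    using assms by (intro set_integral_mono sq_add_le L2_onD(2) L2_on_add set_integral_add
        set_integrable_mult_right)
  also have "\<dots> = 2 * sqint S f + 2 * sqint S g"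
    unfolding sqint_def using assms by (subst set_integral_add(2)) (auto intro!: L2_onD(2))
  finally show ?thesis .
qed

lemma sqint_cmult: "sqint S (\<lambda>z. c * f z) = c\<^sup>2 * sqint S f"
  by (simp add: sqint_def power_mult_distrib)

lemma sqint_diff_commute: "sqint S (\<lambda>z. f z - g z) = sqint S (\<lambda>z. g z - f z)"
  by (simp add: sqint_def power2_commute)

lemma sqint_diff_le:
  assumes "L2_on S f" "L2_on S g"
  shows "sqint S (\<lambda>z. f z - g z) \<le> 2 * sqint S f + 2 * sqint S g"
  using sqint_add_le[OF assms(1) L2_on_cmult[OF assms(2), of "-1"]] sqint_cmult[of S "-1" g] by simp

lemma sqint_triangle:
  assumes "L2_on S f" "L2_on S g" "L2_on S h"
  shows "sqint S (\<lambda>z. f z - h z) \<le> 2 * sqint S (\<lambda>z. f z - g z) + 2 * sqint S (\<lambda>z. g z - h z)"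
  using sqint_add_le[OF L2_on_diff[OF assms(1,2)] L2_on_diff[OF assms(2,3)]] by simp

lemma sqint_cong_AE:
  assumes "L2_on S f" "L2_on S g" "AE z in lborel. z \<in> S \<longrightarrow> f z = g z"
  shows "sqint S f = sqint S g"
  unfolding sqint_def set_lebesgue_integral_def
proof (rule integral_cong_AE)
  show "AE z in lborel. indicator S z *\<^sub>R (f z)\<^sup>2 = indicator S z *\<^sub>R (g z)\<^sup>2"
    using assms(3) by eventually_elim (simp add: indicator_def)
qed (use L2_onD(2)[OF assms(1)] L2_onD(2)[OF assms(2)] in \<open>auto simp: set_integrable_def\<close>)

text \<open>Pointwise \<open>\<bar>f\<bar> \<le> 1 + f^2\<close>, and the constant 1 is integrable
  on a set of finite measure.\<close>

lemma L2_on_imp_set_integrable: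
  assumes "L2_on S f" "S \<in> sets borel" "emeasure lborel S < \<infinity>"
  shows "set_integrable lborel S f"
proof -
  have "set_integrable lborel S (\<lambda>z. 1 + (f z)\<^sup>2)"
    using assms by (intro set_integral_add(1) L2_onD(2)) (simp add: set_integrable_def)
  moreover have "set_borel_measurable lborel S f" using assms(1) by (simp add: L2_on_def)
  moreover have "norm (f z) \<le> norm (1 + (f z)\<^sup>2)" for z
    using zero_le_power2[of "\<bar>f z\<bar> - 1"] by (simp add: power2_diff)
  ultimately show ?thesis
    by (rule set_integrable_bound[where f = "\<lambda>z. 1 + (f z)\<^sup>2", OF _ _ AE_I2[OF impI]])
qed

lemma L2_on_assoc:
  fixes f :: "'a::euclidean_space \<times> 'b::euclidean_space \<times> 'c::euclidean_space \<Rightarrow> real"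
  shows "L2_on (A \<times> B \<times> C) f \<longleftrightarrow> L2_on ((A \<times> B) \<times> C) (\<lambda>((x, y), z). f (x, y, z))" (is "?P \<longleftrightarrow> ?Q")
    and "L2_on (A \<times> B \<times> C) f \<Longrightarrow>
      sqint (A \<times> B \<times> C) f = sqint ((A \<times> B) \<times> C) (\<lambda>((x, y), z). f (x, y, z))"
proof -
  let ?h = "\<lambda>(x, y, z). ((x :: 'a, y :: 'b), z :: 'c)"
  let ?k = "\<lambda>((x, y), z). (x :: 'a, y :: 'b, z :: 'c)"
  let ?f = "\<lambda>((x, y), z). f (x, y, z)"
  have mh: "?h \<in> measurable borel borel" and mk: "?k \<in> measurable borel borel"
    unfolding split_beta' by (intro borel_measurable_continuous_onI continuous_intros)+
  have eqk: "(\<lambda>z. indicator ((A \<times> B) \<times> C) z * ?f z)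
      = (\<lambda>z. (\<lambda>z. indicator (A \<times> B \<times> C) z * f z) (?k z))"
    by (auto simp: indicator_def fun_eq_iff)
  have eqh: "(\<lambda>z. indicator (A \<times> B \<times> C) z * f z)
      = (\<lambda>z. (\<lambda>z. indicator ((A \<times> B) \<times> C) z * ?f z) (?h z))"
    by (auto simp: indicator_def fun_eq_iff)
  have 1: "(\<lambda>z. indicator ((A \<times> B) \<times> C) z * ?f z) \<in> borel_measurable borel"
    if "(\<lambda>z. indicator (A \<times> B \<times> C) z * f z) \<in> borel_measurable borel"
    unfolding eqk by (rule measurable_compose[OF mk that])
  have 2: "(\<lambda>z. indicator (A \<times> B \<times> C) z * f z) \<in> borel_measurable borel"
    if "(\<lambda>z. indicator ((A \<times> B) \<times> C) z * ?f z) \<in> borel_measurable borel"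
    by (subst eqh) (rule measurable_compose[OF mh that])
  have m: "set_borel_measurable lborel (A \<times> B \<times> C) f
      \<longleftrightarrow> set_borel_measurable lborel ((A \<times> B) \<times> C) ?f"
    unfolding set_borel_measurable_def real_scaleR_def using 1 2 by (intro iffI) simp_all
  have m2: "set_borel_measurable lborel (A \<times> B \<times> C) (\<lambda>z. (f z)\<^sup>2)"
    if "set_borel_measurable lborel (A \<times> B \<times> C) f"
  proof -
    have "indicator S z *\<^sub>R (f z)\<^sup>2 = (indicator S z *\<^sub>R f z)\<^sup>2" for z S
      by (simp add: indicator_def)
    then show ?thesis
      using that unfolding set_borel_measurable_def by (simp only: borel_measurable_power)
  qed
  have sq: "(\<lambda>((x, y), z). (f (x, y, z))\<^sup>2) = (\<lambda>z. (?f z)\<^sup>2)" by (simp add: fun_eq_iff)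
  show "?P \<longleftrightarrow> ?Q"
    unfolding L2_on_def using m set_integral_assoc(1)[OF m2] unfolding sq by blast
  assume "L2_on (A \<times> B \<times> C) f"
  then have "set_borel_measurable lborel (A \<times> B \<times> C) f" by (simp add: L2_on_def)
  from set_integral_assoc(2)[OF m2[OF this]]
  show "sqint (A \<times> B \<times> C) f = sqint ((A \<times> B) \<times> C) ?f"
    unfolding sqint_def sq .
qed

section \<open>Velocity averages and functions constant in the velocity\<close>

lemma vavg_square_le:
  assumes "L2_on \<Omega>plus q"
  shows "(vavg q)\<^sup>2 \<le> vavg (\<lambda>v. (q v)\<^sup>2)"
proof -
  define \<mu> where "\<mu> = vavg q"
  have one: "set_integrable lborel \<Omega>plus (\<lambda>v. c::real)" "(LINT v:\<Omega>plus|lborel. c) = c" for c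
    by (simp_all add: set_integrable_def set_lebesgue_integral_def)
  have q: "set_integrable lborel \<Omega>plus q"
    using assms by (rule L2_on_imp_set_integrable) simp_all
  \<comment> \<open>Jensen's inequality in the form of a nonnegative variance;
    \<open>\<Omega>plus\<close> has measure 1, so constants average to themselves.\<close>
  have "0 \<le> sqint \<Omega>plus (\<lambda>v. q v - \<mu>)" by simp
  also have "\<dots> = (LINT v:\<Omega>plus|lborel. ((q v)\<^sup>2 - 2 * \<mu> * q v) + \<mu>\<^sup>2)"
    unfolding sqint_def by (simp add: power2_diff algebra_simps)
  also have "\<dots> = vavg (\<lambda>v. (q v)\<^sup>2) - 2 * \<mu> * vavg q + \<mu>\<^sup>2"
    unfolding vavg_def using q L2_onD(2)[OF assms] one
    by (simp add: set_integral_add set_integral_diff)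
  finally show ?thesis by (simp add: \<mu>_def power2_eq_square)
qed

text \<open>Averaging is a contraction by Jensen on almost every slice. On the remaining slices the
  average is whatever the integral defaults to, which is harmless since they form a null
  set.\<close>

lemma L2_on_vavg:
  fixes q :: "'a::euclidean_space \<times> real \<Rightarrow> real"
  assumes "L2_on (S \<times> \<Omega>plus) q"
  shows "L2_on S (\<lambda>y. vavg (\<lambda>v. q (y, v)))"
    and "sqint S (\<lambda>y. vavg (\<lambda>v. q (y, v))) \<le> sqint (S \<times> \<Omega>plus) q"
    and "AE y in lborel. y \<in> S \<longrightarrow> L2_on \<Omega>plus (\<lambda>v. q (y, v))"
proof -
  let ?m = "\<lambda>y. vavg (\<lambda>v. q (y, v))"
  note sq = L2_onD(2)[OF assms]
  have meas: "(\<lambda>z. indicator (S \<times> \<Omega>plus) z * q z) \<in> borel_measurable (lborel \<Otimes>\<^sub>M lborel)"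
    using L2_onD(1)[OF assms] unfolding lborel_prod .
  show slice: "AE y in lborel. y \<in> S \<longrightarrow> L2_on \<Omega>plus (\<lambda>v. q (y, v))"
    using set_integral_Times(4)[OF sq]
  proof eventually_elim
    case (elim y)
    show ?case
    proof
      assume "y \<in> S"
      then show "L2_on \<Omega>plus (\<lambda>v. q (y, v))"
        using elim measurable_Pair2[OF meas, of y]
        by (simp add: L2_on_def set_borel_measurable_def indicator_times)
    qed
  qed
  have "(\<lambda>y. \<integral>v. indicator (S \<times> \<Omega>plus) (y, v) * q (y, v) \<partial>lborel) \<in> borel_measurable lborel"
    using meas by (intro lborel.borel_measurable_lebesgue_integral) (simp add: split_beta')
  then have m: "(\<lambda>y. indicator S y * ?m y) \<in> borel_measurable lborel"
    by (simp add: vavg_def set_lebesgue_integral_def indicator_times mult.assoc)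
  have int: "set_integrable lborel S (\<lambda>y. vavg (\<lambda>v. (q (y, v))\<^sup>2))"
    using set_integral_Times(3)[OF sq] by (simp add: vavg_def)
  have le: "AE y in lborel. y \<in> S \<longrightarrow> (?m y)\<^sup>2 \<le> vavg (\<lambda>v. (q (y, v))\<^sup>2)"
    using slice by eventually_elim (auto intro: vavg_square_le)
  have "(\<lambda>y. indicator S y *\<^sub>R (?m y)\<^sup>2) = (\<lambda>y. (indicator S y * ?m y)\<^sup>2)"
    by (simp add: indicator_def fun_eq_iff)
  then have "set_borel_measurable lborel S (\<lambda>y. (?m y)\<^sup>2)"
    unfolding set_borel_measurable_def using m by simp
  then have i: "set_integrable lborel S (\<lambda>y. (?m y)\<^sup>2)"
    using le by (intro set_integrable_bound[OF int]) (auto elim!: eventually_mono)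
  then show "L2_on S ?m" using m by (simp add: L2_on_def set_borel_measurable_def)
  have "sqint S ?m \<le> (LINT y:S|lborel. vavg (\<lambda>v. (q (y, v))\<^sup>2))"
    unfolding sqint_def using le by (intro set_integral_mono_AE[OF i int]) auto
  also have "\<dots> = sqint (S \<times> \<Omega>plus) q"
    unfolding sqint_def vavg_def by (rule set_integral_Times(1)[OF sq, symmetric])
  finally show "sqint S ?m \<le> sqint (S \<times> \<Omega>plus) q" .
qed

text \<open>The norm is unchanged because \<open>\<Omega>plus\<close> has measure 1. Measurability
  is proved for the product with the indicator, since \<open>p\<close> is only known to be
  measurable on \<open>S\<close>.\<close>

lemma L2_on_lift:
  fixes p :: "'a::euclidean_space \<Rightarrow> real"
  assumes "L2_on S p"
  shows "L2_on (S \<times> \<Omega>plus) (\<lambda>(y, v). p y)"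
    and "sqint (S \<times> \<Omega>plus) (\<lambda>(y, v). p y) = sqint S p"
proof -
  have meas: "(\<lambda>z. indicator S (fst z) * p (fst z)) \<in> borel_measurable (lborel \<Otimes>\<^sub>M lborel)"
    by (rule measurable_compose[OF measurable_fst L2_onD(1)[OF assms]])
  have m: "(\<lambda>z. indicator (S \<times> \<Omega>plus) z * p (fst z)) \<in> borel_measurable (lborel \<Otimes>\<^sub>M lborel)"
  proof -
    have 1: "(\<lambda>z. indicator \<Omega>plus (snd z) :: real) \<in> borel_measurable (lborel \<Otimes>\<^sub>M lborel)"
      by (rule measurable_compose[OF measurable_snd]) simp
    have 2: "(\<lambda>z. indicator (S \<times> \<Omega>plus) z * p (fst z))
        = (\<lambda>z. indicator \<Omega>plus (snd z) * (indicator S (fst z) * p (fst z)))"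
      by (auto simp: indicator_def mem_Times_iff)
    show ?thesis unfolding 2 by (rule borel_measurable_times[OF 1 meas])
  qed
  have "integrable (lborel \<Otimes>\<^sub>M lborel) (\<lambda>z. indicator (S \<times> \<Omega>plus) z *\<^sub>R (p (fst z))\<^sup>2)"
  proof (rule lborel_pair.Fubini_integrable)
    have "(\<lambda>z. indicator (S \<times> \<Omega>plus) z *\<^sub>R (p (fst z))\<^sup>2)
        = (\<lambda>z. (indicator (S \<times> \<Omega>plus) z * p (fst z))\<^sup>2)"
      by (simp add: indicator_def fun_eq_iff)
    then show "(\<lambda>z. indicator (S \<times> \<Omega>plus) z *\<^sub>R (p (fst z))\<^sup>2) \<in> borel_measurable (lborel \<Otimes>\<^sub>M lborel)"
      using m by simp
    show "integrable lborel (\<lambda>y. \<integral>v. norm (indicator (S \<times> \<Omega>plus) (y, v) *\<^sub>R (p (fst (y, v)))\<^sup>2) \<partial>lborel)"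
      using L2_onD(2)[OF assms]
      by (simp add: set_integrable_def indicator_times abs_mult mult.assoc mult.left_commute)
    show "AE y in lborel. integrable lborel (\<lambda>v. indicator (S \<times> \<Omega>plus) (y, v) *\<^sub>R (p (fst (y, v)))\<^sup>2)"
      by (simp add: indicator_times mult.assoc)
  qed
  then have i: "set_integrable lborel (S \<times> \<Omega>plus) (\<lambda>z. (p (fst z))\<^sup>2)"
    by (simp add: set_integrable_def lborel_prod)
  then show "L2_on (S \<times> \<Omega>plus) (\<lambda>(y, v). p y)"
    using m by (simp add: L2_on_def set_borel_measurable_def split_beta' lborel_prod)
  show "sqint (S \<times> \<Omega>plus) (\<lambda>(y, v). p y) = sqint S p"
    using set_integral_Times(1)[OF i]
    by (simp add: sqint_def split_beta' set_lebesgue_integral_def[of _ "\<Omega>plus"])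
qed

section \<open>Smooth functions on the slab\<close>

text \<open>Passing to the gauge integral gives access to continuity in a parameter and to
  differentiation under the integral sign.\<close>

lemma vavg_eq_integral:
  assumes "continuous_on {0..1} g"
  shows "vavg g = integral {0..1} g"
  unfolding vavg_def
  using set_borel_integral_eq_integral(2)[of "{0..1}" g] borel_integrable_atLeastAtMost'[OF assms]
  by simp

lemma continuous_on_vavg:
  assumes "continuous_on (K \<times> {0..1}) (\<lambda>(y, v). h y v)"
  shows "continuous_on K (\<lambda>y. vavg (h y))"
proof -
  have "continuous_on K (\<lambda>y. integral (cbox 0 1) (h y))"
    using assms by (intro integral_continuous_on_param) simp
  moreover have "continuous_on {0..1} (h y)" if "y \<in> K" for y
  proof -
    have "continuous_on {0..1} (\<lambda>v. (\<lambda>(y, v). h y v) (y, v))"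
      by (rule continuous_on_compose2[OF assms continuous_on_Pair[OF continuous_on_const continuous_on_id]])
        (use that in auto)
    then show ?thesis by simp
  qed
  ultimately show ?thesis
    by (subst continuous_on_cong[OF refl vavg_eq_integral]) auto
qed

lemma has_real_derivative_vavg:
  assumes deriv: "\<And>s v. s \<in> {0..T} \<Longrightarrow> v \<in> {0..1} \<Longrightarrow>
      ((\<lambda>s. c s v) has_real_derivative c' s v) (at s within {0..T})"
    and c: "\<And>s. s \<in> {0..T} \<Longrightarrow> continuous_on {0..1} (c s)"
    and c': "continuous_on ({0..T} \<times> {0..1}) (\<lambda>(s, v). c' s v)" and t: "t \<in> {0..T}"
  shows "((\<lambda>s. vavg (c s)) has_real_derivative vavg (c' t)) (at t within {0..T})"
proof -
  have "((\<lambda>s. integral (cbox 0 1) (c s)) has_real_derivative integral (cbox 0 1) (c' t))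
      (at t within {0..T})"
    using deriv c c' t
    by (intro leibniz_rule_field_derivative) (auto intro: integrable_continuous_real)
  moreover have "continuous_on {0..1} (\<lambda>v. (\<lambda>(s, v). c' s v) (t, v))"
    by (rule continuous_on_compose2[OF c' continuous_on_Pair[OF continuous_on_const continuous_on_id]])
      (use t in auto)
  ultimately show ?thesis
    using t c by (auto simp: vavg_eq_integral has_field_derivative_def
        intro: has_derivative_transform[rotated 2])
qed

lemma set_integral_FTC_Ioo:
  fixes F f :: "real \<Rightarrow> real"
  assumes "a \<le> b" "continuous_on {a..b} f"
    and "\<And>x. x \<in> {a..b} \<Longrightarrow> (F has_real_derivative f x) (at x within {a..b})"
  shows "(LINT x:{a<..<b}|lborel. f x) = F b - F a"
proof -
  have "(LBINT x=a..b. f x) = F b - F a"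
    using assms by (intro interval_integral_FTC_finite)
      (auto simp: has_real_derivative_iff_has_vector_derivative)
  then show ?thesis
    using assms(1) by (simp add: interval_lebesgue_integral_def einterval_eq)
qed

text \<open>Swap the integrals and apply the fundamental theorem of calculus in the first variable.
  The compact \<open>K\<close> carries the regularity, the possibly smaller \<open>S\<close> is the
  set of integration.\<close>

lemma set_integral_partial_derivative_fst:
  fixes F F' :: "real \<times> 'b::euclidean_space \<Rightarrow> real"
  assumes "a \<le> b" and K: "compact K" "S \<subseteq> K" "S \<in> sets borel"
    and F': "continuous_on ({a..b} \<times> K) F'"
    and deriv: "\<And>t y. t \<in> {a..b} \<Longrightarrow> y \<in> K \<Longrightarrow>
      ((\<lambda>s. F (s, y)) has_real_derivative F' (t, y)) (at t within {a..b})"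
  shows "(LINT z:{a<..<b} \<times> S|lborel. F' z) = (LINT y:S|lborel. F (b, y) - F (a, y))"
proof -
  have "set_integrable lborel ({a<..<b} \<times> S) F'"
    using K F' by (intro set_integrable_compact_subset[of "{a..b} \<times> K"] compact_Times borel_Times)
      auto
  from set_integral_Times(2)[OF this]
  have "(LINT z:{a<..<b} \<times> S|lborel. F' z) = (LINT y:S|lborel. LINT t:{a<..<b}|lborel. F' (t, y))" .
  also have "\<dots> = (LINT y:S|lborel. F (b, y) - F (a, y))"
  proof (intro set_lebesgue_integral_cong allI impI)
    fix y assume "y \<in> S"
    then have y: "y \<in> K" using K by auto
    have "continuous_on {a..b} (\<lambda>t. F' (t, y))"
      by (rule continuous_on_compose2[OF F']) (use y in \<open>auto intro!: continuous_intros\<close>)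
    then show "(LINT t:{a<..<b}|lborel. F' (t, y)) = F (b, y) - F (a, y)"
      using assms(1) deriv y by (intro set_integral_FTC_Ioo)
  qed (use K in simp)
  finally show ?thesis .
qed

text \<open>\<open>X\<close> and \<open>Y\<close> stand for \<open>R\<^sub>t + v b\<^sub>x\<close> and \<open>\<epsilon>\<^sup>2 b\<^sub>t + v R\<^sub>x\<close>, \<open>H\<close> and \<open>m\<close> for the velocity averages of
  \<open>e3\<close> and \<open>c\<close>. The last two terms vanish after integration over the velocity.\<close>

lemma dissipation_inequality:
  fixes a b c m e1 e2 e3 \<epsilon> q s R X Y H :: real
  assumes q: "0 \<le> q" and s: "s * (1 + q) = 1"
    and R: "R = a + \<epsilon>\<^sup>2 * c" and X: "X = e1 + e3 - c" and Y: "Y = e2 - b"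
  shows "- (2 + q) * (R\<^sup>2 + \<epsilon>\<^sup>2 * b\<^sup>2 + s * \<epsilon>\<^sup>2 * m\<^sup>2) + R * X + b * Y + s\<^sup>2 * q * m\<^sup>2 / 2 + s * m * (H - m)
    \<le> - (R\<^sup>2 / 2 + \<epsilon>\<^sup>2 * b\<^sup>2) + e1\<^sup>2 + e2\<^sup>2 + 2 * e3\<^sup>2 + s * m * (H - e3) - (a + \<epsilon>\<^sup>2 * m) * (c - m)"
proof -
  have s0: "0 < s" using q s by (metis add_pos_nonneg zero_less_mult_pos2 zero_less_one)
  have s1: "s \<le> 1" and sq: "s * q \<le> 1"
    using s s0 mult_nonneg_nonneg[OF less_imp_le[OF s0] q] unfolding distrib_left by linarith+
  \<comment> \<open>Split \<open>c\<close> into its mean and its fluctuation. The middle term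
    integrates to zero over the velocity, because \<open>a\<close> and \<open>m\<close> do not
    depend on it, and the last term has the good sign.\<close>
  have Rc: "R * c = R * m + (a + \<epsilon>\<^sup>2 * m) * (c - m) + \<epsilon>\<^sup>2 * (c - m)\<^sup>2"
    unfolding R by algebra
  \<comment> \<open>The relation between \<open>s\<close> and \<open>q\<close> is made for this
    completed square: the decay of \<open>m^2\<close> has strength \<open>s\<close>, so the price in
    \<open>R^2\<close> is its reciprocal \<open>1 + q\<close>.\<close>
  have 1: "- (R * m) \<le> (1 + q) * R\<^sup>2 + s * m\<^sup>2 / 4"
  proof -
    have "s * ((1 + q) * R + m / 2)\<^sup>2
        = (s * (1 + q)) * ((1 + q) * R\<^sup>2) + (s * (1 + q)) * (R * m) + s * m\<^sup>2 / 4"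
      by (simp add: power2_eq_square field_simps)
    then have "(1 + q) * R\<^sup>2 + R * m + s * m\<^sup>2 / 4 = s * ((1 + q) * R + m / 2)\<^sup>2"
      unfolding s by simp
    also have "\<dots> \<ge> 0" using s0 by simp
    finally show ?thesis by simp
  qed
  have 2: "R * e1 \<le> R\<^sup>2 / 4 + e1\<^sup>2"
    using zero_le_power2[of "R / 2 - e1"] by (simp add: power2_diff power_divide)
  have 3: "R * e3 \<le> R\<^sup>2 / 4 + e3\<^sup>2"
    using zero_le_power2[of "R / 2 - e3"] by (simp add: power2_diff power_divide)
  have 4: "b * e2 - b\<^sup>2 \<le> e2\<^sup>2"
  proof -
    have "b * e2 \<le> b\<^sup>2 + e2\<^sup>2 / 4"
      using zero_le_power2[of "b - e2 / 2"] by (simp add: power2_diff power_divide)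
    moreover have "0 \<le> e2\<^sup>2" by simp
    ultimately show ?thesis by linarith
  qed
  have 5: "s * m * e3 \<le> s * m\<^sup>2 / 4 + e3\<^sup>2"
  proof -
    have "0 \<le> s * (m / 2 - e3)\<^sup>2" using s0 by simp
    moreover have "s * e3\<^sup>2 \<le> e3\<^sup>2" using s1 by (simp add: mult_left_le_one_le s0 less_imp_le)
    ultimately show ?thesis by (simp add: power2_diff power_divide algebra_simps)
  qed
  \<comment> \<open>This is the growth of the weight on \<open>m^2\<close>; since
    \<open>s * q \<le> 1\<close> it uses up half of the decay \<open>s * m^2\<close>.\<close>
  have 6: "s\<^sup>2 * q * m\<^sup>2 / 2 \<le> s * m\<^sup>2 / 2"
  proof -
    have "(s * q) * (s * m\<^sup>2) \<le> 1 * (s * m\<^sup>2)" using sq s0 by (intro mult_right_mono) auto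
    then show ?thesis by (simp add: power2_eq_square algebra_simps)
  qed
  have 7: "0 \<le> (1 + q) * (\<epsilon>\<^sup>2 * b\<^sup>2)" "0 \<le> (2 + q) * (s * \<epsilon>\<^sup>2 * m\<^sup>2)" "0 \<le> \<epsilon>\<^sup>2 * (c - m)\<^sup>2"
    using q s0 by simp_all
  \<comment> \<open>The budgets: of \<open>(2 + q) * R^2\<close>, the part \<open>1 + q\<close> pays
    for the coupling, two quarters pay for \<open>e1\<close> and \<open>e3\<close>, and one half is
    kept. The decay \<open>s * m^2\<close> is spent as 1/4 on the coupling, 1/4 on \<open>e3\<close>
    and 1/2 on the growth of the weight. As \<open>e3\<close> is split off twice, its square gets
    the factor 2.\<close>
  have "- (2 + q) * (R\<^sup>2 + \<epsilon>\<^sup>2 * b\<^sup>2 + s * \<epsilon>\<^sup>2 * m\<^sup>2) + R * X + b * Y + s\<^sup>2 * q * m\<^sup>2 / 2 + s * m * (H - m)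
    = - R\<^sup>2 - (1 + q) * R\<^sup>2 - \<epsilon>\<^sup>2 * b\<^sup>2 - (1 + q) * (\<epsilon>\<^sup>2 * b\<^sup>2) - (2 + q) * (s * \<epsilon>\<^sup>2 * m\<^sup>2)
      + R * e1 + R * e3 - R * c + (b * e2 - b\<^sup>2) + s\<^sup>2 * q * m\<^sup>2 / 2
      + s * m * (H - e3) + s * m * e3 - s * m\<^sup>2"
    unfolding X Y by (simp add: algebra_simps power2_eq_square)
  with 1 2 3 4 5 6 7 show ?thesis unfolding Rc by linarith
qed

section \<open>Integrals over the space-time-velocity slab\<close>

lemma TD_subset: "TD T xL xR \<subseteq> {0..T} \<times> {xL..xR}"
  and TDV_subset: "TDV T xL xR \<subseteq> {0..T} \<times> {xL..xR} \<times> {0..1}"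
  and TD_sets [simp]: "TD T xL xR \<in> sets borel"
  and TDV_sets [simp]: "TDV T xL xR \<in> sets borel"
  by (auto simp: TD_def TDV_def intro!: borel_Times)

lemma compact_boxes:
  "compact ({0..T::real} \<times> {xL..xR::real})" "compact ({0..T::real} \<times> {xL..xR::real} \<times> {0..1::real})"
  by (intro compact_Times compact_Icc)+

lemma set_integrable_TDV:
  fixes f :: "real \<times> real \<times> real \<Rightarrow> real"
  shows "continuous_on ({0..T} \<times> {xL..xR} \<times> {0..1}) f \<Longrightarrow> set_integrable lborel (TDV T xL xR) f"
  by (rule set_integrable_compact_subset[OF compact_boxes(2) _ TDV_subset TDV_sets])

lemma L2_on_TDV:
  "continuous_on ({0..T} \<times> {xL..xR} \<times> {0..1}) f \<Longrightarrow> L2_on (TDV T xL xR) f"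
  by (rule L2_on_compact_subset[OF compact_boxes(2) _ TDV_subset TDV_sets])

lemma L2_on_TD:
  "continuous_on ({0..T} \<times> {xL..xR}) f \<Longrightarrow> L2_on (TD T xL xR) f"
  by (rule L2_on_compact_subset[OF compact_boxes(1) _ TD_subset TD_sets])

lemma L2_on_TDV_lift:
  assumes "L2_on (TD T xL xR) p"
  shows "L2_on (TDV T xL xR) (\<lambda>(t, x, v). p (t, x))"
    and "sqint (TDV T xL xR) (\<lambda>(t, x, v). p (t, x)) = sqint (TD T xL xR) p"
proof -
  let ?p = "\<lambda>(t, x, v). p (t, x)"
  have eq: "(\<lambda>((t, x), v). ?p (t, x, v)) = (\<lambda>(y, v). p y)" by (simp add: fun_eq_iff)
  have TDV: "TDV T xL xR = {0<..<T} \<times> {xL<..<xR} \<times> \<Omega>plus" by (simp add: TDV_def)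
  note lift = L2_on_lift[OF assms, unfolded TD_def]
  show L: "L2_on (TDV T xL xR) ?p"
    unfolding TDV L2_on_assoc(1) eq by (rule lift(1))
  show "sqint (TDV T xL xR) ?p = sqint (TD T xL xR) p"
    using L2_on_assoc(2)[OF L[unfolded TDV]] unfolding eq TDV[symmetric] TD_def[symmetric] L2_on_lift(2)[OF assms] .
qed

lemma L2_on_TD_vavg:
  assumes "L2_on (TDV T xL xR) q"
  shows "L2_on (TD T xL xR) (\<lambda>(t, x). vavg (\<lambda>v. q (t, x, v)))"
    and "sqint (TD T xL xR) (\<lambda>(t, x). vavg (\<lambda>v. q (t, x, v))) \<le> sqint (TDV T xL xR) q"
    and "AE (t, x) in lborel. (t, x) \<in> TD T xL xR \<longrightarrow> L2_on \<Omega>plus (\<lambda>v. q (t, x, v))"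
proof -
  have TDV: "TDV T xL xR = {0<..<T} \<times> {xL<..<xR} \<times> \<Omega>plus" by (simp add: TDV_def)
  note q = assms[unfolded TDV]
  have eq: "(\<lambda>(t, x). vavg (\<lambda>v. q (t, x, v))) = (\<lambda>y. vavg (\<lambda>v. (\<lambda>((t, x), v). q (t, x, v)) (y, v)))"
    by (simp add: fun_eq_iff)
  note va = L2_on_vavg[OF q[unfolded L2_on_assoc(1)]]
  show "L2_on (TD T xL xR) (\<lambda>(t, x). vavg (\<lambda>v. q (t, x, v)))"
    unfolding eq TD_def by (rule va(1))
  show "sqint (TD T xL xR) (\<lambda>(t, x). vavg (\<lambda>v. q (t, x, v))) \<le> sqint (TDV T xL xR) q"
    unfolding eq TD_def TDV L2_on_assoc(2)[OF q] by (rule va(2))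
  show "AE (t, x) in lborel. (t, x) \<in> TD T xL xR \<longrightarrow> L2_on \<Omega>plus (\<lambda>v. q (t, x, v))"
    using va(3) by eventually_elim (auto simp: TD_def)
qed

lemma continuous_on_lift:
  assumes "continuous_on ({0..T} \<times> {xL..xR}) p"
  shows "continuous_on ({0..T} \<times> {xL..xR} \<times> {0..1::real}) (\<lambda>z. p (fst z, fst (snd z)))"
  by (rule continuous_on_compose2[OF assms]) (auto intro!: continuous_intros)

lemma continuous_on_TD_vavg:
  assumes "continuous_on ({0..T} \<times> {xL..xR} \<times> {0..1}) h"
  shows "continuous_on ({0..T} \<times> {xL..xR}) (\<lambda>y. vavg (\<lambda>v. h (fst y, snd y, v)))"
  unfolding split_beta'
  by (rule continuous_on_vavg, unfold split_beta', rule continuous_on_compose2[OF assms])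
    (auto intro!: continuous_intros)

lemma continuous_on_slice:
  assumes "continuous_on ({0..T} \<times> {xL..xR} \<times> {0..1}) h" "t \<in> {0..T}" "x \<in> {xL..xR}"
  shows "continuous_on {0..1} (\<lambda>v. h (t, x, v))"
  by (rule continuous_on_compose2[OF assms(1)]) (use assms in \<open>auto intro!: continuous_intros\<close>)

lemma set_integral_TDV_iterated:
  fixes h :: "real \<times> real \<times> real \<Rightarrow> real"
  assumes "continuous_on ({0..T} \<times> {xL..xR} \<times> {0..1}) h"
  shows "(LINT z:TDV T xL xR|lborel. h z)
    = (LINT t:{0<..<T}|lborel. LINT x:{xL<..<xR}|lborel. LINT v:\<Omega>plus|lborel. h (t, x, v))"
proof -
  have "(LINT z:TDV T xL xR|lborel. h z)
      = (LINT t:{0<..<T}|lborel. LINT z:{xL<..<xR} \<times> \<Omega>plus|lborel. h (t, z))"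
    using set_integrable_TDV[OF assms] unfolding TDV_def by (rule set_integral_Times(1))
  also have "\<dots> = (LINT t:{0<..<T}|lborel. LINT x:{xL<..<xR}|lborel. LINT v:\<Omega>plus|lborel. h (t, x, v))"
  proof (intro set_lebesgue_integral_cong allI impI)
    fix t assume t: "t \<in> {0<..<T}"
    have "continuous_on ({xL..xR} \<times> {0..1}) (\<lambda>z. h (t, z))"
      by (rule continuous_on_compose2[OF assms]) (use t in \<open>auto intro!: continuous_intros\<close>)
    then show "(LINT z:{xL<..<xR} \<times> \<Omega>plus|lborel. h (t, z))
        = (LINT x:{xL<..<xR}|lborel. LINT v:\<Omega>plus|lborel. h (t, x, v))"
      by (intro set_integral_Times(1) set_integrable_compact_subset[of "{xL..xR} \<times> {0..1}"]
          compact_Times compact_Icc) (auto intro!: borel_Times)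
  qed simp
  finally show ?thesis .
qed

text \<open>A factor independent of \<open>v\<close> multiplies a function of zero velocity mean.
  This removes the two terms without a sign from the dissipation inequality.\<close>

lemma set_integral_TDV_centered:
  assumes h: "continuous_on ({0..T} \<times> {xL..xR} \<times> {0..1}) h"
    and \<psi>: "continuous_on ({0..T} \<times> {xL..xR}) \<psi>"
  shows "(LINT (t, x, v):TDV T xL xR|lborel. \<psi> (t, x) * (h (t, x, v) - vavg (\<lambda>v. h (t, x, v)))) = 0"
proof -
  have "continuous_on ({0..T} \<times> {xL..xR} \<times> {0..1})
      (\<lambda>(t, x, v). \<psi> (t, x) * (h (t, x, v) - vavg (\<lambda>v. h (t, x, v))))"
    unfolding split_beta' using h continuous_on_lift[OF \<psi>] continuous_on_lift[OF continuous_on_TD_vavg[OF h]]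
    by (intro continuous_intros) simp_all
  then have "(LINT (t, x, v):TDV T xL xR|lborel. \<psi> (t, x) * (h (t, x, v) - vavg (\<lambda>v. h (t, x, v))))
    = (LINT t:{0<..<T}|lborel. LINT x:{xL<..<xR}|lborel. LINT v:\<Omega>plus|lborel.
        \<psi> (t, x) * (h (t, x, v) - vavg (\<lambda>v. h (t, x, v))))"
    by (simp add: set_integral_TDV_iterated)
  also have "\<dots> = (LINT t:{0<..<T}|lborel. LINT x:{xL<..<xR}|lborel. 0)"
  proof (intro set_lebesgue_integral_cong allI impI)
    fix t x assume "t \<in> {0<..<T}" "x \<in> {xL<..<xR}"
    then have "continuous_on {0..1} (\<lambda>v. h (t, x, v))"
      by (intro continuous_on_slice[OF h]) auto
    then have "set_integrable lborel \<Omega>plus (\<lambda>v. h (t, x, v))"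
      by (intro set_integrable_compact_subset[of \<Omega>plus]) auto
    moreover have "set_integrable lborel \<Omega>plus (\<lambda>v. c::real)" "(LINT v:\<Omega>plus|lborel. c) = c" for c
      by (simp_all add: set_integrable_def set_lebesgue_integral_def)
    ultimately show "(LINT v:\<Omega>plus|lborel. \<psi> (t, x) * (h (t, x, v) - vavg (\<lambda>v. h (t, x, v)))) = 0"
      by (simp add: set_integral_diff vavg_def)
  qed simp_all
  finally show ?thesis by simp
qed

lemma set_integral_TDV_dt:
  assumes "0 \<le> T" and u': "continuous_on ({0..T} \<times> {xL..xR} \<times> {0..1}) u'"
    and "\<And>t x v. t \<in> {0..T} \<Longrightarrow> x \<in> {xL..xR} \<Longrightarrow> v \<in> {0..1} \<Longrightarrow>
      ((\<lambda>s. u (s, x, v)) has_real_derivative u' (t, x, v)) (at t within {0..T})"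
  shows "(LINT z:TDV T xL xR|lborel. u' z)
    = (LINT (x, v):{xL<..<xR} \<times> \<Omega>plus|lborel. u (T, x, v) - u (0, x, v))"
proof -
  have "(LINT z:TDV T xL xR|lborel. u' z) = (LINT y:{xL<..<xR} \<times> \<Omega>plus|lborel. u (T, y) - u (0, y))"
    unfolding TDV_def
    by (rule set_integral_partial_derivative_fst[where K = "{xL..xR} \<times> {0..1}"])
      (use assms in \<open>auto intro!: compact_Times borel_Times\<close>)
  then show ?thesis by (simp add: split_beta')
qed

text \<open>As \<open>x\<close> is the middle variable, the formula for the first variable is
  applied on each slice of constant \<open>t\<close>, and the remaining integrals over
  \<open>t\<close> and \<open>v\<close> are then joined.\<close>

lemma set_integral_TDV_dx:
  assumes "xL \<le> xR" and u': "continuous_on ({0..T} \<times> {xL..xR} \<times> {0..1}) u'"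
    and u: "continuous_on ({0..T} \<times> {xL..xR} \<times> {0..1}) u"
    and deriv: "\<And>t x v. t \<in> {0..T} \<Longrightarrow> x \<in> {xL..xR} \<Longrightarrow> v \<in> {0..1} \<Longrightarrow>
      ((\<lambda>s. u (t, s, v)) has_real_derivative u' (t, x, v)) (at x within {xL..xR})"
  shows "(LINT z:TDV T xL xR|lborel. u' z)
    = (LINT (t, v):{0<..<T} \<times> \<Omega>plus|lborel. u (t, xR, v) - u (t, xL, v))"
proof -
  have "(LINT z:TDV T xL xR|lborel. u' z)
      = (LINT t:{0<..<T}|lborel. LINT z:{xL<..<xR} \<times> \<Omega>plus|lborel. u' (t, z))"
    using set_integrable_TDV[OF u'] unfolding TDV_def by (rule set_integral_Times(1))
  also have "\<dots> = (LINT t:{0<..<T}|lborel. LINT v:\<Omega>plus|lborel. u (t, xR, v) - u (t, xL, v))"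
  proof (intro set_lebesgue_integral_cong allI impI)
    fix t assume t: "t \<in> {0<..<T}"
    have "continuous_on ({xL..xR} \<times> {0..1}) (\<lambda>z. u' (t, z))"
      by (rule continuous_on_compose2[OF u']) (use t in \<open>auto intro!: continuous_intros\<close>)
    then show "(LINT z:{xL<..<xR} \<times> \<Omega>plus|lborel. u' (t, z))
        = (LINT v:\<Omega>plus|lborel. u (t, xR, v) - u (t, xL, v))"
      using set_integral_partial_derivative_fst[of xL xR "{0..1}" \<Omega>plus "\<lambda>z. u' (t, z)" "\<lambda>z. u (t, z)"]
        assms(1) deriv t by auto
  qed simp
  also have "\<dots> = (LINT (t, v):{0<..<T} \<times> \<Omega>plus|lborel. u (t, xR, v) - u (t, xL, v))"
  proof -
    have s: "continuous_on ({0..T} \<times> {0..1}) (\<lambda>z. u (fst z, s, snd z))" if "s \<in> {xL..xR}" for s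
      by (rule continuous_on_compose2[OF u]) (use that in \<open>auto intro!: continuous_intros\<close>)
    have "continuous_on ({0..T} \<times> {0..1}) (\<lambda>(t, v). u (t, xR, v) - u (t, xL, v))"
      unfolding split_beta' using assms(1) by (intro continuous_on_diff s) auto
    then have "set_integrable lborel ({0<..<T} \<times> \<Omega>plus) (\<lambda>(t, v). u (t, xR, v) - u (t, xL, v))"
      by (intro set_integrable_compact_subset[of "{0..T} \<times> {0..1}"] compact_Times compact_Icc)
        (auto intro!: borel_Times)
    from set_integral_Times(1)[OF this] show ?thesis by simp
  qed
  finally show ?thesis .
qed

section \<open>Energy estimate for smooth fields\<close>

text \<open>The derivatives are separate functions tied to the fields by one-sided derivatives on
  the closed box. The locale can thus be instantiated with the networks as well as with differences
  of fields.\<close>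

locale smooth_fields =
  fixes T xL xR \<epsilon> :: real
    and a a\<^sub>t a\<^sub>x :: "real \<times> real \<Rightarrow> real"
    and b b\<^sub>t b\<^sub>x c c\<^sub>t c\<^sub>x :: "real \<times> real \<times> real \<Rightarrow> real"
  assumes T: "0 < T" and xLR: "xL < xR" and \<epsilon>: "0 < \<epsilon>" "\<epsilon> \<le> 1"
    and cont_a: "continuous_on ({0..T} \<times> {xL..xR}) a" "continuous_on ({0..T} \<times> {xL..xR}) a\<^sub>t"
      "continuous_on ({0..T} \<times> {xL..xR}) a\<^sub>x"
    and cont_b: "continuous_on ({0..T} \<times> {xL..xR} \<times> {0..1}) b"
      "continuous_on ({0..T} \<times> {xL..xR} \<times> {0..1}) b\<^sub>t" "continuous_on ({0..T} \<times> {xL..xR} \<times> {0..1}) b\<^sub>x"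
    and cont_c: "continuous_on ({0..T} \<times> {xL..xR} \<times> {0..1}) c"
      "continuous_on ({0..T} \<times> {xL..xR} \<times> {0..1}) c\<^sub>t" "continuous_on ({0..T} \<times> {xL..xR} \<times> {0..1}) c\<^sub>x"
    and deriv_a: "\<And>t x. t \<in> {0..T} \<Longrightarrow> x \<in> {xL..xR} \<Longrightarrow>
        ((\<lambda>s. a (s, x)) has_real_derivative a\<^sub>t (t, x)) (at t within {0..T})"
      "\<And>t x. t \<in> {0..T} \<Longrightarrow> x \<in> {xL..xR} \<Longrightarrow>
        ((\<lambda>s. a (t, s)) has_real_derivative a\<^sub>x (t, x)) (at x within {xL..xR})"
    and deriv_b: "\<And>t x v. t \<in> {0..T} \<Longrightarrow> x \<in> {xL..xR} \<Longrightarrow> v \<in> {0..1} \<Longrightarrow>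
        ((\<lambda>s. b (s, x, v)) has_real_derivative b\<^sub>t (t, x, v)) (at t within {0..T})"
      "\<And>t x v. t \<in> {0..T} \<Longrightarrow> x \<in> {xL..xR} \<Longrightarrow> v \<in> {0..1} \<Longrightarrow>
        ((\<lambda>s. b (t, s, v)) has_real_derivative b\<^sub>x (t, x, v)) (at x within {xL..xR})"
    and deriv_c: "\<And>t x v. t \<in> {0..T} \<Longrightarrow> x \<in> {xL..xR} \<Longrightarrow> v \<in> {0..1} \<Longrightarrow>
        ((\<lambda>s. c (s, x, v)) has_real_derivative c\<^sub>t (t, x, v)) (at t within {0..T})"
      "\<And>t x v. t \<in> {0..T} \<Longrightarrow> x \<in> {xL..xR} \<Longrightarrow> v \<in> {0..1} \<Longrightarrow>
        ((\<lambda>s. c (t, s, v)) has_real_derivative c\<^sub>x (t, x, v)) (at x within {xL..xR})"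
begin

abbreviation box3 where "box3 \<equiv> {0..T} \<times> {xL..xR} \<times> {0..1::real}"

definition m :: "real \<times> real \<Rightarrow> real" where "m = (\<lambda>y. vavg (\<lambda>v. c (fst y, snd y, v)))"
definition m\<^sub>t :: "real \<times> real \<Rightarrow> real" where "m\<^sub>t = (\<lambda>y. vavg (\<lambda>v. c\<^sub>t (fst y, snd y, v)))"
definition e1 :: "real \<times> real \<Rightarrow> real" where "e1 = (\<lambda>y. lhs1 a\<^sub>t b\<^sub>x (fst y) (snd y))"
definition e2 :: "real \<times> real \<times> real \<Rightarrow> real" where
  "e2 = (\<lambda>z. lhs2 \<epsilon> b\<^sub>t a\<^sub>x c\<^sub>x b (fst z) (fst (snd z)) (snd (snd z)))"
definition e3 :: "real \<times> real \<times> real \<Rightarrow> real" where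
  "e3 = (\<lambda>z. lhs3 \<epsilon> c\<^sub>t c b\<^sub>x (fst z) (fst (snd z)) (snd (snd z)))"

lemma cont_vb: "continuous_on box3 (\<lambda>z. snd (snd z) * b\<^sub>x z)"
  by (intro continuous_intros cont_b)

lemma cont_vavg_b: "continuous_on ({0..T} \<times> {xL..xR}) (\<lambda>y. vavg (\<lambda>v. v * b\<^sub>x (fst y, snd y, v)))"
  using continuous_on_TD_vavg[OF cont_vb] by simp

lemma cont_m: "continuous_on ({0..T} \<times> {xL..xR}) m" "continuous_on ({0..T} \<times> {xL..xR}) m\<^sub>t"
  unfolding m_def m\<^sub>t_def by (intro continuous_on_TD_vavg cont_c)+

lemma cont_e1: "continuous_on ({0..T} \<times> {xL..xR}) e1"
  unfolding e1_def lhs1_def by (intro continuous_intros cont_vavg_b) (simp add: cont_a)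

lemmas cont_lifted = cont_a[THEN continuous_on_lift] cont_m[THEN continuous_on_lift]
  cont_e1[THEN continuous_on_lift] cont_vavg_b[THEN continuous_on_lift]

lemma cont_e2: "continuous_on box3 e2"
  unfolding e2_def lhs2_def prod.collapse
  by (intro continuous_intros cont_b cont_c cont_lifted)

lemma cont_e3: "continuous_on box3 e3"
  unfolding e3_def lhs3_def prod.collapse
  using cont_vavg_b[THEN continuous_on_lift]
  by (intro continuous_intros cont_b cont_c) simp

lemma deriv_m:
  assumes "t \<in> {0..T}" "x \<in> {xL..xR}"
  shows "((\<lambda>s. m (s, x)) has_real_derivative m\<^sub>t (t, x)) (at t within {0..T})"
proof -
  have "continuous_on ({0..T} \<times> {0..1}) (\<lambda>(s, v). c\<^sub>t (s, x, v))"
    unfolding split_beta'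
    by (rule continuous_on_compose2[OF cont_c(2)]) (use assms in \<open>auto intro!: continuous_intros\<close>)
  then show ?thesis
    unfolding m_def m\<^sub>t_def fst_conv snd_conv
    using assms deriv_c(1) continuous_on_slice[OF cont_c(1)]
    by (intro has_real_derivative_vavg) auto
qed

text \<open>The transport part of the third equation is centered, so averaging leaves an ordinary
  differential equation in \<open>t\<close> for the mean. It is the only information on
  \<open>m\<close> in the interior.\<close>

lemma vavg_e3:
  assumes "t \<in> {0..T}" "x \<in> {xL..xR}"
  shows "vavg (\<lambda>v. e3 (t, x, v)) = \<epsilon>\<^sup>2 * m\<^sub>t (t, x) + m (t, x)"
proof -
  have int: "set_integrable lborel \<Omega>plus (\<lambda>v. h (t, x, v))" if "continuous_on box3 h"
    for h :: "real \<times> real \<times> real \<Rightarrow> real"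
    using continuous_on_slice[OF that assms]
    by (intro set_integrable_compact_subset[of \<Omega>plus]) auto
  have one: "set_integrable lborel \<Omega>plus (\<lambda>v. k::real)" "(LINT v:\<Omega>plus|lborel. k) = k" for k
    by (simp_all add: set_integrable_def set_lebesgue_integral_def)
  show ?thesis
    unfolding e3_def lhs3_def m_def m\<^sub>t_def vavg_def
    using int[OF cont_c(1)] int[OF cont_c(2)] int[OF cont_vb] one
    by (simp add: set_integral_add set_integral_diff)
qed

text \<open>The energy is that of the even part \<open>R = a + \<epsilon>\<^sup>2 c\<close> and the odd part \<open>\<epsilon> b\<close>, for which the
  \<open>x\<close>-derivatives form the exact divergence of \<open>v R b\<close>. The remaining coupling of \<open>R\<close> with the mean
  \<open>m\<close> of \<open>c\<close>, which the loss does not penalise and which has an initial layer of width \<open>\<epsilon>\<^sup>2\<close>, is absorbed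
  by the third term of the energy: \<open>kap\<close> grows from order 1 to order \<open>\<epsilon>\<^sup>-\<^sup>2\<close> across the layer, and
  \<open>chi\<close> drops accordingly by a bounded factor.\<close>

definition ex :: "real \<Rightarrow> real" where "ex t = exp (- t / \<epsilon>\<^sup>2)"
definition kap :: "real \<Rightarrow> real" where "kap t = 1 / (\<epsilon>\<^sup>2 + ex t)"
definition chi :: "real \<Rightarrow> real" where "chi t = exp (- 4 * t + 2 * ex t)"

definition R :: "real \<times> real \<times> real \<Rightarrow> real" where
  "R = (\<lambda>z. a (fst z, fst (snd z)) + \<epsilon>\<^sup>2 * c z)"

definition u :: "real \<times> real \<times> real \<Rightarrow> real" where
  "u = (\<lambda>z. chi (fst z) / 2 * ((R z)\<^sup>2 + \<epsilon>\<^sup>2 * (b z)\<^sup>2 + kap (fst z) * \<epsilon> ^ 4 * (m (fst z, fst (snd z)))\<^sup>2))"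

definition p :: "real \<times> real \<times> real \<Rightarrow> real" where
  "p = (\<lambda>z. chi (fst z) * snd (snd z) * (R z * b z))"

definition R\<^sub>t where "R\<^sub>t = (\<lambda>z. a\<^sub>t (fst z, fst (snd z)) + \<epsilon>\<^sup>2 * c\<^sub>t z)"
definition R\<^sub>x where "R\<^sub>x = (\<lambda>z. a\<^sub>x (fst z, fst (snd z)) + \<epsilon>\<^sup>2 * c\<^sub>x z)"

definition p\<^sub>x where "p\<^sub>x = (\<lambda>z. chi (fst z) * snd (snd z) * (R\<^sub>x z * b z + R z * b\<^sub>x z))"

text \<open>The product rule written out in terms of \<open>q\<close>: the factor
  \<open>- (2 + q)\<close> comes from the derivative of \<open>chi\<close>, the term with
  \<open>(kap t)\<^sup>2 * q\<close> from that of \<open>kap\<close>.\<close>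

definition u\<^sub>t where
  "u\<^sub>t = (\<lambda>z. let t = fst z; q = ex t / \<epsilon>\<^sup>2; M = m (t, fst (snd z)); M\<^sub>t = m\<^sub>t (t, fst (snd z)) in
     chi t * (- (2 + q) * ((R z)\<^sup>2 + \<epsilon>\<^sup>2 * (b z)\<^sup>2 + kap t * \<epsilon> ^ 4 * M\<^sup>2)
       + R z * R\<^sub>t z + \<epsilon>\<^sup>2 * b z * b\<^sub>t z + (kap t)\<^sup>2 * q * \<epsilon> ^ 4 * M\<^sup>2 / 2 + kap t * \<epsilon> ^ 4 * M * M\<^sub>t))"

lemma ex_pos: "0 < ex t" by (simp add: ex_def)

lemma den_pos: "0 < \<epsilon>\<^sup>2 + ex t"
  using ex_pos[of t] by (simp add: add_nonneg_pos)

lemma kap_pos: "0 < kap t" using den_pos by (simp add: kap_def)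

lemma chi_pos: "0 < chi t" by (simp add: chi_def)

text \<open>The decay rate \<open>2 * (2 + q)\<close> of \<open>chi\<close> is singular as
  \<open>\<epsilon>\<close> tends to 0, but \<open>q\<close> is minus the time derivative of
  \<open>ex\<close> and \<open>ex\<close> stays between 0 and 1. This is why the bounds do not
  contain \<open>\<epsilon>\<close>.\<close>

lemma chi_bounds: "t \<in> {0..T} \<Longrightarrow> exp (- 4 * T) \<le> chi t" "t \<in> {0..T} \<Longrightarrow> chi t \<le> exp 2"
proof -
  assume t: "t \<in> {0..T}"
  have "ex t \<le> 1" using t by (simp add: ex_def divide_nonpos_nonneg)
  then show "exp (- 4 * T) \<le> chi t" "chi t \<le> exp 2"
    using t ex_pos[of t] by (simp_all add: chi_def)
qed

lemma deriv_ex: "(ex has_real_derivative - ex t / \<epsilon>\<^sup>2) (at t within S)"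
proof -
  define k where "k = \<epsilon>\<^sup>2"
  have "k \<noteq> 0" using \<epsilon> by (simp add: k_def)
  then show ?thesis
    unfolding ex_def k_def[symmetric] by (auto intro!: derivative_eq_intros simp: field_simps)
qed

lemma deriv_kap: "(kap has_real_derivative (kap t)\<^sup>2 * (ex t / \<epsilon>\<^sup>2)) (at t within S)"
  unfolding kap_def
  by (rule derivative_eq_intros deriv_ex refl | use den_pos[of t] in \<open>simp add: power2_eq_square\<close>)+

lemma deriv_chi: "(chi has_real_derivative - 2 * (2 + ex t / \<epsilon>\<^sup>2) * chi t) (at t within S)"
  unfolding chi_def
  by (rule derivative_eq_intros deriv_ex refl | simp add: algebra_simps)+

lemma cont_weights: "continuous_on S (\<lambda>z. ex (f z))" "continuous_on S (\<lambda>z. kap (f z))"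
    "continuous_on S (\<lambda>z. chi (f z))" if "continuous_on S f"
proof -
  have "continuous_on UNIV ex" "continuous_on UNIV kap" "continuous_on UNIV chi"
    using deriv_ex deriv_kap deriv_chi by (auto intro!: DERIV_continuous_on)
  from this[THEN continuous_on_compose2, OF that]
  show "continuous_on S (\<lambda>z. ex (f z))" "continuous_on S (\<lambda>z. kap (f z))" "continuous_on S (\<lambda>z. chi (f z))"
    by simp_all
qed

lemma cont_R: "continuous_on box3 R" "continuous_on box3 R\<^sub>t" "continuous_on box3 R\<^sub>x"
  unfolding R_def R\<^sub>t_def R\<^sub>x_def by (intro continuous_intros cont_c cont_lifted)+

lemma cont_u: "continuous_on box3 u" "continuous_on box3 u\<^sub>t"
proof -
  show "continuous_on box3 u"
    unfolding u_def by (intro continuous_intros cont_weights cont_R cont_b cont_lifted) simp_all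
  show "continuous_on box3 u\<^sub>t"
    unfolding u\<^sub>t_def Let_def
    by (intro continuous_intros cont_weights cont_R cont_b cont_lifted) (use \<epsilon> in simp_all)
qed

lemma cont_p: "continuous_on box3 p" "continuous_on box3 p\<^sub>x"
  unfolding p_def p\<^sub>x_def by (intro continuous_intros cont_weights cont_R cont_b)+

lemma deriv_u:
  assumes "t \<in> {0..T}" "x \<in> {xL..xR}" "v \<in> {0..1}"
  shows "((\<lambda>s. u (s, x, v)) has_real_derivative u\<^sub>t (t, x, v)) (at t within {0..T})"
proof -
  note d = deriv_chi deriv_kap deriv_a(1)[OF assms(1,2)] deriv_b(1)[OF assms] deriv_c(1)[OF assms]
    deriv_m[OF assms(1,2)]
  show ?thesis
    unfolding u_def R_def fst_conv snd_conv
    by (rule derivative_eq_intros d refl | simp)+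
      (simp add: u\<^sub>t_def Let_def R_def R\<^sub>t_def field_simps power2_eq_square)
qed

lemma deriv_p:
  assumes "t \<in> {0..T}" "x \<in> {xL..xR}" "v \<in> {0..1}"
  shows "((\<lambda>s. p (t, s, v)) has_real_derivative p\<^sub>x (t, x, v)) (at x within {xL..xR})"
proof -
  note d = deriv_a(2)[OF assms(1,2)] deriv_b(2)[OF assms] deriv_c(2)[OF assms]
  show ?thesis
    unfolding p_def R_def fst_conv snd_conv
    by (rule derivative_eq_intros d refl | simp)+
      (simp add: p\<^sub>x_def R_def R\<^sub>x_def field_simps)
qed

text \<open>Weighted by \<open>chi\<close>, the equation for \<open>R\<close> is multiplied by
  \<open>R\<close>, that for \<open>b\<close> by \<open>b\<close>, and the averaged third equation
  by \<open>s * m\<close> with \<open>s = kap * \<epsilon>^2\<close>. The two transport terms add up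
  to \<open>v\<close> times the \<open>x\<close>-derivative of \<open>R * b\<close>, which is
  \<open>p\<^sub>x\<close> up to the weight.\<close>

lemma dissipation:
  assumes "z \<in> box3"
  shows "u\<^sub>t z + p\<^sub>x z \<le> chi (fst z) * (- ((R z)\<^sup>2 / 2 + \<epsilon>\<^sup>2 * (b z)\<^sup>2)
     + (e1 (fst z, fst (snd z)))\<^sup>2 + (e2 z)\<^sup>2 + 2 * (e3 z)\<^sup>2
     - kap (fst z) * \<epsilon>\<^sup>2 * m (fst z, fst (snd z)) * (e3 z - vavg (\<lambda>v. e3 (fst z, fst (snd z), v)))
     - (a (fst z, fst (snd z)) + \<epsilon>\<^sup>2 * m (fst z, fst (snd z)))
       * (c z - vavg (\<lambda>v. c (fst z, fst (snd z), v))))"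
proof -
  obtain t x v where z: "z = (t, x, v)" by (metis prod.exhaust)
  have tx: "t \<in> {0..T}" "x \<in> {xL..xR}" using assms by (auto simp: z)
  define q where "q = ex t / \<epsilon>\<^sup>2"
  define s where "s = kap t * \<epsilon>\<^sup>2"
  define H where "H = vavg (\<lambda>v. e3 (t, x, v))"
  have e0: "\<epsilon> \<noteq> 0" "0 < \<epsilon>\<^sup>2" using \<epsilon> by auto
  have q0: "0 \<le> q" using ex_pos[of t] by (simp add: q_def)
  have s1: "s * (1 + q) = 1"
  proof -
    have "s * (1 + q) = kap t * (\<epsilon>\<^sup>2 + ex t)"
      using e0 by (simp add: s_def q_def distrib_left mult.assoc)
    then show ?thesis using den_pos[of t] by (simp add: kap_def)
  qed
  \<comment> \<open>Adding the first and the third equation cancels the average of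
    \<open>v * b\<^sub>x\<close>.\<close>
  have X: "R\<^sub>t z + v * b\<^sub>x z = e1 (t, x) + e3 z - c z"
    by (simp add: R\<^sub>t_def e1_def e3_def lhs1_def lhs3_def z algebra_simps)
  have Y: "\<epsilon>\<^sup>2 * b\<^sub>t z + v * R\<^sub>x z = e2 z - b z"
    by (simp add: R\<^sub>x_def e2_def lhs2_def z algebra_simps)
  have mt: "\<epsilon>\<^sup>2 * m\<^sub>t (t, x) = H - m (t, x)"
    using vavg_e3[OF tx] by (simp add: H_def)
  have s2: "kap t * \<epsilon> ^ 4 = s * \<epsilon>\<^sup>2" "(kap t)\<^sup>2 * q * \<epsilon> ^ 4 = s\<^sup>2 * q"
    by (simp_all add: s_def power2_eq_square power4_eq_xxxx)
  have "u\<^sub>t z + p\<^sub>x z = chi t * (- (2 + q) * ((R z)\<^sup>2 + \<epsilon>\<^sup>2 * (b z)\<^sup>2 + s * \<epsilon>\<^sup>2 * (m (t, x))\<^sup>2)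
      + R z * (R\<^sub>t z + v * b\<^sub>x z) + b z * (\<epsilon>\<^sup>2 * b\<^sub>t z + v * R\<^sub>x z) + s\<^sup>2 * q * (m (t, x))\<^sup>2 / 2
      + s * m (t, x) * (\<epsilon>\<^sup>2 * m\<^sub>t (t, x)))"
    unfolding u\<^sub>t_def p\<^sub>x_def Let_def z fst_conv snd_conv q_def[symmetric] s2
    by (simp add: algebra_simps)
  also have "\<dots> \<le> chi t * (- ((R z)\<^sup>2 / 2 + \<epsilon>\<^sup>2 * (b z)\<^sup>2) + (e1 (t, x))\<^sup>2 + (e2 z)\<^sup>2 + 2 * (e3 z)\<^sup>2
      + s * m (t, x) * (H - e3 z) - (a (t, x) + \<epsilon>\<^sup>2 * m (t, x)) * (c z - m (t, x)))"
    unfolding mt X Y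
    by (intro mult_left_mono dissipation_inequality q0 s1 refl less_imp_le[OF chi_pos])
      (simp add: R_def z)
  also have "m (t, x) = vavg (\<lambda>v. c (t, x, v))" by (simp add: m_def)
  finally show ?thesis
    by (simp add: z H_def s_def m_def algebra_simps)
qed

end

section \<open>Face terms and the integrated energy estimate\<close>

lemma L2_on_faces:
  fixes T xL xR :: real
  assumes "continuous_on ({0..T} \<times> {xL..xR} \<times> {0..1}) h"
  shows "t \<in> {0..T} \<Longrightarrow> L2_on ({xL<..<xR} \<times> \<Omega>plus) (\<lambda>(x, v). h (t, x, v))"
    and "s \<in> {xL..xR} \<Longrightarrow> L2_on ({0<..<T} \<times> \<Omega>plus) (\<lambda>(t, v). h (t, s, v))"
proof -
  assume t: "t \<in> {0..T}"
  have "continuous_on ({xL..xR} \<times> {0..1}) (\<lambda>z. h (t, fst z, snd z))"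
    by (rule continuous_on_compose2[OF assms]) (use t in \<open>auto intro!: continuous_intros\<close>)
  then show "L2_on ({xL<..<xR} \<times> \<Omega>plus) (\<lambda>(x, v). h (t, x, v))"
    unfolding split_beta'
    by (rule L2_on_compact_subset[rotated]) (auto intro!: borel_Times compact_Times)
next
  assume s: "s \<in> {xL..xR}"
  have "continuous_on ({0..T} \<times> {0..1}) (\<lambda>z. h (fst z, s, snd z))"
    by (rule continuous_on_compose2[OF assms]) (use s in \<open>auto intro!: continuous_intros\<close>)
  then show "L2_on ({0<..<T} \<times> \<Omega>plus) (\<lambda>(t, v). h (t, s, v))"
    unfolding split_beta'
    by (rule L2_on_compact_subset[rotated]) (auto intro!: borel_Times compact_Times)
qed

lemma L2_on_lines:
  fixes T xL xR :: real
  assumes "continuous_on ({0..T} \<times> {xL..xR}) h"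
  shows "t \<in> {0..T} \<Longrightarrow> L2_on {xL<..<xR} (\<lambda>x. h (t, x))"
    and "s \<in> {xL..xR} \<Longrightarrow> L2_on {0<..<T} (\<lambda>t. h (t, s))"
proof -
  assume t: "t \<in> {0..T}"
  have "continuous_on {xL..xR} (\<lambda>x. h (t, x))"
    by (rule continuous_on_compose2[OF assms]) (use t in \<open>auto intro!: continuous_intros\<close>)
  then show "L2_on {xL<..<xR} (\<lambda>x. h (t, x))"
    by (auto intro!: L2_on_compact_subset[of "{xL..xR}"])
next
  assume s: "s \<in> {xL..xR}"
  have "continuous_on {0..T} (\<lambda>t. h (t, s))"
    by (rule continuous_on_compose2[OF assms]) (use s in \<open>auto intro!: continuous_intros\<close>)
  then show "L2_on {0<..<T} (\<lambda>t. h (t, s))"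
    by (auto intro!: L2_on_compact_subset[of "{0..T}"])
qed

context smooth_fields
begin

lemma set_integrable_faces:
  assumes "continuous_on box3 h"
  shows "t \<in> {0..T} \<Longrightarrow> set_integrable lborel ({xL<..<xR} \<times> \<Omega>plus) (\<lambda>(x, v). h (t, x, v) :: real)"
    and "s \<in> {xL..xR} \<Longrightarrow> set_integrable lborel ({0<..<T} \<times> \<Omega>plus) (\<lambda>(t, v). h (t, s, v) :: real)"
proof -
  have fin: "emeasure lborel ({xL<..<xR} \<times> \<Omega>plus) < \<infinity>" "emeasure lborel ({0<..<T} \<times> \<Omega>plus) < \<infinity>"
    using T xLR by (simp_all add: emeasure_lborel_Times)
  show "t \<in> {0..T} \<Longrightarrow> set_integrable lborel ({xL<..<xR} \<times> \<Omega>plus) (\<lambda>(x, v). h (t, x, v) :: real)"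
    by (rule L2_on_imp_set_integrable[OF L2_on_faces(1)[OF assms]])
      (use fin in \<open>auto intro!: borel_Times\<close>)
  show "s \<in> {xL..xR} \<Longrightarrow> set_integrable lborel ({0<..<T} \<times> \<Omega>plus) (\<lambda>(t, v). h (t, s, v) :: real)"
    by (rule L2_on_imp_set_integrable[OF L2_on_faces(2)[OF assms]])
      (use fin in \<open>auto intro!: borel_Times\<close>)
qed

definition initial_error :: real where
  "initial_error = sqint {xL<..<xR} (\<lambda>x. a (0, x))
     + \<epsilon>\<^sup>2 * sqint ({xL<..<xR} \<times> \<Omega>plus) (\<lambda>(x, v). b (0, x, v))
     + \<epsilon> ^ 4 * sqint ({xL<..<xR} \<times> \<Omega>plus) (\<lambda>(x, v). c (0, x, v))"

definition face_error :: "real \<Rightarrow> real" where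
  "face_error s = sqint {0<..<T} (\<lambda>t. a (t, s)) + sqint ({0<..<T} \<times> \<Omega>plus) (\<lambda>(t, v). b (t, s, v))
     + sqint ({0<..<T} \<times> \<Omega>plus) (\<lambda>(t, v). c (t, s, v))"

text \<open>At time 0 the layer function \<open>ex\<close> equals 1, hence
  \<open>kap 0 \<le> 1\<close> and the mean enters with \<open>\<epsilon>^4\<close>, exactly the
  weight of \<open>c\<close> in the initial loss. Jensen turns the mean into \<open>c\<close>,
  whence the factor 2; \<open>exp 2\<close> is \<open>chi 0\<close>.\<close>

lemma integral_u_initial:
  "(LINT (x, v):{xL<..<xR} \<times> \<Omega>plus|lborel. u (0, x, v)) \<le> 2 * exp 2 * initial_error"
proof -
  let ?XV = "{xL<..<xR} \<times> \<Omega>plus"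
  have a: "L2_on ?XV (\<lambda>(x, v). a (0, x))" "sqint ?XV (\<lambda>(x, v). a (0, x)) = sqint {xL<..<xR} (\<lambda>x. a (0, x))"
    using L2_on_lift[OF L2_on_lines(1)[OF cont_a(1), of 0]] T by simp_all
  have M: "L2_on ?XV (\<lambda>(x, v). m (0, x))"
    and M_le: "sqint ?XV (\<lambda>(x, v). m (0, x)) \<le> sqint ?XV (\<lambda>(x, v). c (0, x, v))"
    using L2_on_lift[OF L2_on_lines(1)[OF cont_m(1), of 0]] L2_on_vavg(2)[OF L2_on_faces(1)[OF cont_c(1), of 0]] T
    by (simp_all add: m_def)
  have b: "L2_on ?XV (\<lambda>(x, v). b (0, x, v))" and c: "L2_on ?XV (\<lambda>(x, v). c (0, x, v))"
    using T by (auto intro!: L2_on_faces cont_b cont_c)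
  define g where "g = (\<lambda>z. exp 2 * (((\<lambda>(x, v). a (0, x)) z)\<^sup>2 + \<epsilon>\<^sup>2 * ((\<lambda>(x, v). b (0, x, v)) z)\<^sup>2
      + \<epsilon> ^ 4 * ((\<lambda>(x, v). c (0, x, v)) z)\<^sup>2 + \<epsilon> ^ 4 * ((\<lambda>(x, v). m (0, x)) z)\<^sup>2))"
  note int = L2_onD(2)[OF a(1)] L2_onD(2)[OF b] L2_onD(2)[OF c] L2_onD(2)[OF M]
  have le: "u (0, x, v) \<le> g (x, v)" for x v
  proof -
    have "\<epsilon>\<^sup>2 + ex 0 \<ge> 1" using \<epsilon> by (simp add: ex_def)
    then have k: "kap 0 \<le> 1" using den_pos[of 0] by (simp add: kap_def)
    have chi0: "chi 0 = exp 2" by (simp add: chi_def ex_def)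
    have "(a (0, x) + \<epsilon>\<^sup>2 * c (0, x, v))\<^sup>2 \<le> 2 * (a (0, x))\<^sup>2 + 2 * (\<epsilon>\<^sup>2 * c (0, x, v))\<^sup>2"
      by (rule sq_add_le)
    moreover have "(\<epsilon>\<^sup>2 * c (0, x, v))\<^sup>2 = \<epsilon> ^ 4 * (c (0, x, v))\<^sup>2"
      by (simp add: power_mult_distrib)
    moreover have "kap 0 * (\<epsilon> ^ 4 * (m (0, x))\<^sup>2) \<le> 1 * (\<epsilon> ^ 4 * (m (0, x))\<^sup>2)"
      using k by (intro mult_right_mono) auto
    moreover have "0 \<le> \<epsilon>\<^sup>2 * (b (0, x, v))\<^sup>2" "0 \<le> \<epsilon> ^ 4 * (m (0, x))\<^sup>2" by simp_all
    moreover have "1 / 2 * (r + eb + k) \<le> a2 + eb + c4 + m4"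
      if "r \<le> 2 * a2 + 2 * c2" "c2 = c4" "k \<le> 1 * m4" "0 \<le> eb" "0 \<le> m4" for r eb k a2 c2 c4 m4 :: real
      using that by simp
    ultimately have "1 / 2 * ((a (0, x) + \<epsilon>\<^sup>2 * c (0, x, v))\<^sup>2 + \<epsilon>\<^sup>2 * (b (0, x, v))\<^sup>2
        + kap 0 * (\<epsilon> ^ 4 * (m (0, x))\<^sup>2))
      \<le> (a (0, x))\<^sup>2 + \<epsilon>\<^sup>2 * (b (0, x, v))\<^sup>2 + \<epsilon> ^ 4 * (c (0, x, v))\<^sup>2 + \<epsilon> ^ 4 * (m (0, x))\<^sup>2"
      by blast
    then have "exp 2 * (1 / 2 * ((a (0, x) + \<epsilon>\<^sup>2 * c (0, x, v))\<^sup>2 + \<epsilon>\<^sup>2 * (b (0, x, v))\<^sup>2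
        + kap 0 * (\<epsilon> ^ 4 * (m (0, x))\<^sup>2))) \<le> g (x, v)"
      unfolding g_def by (intro mult_left_mono) auto
    then show ?thesis by (simp add: u_def R_def chi0 mult.assoc)
  qed
  have gi: "set_integrable lborel ?XV g"
    unfolding g_def using int by (intro set_integrable_mult_right set_integral_add(1))
  have "(LINT (x, v):?XV|lborel. u (0, x, v)) \<le> (LINT z:?XV|lborel. g z)"
    using set_integrable_faces(1)[OF cont_u(1), of 0] T gi le
    by (intro set_integral_mono) (auto simp: split_beta')
  also have "\<dots> = exp 2 * (sqint {xL<..<xR} (\<lambda>x. a (0, x)) + \<epsilon>\<^sup>2 * sqint ?XV (\<lambda>(x, v). b (0, x, v))
      + \<epsilon> ^ 4 * sqint ?XV (\<lambda>(x, v). c (0, x, v)) + \<epsilon> ^ 4 * sqint ?XV (\<lambda>(x, v). m (0, x)))"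
    unfolding g_def unfolding a(2)[symmetric] unfolding sqint_def using int
    by (simp add: set_integral_add del: case_prod_conv)
  also have "\<dots> \<le> exp 2 * (sqint {xL<..<xR} (\<lambda>x. a (0, x)) + \<epsilon>\<^sup>2 * sqint ?XV (\<lambda>(x, v). b (0, x, v))
      + \<epsilon> ^ 4 * sqint ?XV (\<lambda>(x, v). c (0, x, v)) + \<epsilon> ^ 4 * sqint ?XV (\<lambda>(x, v). c (0, x, v)))"
    using M_le by (intro mult_left_mono add_left_mono) auto
  also have "\<dots> \<le> exp 2 * (2 * initial_error)"
  proof (rule mult_left_mono)
    have "A + B + C + C \<le> 2 * (A + B + C)" if "0 \<le> A" "0 \<le> B" for A B C :: real
      using that by simp
    then show "sqint {xL<..<xR} (\<lambda>x. a (0, x)) + \<epsilon>\<^sup>2 * sqint ?XV (\<lambda>(x, v). b (0, x, v))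
      + \<epsilon> ^ 4 * sqint ?XV (\<lambda>(x, v). c (0, x, v)) + \<epsilon> ^ 4 * sqint ?XV (\<lambda>(x, v). c (0, x, v))
      \<le> 2 * initial_error"
      unfolding initial_error_def by simp
  qed simp
  finally show ?thesis by (simp add: mult.assoc)
qed

text \<open>Networks need not be periodic, so the fluxes through the two faces do not cancel and
  each is bounded in absolute value. From \<open>2 * \<bar>R * b\<bar> \<le> R^2 + b^2\<close> one
  gets \<open>b^2\<close> without a power of \<open>\<epsilon>\<close>, which the boundary loss
  controls.\<close>

lemma integral_abs_p_face:
  assumes s: "s \<in> {xL..xR}"
  shows "(LINT (t, v):{0<..<T} \<times> \<Omega>plus|lborel. \<bar>p (t, s, v)\<bar>) \<le> 2 * exp 2 * face_error s"
proof -
  let ?IV = "{0<..<T} \<times> \<Omega>plus"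
  have a: "L2_on ?IV (\<lambda>(t, v). a (t, s))" "sqint ?IV (\<lambda>(t, v). a (t, s)) = sqint {0<..<T} (\<lambda>t. a (t, s))"
    using L2_on_lift[OF L2_on_lines(2)[OF cont_a(1) s]] by simp_all
  have b: "L2_on ?IV (\<lambda>(t, v). b (t, s, v))" and c: "L2_on ?IV (\<lambda>(t, v). c (t, s, v))"
    using s by (auto intro!: L2_on_faces cont_b cont_c)
  define g where "g = (\<lambda>z. exp 2 * (((\<lambda>(t, v). a (t, s)) z)\<^sup>2 + ((\<lambda>(t, v). b (t, s, v)) z)\<^sup>2
      + ((\<lambda>(t, v). c (t, s, v)) z)\<^sup>2))"
  note int = L2_onD(2)[OF a(1)] L2_onD(2)[OF b] L2_onD(2)[OF c]
  have le: "\<bar>p (t, s, v)\<bar> \<le> g (t, v)" if t: "t \<in> {0<..<T}" and v: "v \<in> {0..1}" for t v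
  proof -
    have 1: "\<bar>p (t, s, v)\<bar> \<le> exp 2 * 1 * \<bar>R (t, s, v) * b (t, s, v)\<bar>"
      unfolding p_def abs_mult fst_conv snd_conv
      using t v chi_bounds(2)[of t] less_imp_le[OF chi_pos[of t]] by (intro mult_mono) auto
    have 2: "2 * \<bar>R (t, s, v) * b (t, s, v)\<bar> \<le> (R (t, s, v))\<^sup>2 + (b (t, s, v))\<^sup>2"
      using zero_le_power2[of "\<bar>R (t, s, v)\<bar> - \<bar>b (t, s, v)\<bar>"]
      by (simp add: power2_diff abs_mult)
    have "(R (t, s, v))\<^sup>2 \<le> 2 * (a (t, s))\<^sup>2 + 2 * (\<epsilon>\<^sup>2 * c (t, s, v))\<^sup>2"
      unfolding R_def fst_conv snd_conv by (rule sq_add_le)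
    moreover have "(\<epsilon>\<^sup>2 * c (t, s, v))\<^sup>2 \<le> (c (t, s, v))\<^sup>2"
      using \<epsilon> by (simp add: power_mult_distrib power_le_one mult_left_le_one_le)
    moreover have "0 \<le> (b (t, s, v))\<^sup>2" by simp
    ultimately have "\<bar>R (t, s, v) * b (t, s, v)\<bar> \<le> (a (t, s))\<^sup>2 + (b (t, s, v))\<^sup>2 + (c (t, s, v))\<^sup>2"
      using 2 by linarith
    then have "exp 2 * \<bar>R (t, s, v) * b (t, s, v)\<bar>
        \<le> exp 2 * ((a (t, s))\<^sup>2 + (b (t, s, v))\<^sup>2 + (c (t, s, v))\<^sup>2)"
      by (intro mult_left_mono) auto
    with 1 have "\<bar>p (t, s, v)\<bar> \<le> exp 2 * ((a (t, s))\<^sup>2 + (b (t, s, v))\<^sup>2 + (c (t, s, v))\<^sup>2)"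
      by linarith
    then show ?thesis by (simp add: g_def)
  qed
  have gi: "set_integrable lborel ?IV g"
    unfolding g_def using int by (intro set_integrable_mult_right set_integral_add(1))
  have "(LINT (t, v):?IV|lborel. \<bar>p (t, s, v)\<bar>) \<le> (LINT z:?IV|lborel. g z)"
    using set_integrable_abs[OF set_integrable_faces(2)[OF cont_p(1) s]] gi le
    by (intro set_integral_mono) (auto simp: split_beta')
  also have "\<dots> = exp 2 * face_error s"
    unfolding g_def face_error_def unfolding a(2)[symmetric] unfolding sqint_def using int
    by (simp add: set_integral_add del: case_prod_conv)
  also have "\<dots> \<le> 2 * exp 2 * face_error s"
    by (simp add: face_error_def)
  finally show ?thesis .
qed

text \<open>The constant is \<open>4 * exp (4 * T)\<close>, from comparing the total error with the
  weighted dissipation, times \<open>2 * exp 2\<close>, the largest coefficient among the source,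
  initial and face terms.\<close>

lemma energy_estimate:
  "sqint (TDV T xL xR) (recon \<epsilon> a b c)
    \<le> 8 * exp (4 * T + 2) * (sqint (TD T xL xR) e1 + sqint (TDV T xL xR) e2 + sqint (TDV T xL xR) e3
      + initial_error + face_error xL + face_error xR)"
proof -
  let ?\<Omega> = "TDV T xL xR"
  define D where "D = (\<lambda>z. (R z)\<^sup>2 / 2 + \<epsilon>\<^sup>2 * (b z)\<^sup>2)"
  define E where "E = (\<lambda>z. (e1 (fst z, fst (snd z)))\<^sup>2 + (e2 z)\<^sup>2 + 2 * (e3 z)\<^sup>2)"
  \<comment> \<open>\<open>o1\<close> and \<open>o2\<close> collect the terms without a sign; both
    are a function of \<open>(t, x)\<close> times a centered function of \<open>v\<close>.\<close>
  define o1 where "o1 = (\<lambda>z. chi (fst z) * kap (fst z) * \<epsilon>\<^sup>2 * m (fst z, fst (snd z))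
      * (e3 z - vavg (\<lambda>v. e3 (fst z, fst (snd z), v))))"
  define o2 where "o2 = (\<lambda>z. chi (fst z) * (a (fst z, fst (snd z)) + \<epsilon>\<^sup>2 * m (fst z, fst (snd z)))
      * (c z - vavg (\<lambda>v. c (fst z, fst (snd z), v))))"
  have cD: "continuous_on box3 D" unfolding D_def by (intro continuous_intros cont_R cont_b) simp
  have cE: "continuous_on box3 E" unfolding E_def by (intro continuous_intros cont_e2 cont_e3 cont_lifted)
  have cchi: "continuous_on box3 (\<lambda>z. chi (fst z))" by (intro cont_weights continuous_intros)
  note cv = continuous_on_TD_vavg[OF cont_e3, THEN continuous_on_lift]
    continuous_on_TD_vavg[OF cont_c(1), THEN continuous_on_lift]
  have co: "continuous_on box3 o1" "continuous_on box3 o2"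
    unfolding o1_def o2_def using cv
    by (intro continuous_intros cont_weights cont_e3 cont_c cont_lifted; simp)+
  have o: "(LINT z:?\<Omega>|lborel. o1 z) = 0" "(LINT z:?\<Omega>|lborel. o2 z) = 0"
  proof -
    have "continuous_on ({0..T} \<times> {xL..xR}) (\<lambda>y. chi (fst y) * kap (fst y) * \<epsilon>\<^sup>2 * m y)"
      "continuous_on ({0..T} \<times> {xL..xR}) (\<lambda>y. chi (fst y) * (a y + \<epsilon>\<^sup>2 * m y))"
      by (intro continuous_intros cont_weights cont_m cont_a)+
    from set_integral_TDV_centered[OF cont_e3 this(1)] set_integral_TDV_centered[OF cont_c(1) this(2)]
    show "(LINT z:?\<Omega>|lborel. o1 z) = 0" "(LINT z:?\<Omega>|lborel. o2 z) = 0"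
      by (simp_all add: o1_def o2_def split_beta')
  qed
  have diss: "chi (fst z) * D z \<le> chi (fst z) * E z - o1 z - o2 z - u\<^sub>t z - p\<^sub>x z" if "z \<in> box3" for z
    using dissipation[OF that] by (simp add: D_def E_def o1_def o2_def algebra_simps)
  note int = set_integrable_TDV[OF continuous_on_mult[OF cchi cD]]
    set_integrable_TDV[OF continuous_on_mult[OF cchi cE]] set_integrable_TDV[OF co(1)]
    set_integrable_TDV[OF co(2)] set_integrable_TDV[OF cont_u(2)] set_integrable_TDV[OF cont_p(2)]
  have "(LINT z:?\<Omega>|lborel. chi (fst z) * D z)
      \<le> (LINT z:?\<Omega>|lborel. chi (fst z) * E z - o1 z - o2 z - u\<^sub>t z - p\<^sub>x z)"
    by (intro set_integral_mono set_integral_diff(1) int diss subsetD[OF TDV_subset])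
  also have "\<dots> = (LINT z:?\<Omega>|lborel. chi (fst z) * E z) - (LINT z:?\<Omega>|lborel. u\<^sub>t z) - (LINT z:?\<Omega>|lborel. p\<^sub>x z)"
    using int o by (simp add: set_integral_diff)
  finally have main: "(LINT z:?\<Omega>|lborel. chi (fst z) * D z)
    \<le> (LINT z:?\<Omega>|lborel. chi (fst z) * E z) - (LINT z:?\<Omega>|lborel. u\<^sub>t z) - (LINT z:?\<Omega>|lborel. p\<^sub>x z)" .
  have src: "(LINT z:?\<Omega>|lborel. chi (fst z) * E z)
      \<le> exp 2 * (sqint (TD T xL xR) e1 + sqint ?\<Omega> e2 + 2 * sqint ?\<Omega> e3)"
  proof -
    have "(LINT z:?\<Omega>|lborel. chi (fst z) * E z) \<le> (LINT z:?\<Omega>|lborel. exp 2 * E z)"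
      using int(2) set_integrable_TDV[OF cE] chi_bounds(2) TDV_subset[of T xL xR]
      by (intro set_integral_mono set_integrable_mult_right mult_right_mono) (auto simp: E_def)
    also have "\<dots> = exp 2 * (sqint ?\<Omega> (\<lambda>(t, x, v). e1 (t, x)) + sqint ?\<Omega> e2 + 2 * sqint ?\<Omega> e3)"
    proof -
      have "L2_on ?\<Omega> (\<lambda>(t, x, v). e1 (t, x))"
        unfolding split_beta' by (intro L2_on_TDV cont_lifted)
      from L2_onD(2)[OF this] L2_onD(2)[OF L2_on_TDV[OF cont_e2]] L2_onD(2)[OF L2_on_TDV[OF cont_e3]]
      show ?thesis
        unfolding sqint_def E_def split_beta' by (simp add: set_integral_add)
    qed
    finally show ?thesis by (simp add: L2_on_TDV_lift(2)[OF L2_on_TD[OF cont_e1]])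
  qed
  have ini: "- (LINT z:?\<Omega>|lborel. u\<^sub>t z) \<le> 2 * exp 2 * initial_error"
  proof -
    have uint: "set_integrable lborel ({xL<..<xR} \<times> \<Omega>plus) (\<lambda>(x, v). u (t, x, v))" if "t \<in> {0..T}" for t
      by (rule set_integrable_faces(1)[OF cont_u(1) that])
    have upos: "0 \<le> u z" for z
      unfolding u_def using chi_pos[of "fst z"] kap_pos[of "fst z"] by (auto intro!: mult_nonneg_nonneg add_nonneg_nonneg)
    have "(LINT z:?\<Omega>|lborel. u\<^sub>t z) = (LINT (x, v):{xL<..<xR} \<times> \<Omega>plus|lborel. u (T, x, v) - u (0, x, v))"
      using T by (intro set_integral_TDV_dt cont_u deriv_u) auto
    also have "\<dots> = (LINT (x, v):{xL<..<xR} \<times> \<Omega>plus|lborel. u (T, x, v))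
        - (LINT (x, v):{xL<..<xR} \<times> \<Omega>plus|lborel. u (0, x, v))"
      using uint[of T] uint[of 0] T by (simp add: split_beta' set_integral_diff)
    \<comment> \<open>The energy at the final time is nonnegative and is dropped.\<close>
    also have "\<dots> \<ge> - (LINT (x, v):{xL<..<xR} \<times> \<Omega>plus|lborel. u (0, x, v))"
      unfolding set_lebesgue_integral_def
      by (simp add: upos split_beta' Bochner_Integration.integral_nonneg)
    finally show ?thesis using integral_u_initial by linarith
  qed
  have bdy: "- (LINT z:?\<Omega>|lborel. p\<^sub>x z) \<le> 2 * exp 2 * face_error xL + 2 * exp 2 * face_error xR"
  proof -
    let ?IV = "{0<..<T} \<times> \<Omega>plus"
    have pint: "set_integrable lborel ?IV (\<lambda>(t, v). p (t, s, v))" if "s \<in> {xL..xR}" for s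
      by (rule set_integrable_faces(2)[OF cont_p(1) that])
    have pabs: "\<bar>LINT (t, v):?IV|lborel. p (t, s, v)\<bar> \<le> 2 * exp 2 * face_error s" if "s \<in> {xL..xR}" for s
    proof -
      have "\<bar>LINT (t, v):?IV|lborel. p (t, s, v)\<bar> \<le> (LINT (t, v):?IV|lborel. \<bar>p (t, s, v)\<bar>)"
        using integral_abs_bound[of lborel "\<lambda>z. indicator ?IV z *\<^sub>R (\<lambda>(t, v). p (t, s, v)) z"]
        by (simp add: set_lebesgue_integral_def abs_mult split_beta')
      with integral_abs_p_face[OF that] show ?thesis by linarith
    qed
    have "(LINT z:?\<Omega>|lborel. p\<^sub>x z) = (LINT (t, v):?IV|lborel. p (t, xR, v) - p (t, xL, v))"
      using xLR by (intro set_integral_TDV_dx cont_p deriv_p) auto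
    also have "\<dots> = (LINT (t, v):?IV|lborel. p (t, xR, v)) - (LINT (t, v):?IV|lborel. p (t, xL, v))"
      using pint[of xL] pint[of xR] xLR by (simp add: split_beta' set_integral_diff)
    finally show ?thesis using pabs[of xL] pabs[of xR] xLR by auto
  qed
  have tot: "sqint ?\<Omega> (recon \<epsilon> a b c) \<le> 4 * exp (4 * T) * (LINT z:?\<Omega>|lborel. chi (fst z) * D z)"
  proof -
    have rec: "recon \<epsilon> a b c z = R z + \<epsilon> * b z" for z
      by (simp add: recon_def R_def split_beta')
    have "sqint ?\<Omega> (recon \<epsilon> a b c) \<le> (LINT z:?\<Omega>|lborel. 4 * exp (4 * T) * (chi (fst z) * D z))"
      unfolding sqint_def
    proof (intro set_integral_mono)
      show "set_integrable lborel ?\<Omega> (\<lambda>z. (recon \<epsilon> a b c z)\<^sup>2)"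
        unfolding rec by (intro set_integrable_TDV continuous_intros cont_R cont_b)
      show "set_integrable lborel ?\<Omega> (\<lambda>z. 4 * exp (4 * T) * (chi (fst z) * D z))"
        by (intro set_integrable_mult_right int)
      fix z assume "z \<in> ?\<Omega>"
      then have "fst z \<in> {0..T}" using TDV_subset[of T xL xR] by auto
      then have "exp (4 * T) * exp (- 4 * T) \<le> exp (4 * T) * chi (fst z)"
        by (intro mult_left_mono chi_bounds) auto
      then have "1 \<le> exp (4 * T) * chi (fst z)" by (simp flip: exp_add)
      then have "1 * D z \<le> exp (4 * T) * chi (fst z) * D z"
        by (intro mult_right_mono) (auto simp: D_def)
      \<comment> \<open>The reconstruction is even part plus odd part,
        \<open>R + \<epsilon> * b\<close>, so its square is at most
        \<open>2 * R^2 + 2 * \<epsilon>^2 * b^2\<close>; the factor 4 compensates the half in front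
        of \<open>R^2\<close> in \<open>D\<close>.\<close>
      moreover have "(recon \<epsilon> a b c z)\<^sup>2 \<le> 4 * D z"
        using sq_add_le[of "R z" "\<epsilon> * b z"] unfolding rec D_def
        by (simp add: power_mult_distrib) (smt (verit) zero_le_power2 mult_nonneg_nonneg)
      ultimately show "(recon \<epsilon> a b c z)\<^sup>2 \<le> 4 * exp (4 * T) * (chi (fst z) * D z)"
        by simp
    qed
    then show ?thesis by simp
  qed
  have "(LINT z:?\<Omega>|lborel. chi (fst z) * D z) \<le> 2 * exp 2 * (sqint (TD T xL xR) e1 + sqint ?\<Omega> e2
      + sqint ?\<Omega> e3 + initial_error + face_error xL + face_error xR)"
  proof -
    have "0 \<le> exp 2 * sqint (TD T xL xR) e1" "0 \<le> exp 2 * sqint ?\<Omega> e2" by simp_all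
    then show ?thesis using main src ini bdy unfolding distrib_left mult.assoc by linarith
  qed
  then have "4 * exp (4 * T) * (LINT z:?\<Omega>|lborel. chi (fst z) * D z)
    \<le> 4 * exp (4 * T) * (2 * exp 2 * (sqint (TD T xL xR) e1 + sqint ?\<Omega> e2
      + sqint ?\<Omega> e3 + initial_error + face_error xL + face_error xR))"
    by (intro mult_left_mono) auto
  also have "\<dots> = 8 * exp (4 * T + 2) * (sqint (TD T xL xR) e1 + sqint ?\<Omega> e2
      + sqint ?\<Omega> e3 + initial_error + face_error xL + face_error xR)"
    by (simp add: exp_add)
  finally show ?thesis using tot by linarith
qed

end

section \<open>Approximation of functions with traces\<close>

text \<open>The regularity shared by test functions and by networks smooth up to the boundary.
  Differentiability is required in a full neighbourhood of each point of \<open>K\<close>, including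
  boundary points.\<close>

definition C1_near :: "'a::euclidean_space set \<Rightarrow> ('a \<Rightarrow> real) \<Rightarrow> bool" where
  "C1_near K f \<longleftrightarrow>
     (\<forall>z\<in>K. f differentiable (at z)) \<and> (\<forall>b\<in>Basis. continuous_on K (pderiv_at b f))"

text \<open>Chain rule along a curve with velocity \<open>b\<close>. Because \<open>f\<close> is
  differentiable in the whole space, one-sided derivatives at the ends of an interval are
  covered.\<close>

lemma has_real_derivative_pderiv_at:
  assumes "f differentiable (at (\<gamma> t))" "(\<gamma> has_vector_derivative b) (at t within S)"
  shows "((\<lambda>s. f (\<gamma> s)) has_real_derivative pderiv_at b f (\<gamma> t)) (at t within S)"
proof -
  have "(f has_derivative frechet_derivative f (at (\<gamma> t))) (at (\<gamma> t) within \<gamma> ` S)"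
    using assms(1) frechet_derivative_works has_derivative_at_withinI by blast
  from vector_derivative_diff_chain_within[OF assms(2) this] show ?thesis
    by (simp add: pderiv_at_def has_real_derivative_iff_has_vector_derivative o_def)
qed

lemma C1_near_imp_continuous_on: "C1_near K f \<Longrightarrow> continuous_on K f"
  unfolding C1_near_def
  by (meson continuous_at_imp_continuous_on differentiable_imp_continuous_within)

lemma smooth_on_imp_C1_near:
  assumes "smooth_on U f" "K \<subseteq> U"
  shows "C1_near K f"
proof -
  have "Ck_on (Suc 0) U f" using assms(1) by (simp only: smooth_on_def)
  then show ?thesis
    using assms(2) unfolding C1_near_def by (auto intro: continuous_on_subset)
qed

lemma test_function_imp_C1_near: "test_function UNIV \<Phi> \<Longrightarrow> C1_near K \<Phi>"
  by (rule smooth_on_imp_C1_near[of UNIV]) (auto simp: test_function_def)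

lemma smooth_up_to_boundary_imp_C1_near: "smooth_up_to_boundary S f \<Longrightarrow> C1_near (closure S) f"
  using smooth_on_imp_C1_near unfolding smooth_up_to_boundary_def by blast

lemma closure_TD: "0 < T \<Longrightarrow> xL < xR \<Longrightarrow> closure (TD T xL xR) = {0..T} \<times> {xL..xR}"
  and closure_TDV: "0 < T \<Longrightarrow> xL < xR \<Longrightarrow> closure (TDV T xL xR) = {0..T} \<times> {xL..xR} \<times> {0..1}"
  by (simp_all add: TD_def TDV_def closure_Times)

lemma Basis_directions [simp]:
  "dt2 \<in> Basis" "dx2 \<in> Basis" "dt3 \<in> Basis" "dx3 \<in> Basis"
  by (simp_all add: Basis_prod_def zero_prod_def)

lemma C1_nearD2:
  assumes f: "C1_near ({0..T} \<times> {xL..xR}) f"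
  shows "continuous_on ({0..T} \<times> {xL..xR}) (pderiv_at dt2 f)"
    and "continuous_on ({0..T} \<times> {xL..xR}) (pderiv_at dx2 f)"
    and "\<And>t x. t \<in> {0..T} \<Longrightarrow> x \<in> {xL..xR} \<Longrightarrow>
      ((\<lambda>s. f (s, x)) has_real_derivative pderiv_at dt2 f (t, x)) (at t within {0..T})"
    and "\<And>t x. t \<in> {0..T} \<Longrightarrow> x \<in> {xL..xR} \<Longrightarrow>
      ((\<lambda>s. f (t, s)) has_real_derivative pderiv_at dx2 f (t, x)) (at x within {xL..xR})"
  using f unfolding C1_near_def
  by (auto intro!: has_real_derivative_pderiv_at[where f = f] derivative_eq_intros
      simp: has_vector_derivative_def zero_prod_def)

lemma C1_nearD3:
  assumes f: "C1_near ({0..T} \<times> {xL..xR} \<times> {0..1}) f"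
  shows "continuous_on ({0..T} \<times> {xL..xR} \<times> {0..1}) (pderiv_at dt3 f)"
    and "continuous_on ({0..T} \<times> {xL..xR} \<times> {0..1}) (pderiv_at dx3 f)"
    and "\<And>t x v. t \<in> {0..T} \<Longrightarrow> x \<in> {xL..xR} \<Longrightarrow> v \<in> {0..1} \<Longrightarrow>
      ((\<lambda>s. f (s, x, v)) has_real_derivative pderiv_at dt3 f (t, x, v)) (at t within {0..T})"
    and "\<And>t x v. t \<in> {0..T} \<Longrightarrow> x \<in> {xL..xR} \<Longrightarrow> v \<in> {0..1} \<Longrightarrow>
      ((\<lambda>s. f (t, s, v)) has_real_derivative pderiv_at dx3 f (t, x, v)) (at x within {xL..xR})"
  using f unfolding C1_near_def
  by (auto intro!: has_real_derivative_pderiv_at[where f = f] derivative_eq_intros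
      simp: has_vector_derivative_def zero_prod_def)

section \<open>Simultaneous approximation of a function and its traces\<close>

lemma in_H1D:
  assumes "in_H1 S u"
  shows "L2_on S u" and "b \<in> Basis \<Longrightarrow> L2_on S (weak_deriv S b u)"
proof -
  show "L2_on S u" using assms by (simp add: in_H1_def)
  assume "b \<in> Basis"
  then have "\<exists>g. L2_on S g \<and> is_weak_deriv S b u g" using assms by (simp add: in_H1_def)
  from someI_ex[OF this] show "L2_on S (weak_deriv S b u)" by (simp add: weak_deriv_def)
qed

text \<open>All the limits in the definition of the trace hold along one sequence, and the basis is
  finite, so a single index makes every error small.\<close>

lemma has_trace_approx:
  fixes u :: "'a::euclidean_space \<Rightarrow> real"
  assumes "has_trace S u \<gamma> F g" "0 < \<delta>"
  obtains \<Phi> where "test_function UNIV \<Phi>" "sqint S (\<lambda>z. \<Phi> z - u z) < \<delta>"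
    "\<And>b. b \<in> Basis \<Longrightarrow> sqint S (\<lambda>z. pderiv_at b \<Phi> z - weak_deriv S b u z) < \<delta>"
    "sqint F (\<lambda>y. \<Phi> (\<gamma> y) - g y) < \<delta>"
proof -
  obtain \<Phi> where \<Phi>: "\<And>n. test_function UNIV (\<Phi> n)" "H1_converges S \<Phi> u"
    "(\<lambda>n. L2_norm_on F (\<lambda>y. \<Phi> n (\<gamma> y) - g y)) \<longlonglongrightarrow> 0"
    using assms(1) by (auto simp: has_trace_def)
  have ev: "\<forall>\<^sub>F n in sequentially. sqint D (f n) < \<delta>" if "(\<lambda>n. L2_norm_on D (f n)) \<longlonglongrightarrow> 0"
    for D :: "'a set" and f
    using tendsto_power[OF that, of 2] assms(2) by (auto simp: L2_norm_on_power2 intro: order_tendstoD)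
  have ev': "\<forall>\<^sub>F n in sequentially. sqint F (\<lambda>y. \<Phi> n (\<gamma> y) - g y) < \<delta>"
    using tendsto_power[OF \<Phi>(3), of 2] assms(2)
    by (auto simp: L2_norm_on_power2 intro: order_tendstoD)
  have "\<forall>\<^sub>F n in sequentially. sqint S (\<lambda>z. \<Phi> n z - u z) < \<delta>"
    using \<Phi>(2) by (intro ev) (simp add: H1_converges_def)
  moreover have "\<forall>\<^sub>F n in sequentially.
      \<forall>b\<in>Basis. sqint S (\<lambda>z. pderiv_at b (\<Phi> n) z - weak_deriv S b u z) < \<delta>"
    using \<Phi>(2) by (intro eventually_ball_finite ballI ev) (simp_all add: H1_converges_def)
  ultimately have "\<forall>\<^sub>F n in sequentially. sqint S (\<lambda>z. \<Phi> n z - u z) < \<delta> \<and>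
      (\<forall>b\<in>Basis. sqint S (\<lambda>z. pderiv_at b (\<Phi> n) z - weak_deriv S b u z) < \<delta>) \<and>
      sqint F (\<lambda>y. \<Phi> n (\<gamma> y) - g y) < \<delta>"
    using ev' by (simp only: eventually_conj_iff)
  then obtain n where "sqint S (\<lambda>z. \<Phi> n z - u z) < \<delta> \<and>
      (\<forall>b\<in>Basis. sqint S (\<lambda>z. pderiv_at b (\<Phi> n) z - weak_deriv S b u z) < \<delta>) \<and>
      sqint F (\<lambda>y. \<Phi> n (\<gamma> y) - g y) < \<delta>"
    using eventually_happens'[OF sequentially_bot] by blast
  with \<Phi>(1)[of n] that show ?thesis by blast
qed

text \<open>Integrate the \<open>x\<close>-derivative of \<open>(x - y) * h^2\<close>, where
  \<open>y\<close> is the endpoint opposite to \<open>s\<close>. Only the face at \<open>s\<close>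
  contributes, with weight of modulus \<open>xR - xL\<close>; dividing by this length gives the
  constant.\<close>

lemma trace_inequality:
  assumes "0 < T" "xL < xR" and s: "s \<in> {xL, xR}"
    and h: "continuous_on ({0..T} \<times> {xL..xR} \<times> {0..1}) h"
      "continuous_on ({0..T} \<times> {xL..xR} \<times> {0..1}) h'"
    and deriv: "\<And>t x v. t \<in> {0..T} \<Longrightarrow> x \<in> {xL..xR} \<Longrightarrow> v \<in> {0..1} \<Longrightarrow>
      ((\<lambda>s. h (t, s, v)) has_real_derivative h' (t, x, v)) (at x within {xL..xR})"
  shows "sqint ({0<..<T} \<times> \<Omega>plus) (\<lambda>(t, v). h (t, s, v))
    \<le> (1 + 1 / (xR - xL)) * (sqint (TDV T xL xR) h + sqint (TDV T xL xR) h')"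
proof -
  define X where "X = xR - xL"
  have X: "0 < X" using assms(2) by (simp add: X_def)
  \<comment> \<open>The opposite endpoint, so that the multiplier \<open>x - y\<close> vanishes on
    the face that is not wanted.\<close>
  define y where "y = (if s = xL then xR else xL)"
  have y: "y \<in> {xL, xR}" "\<bar>s - y\<bar> = X" "(s = xL \<and> y = xR) \<or> (s = xR \<and> y = xL)"
    using s assms(2) by (auto simp: y_def X_def)
  define U where "U = (\<lambda>z. (fst (snd z) - y) * (h z)\<^sup>2)"
  define U' where "U' = (\<lambda>z. (h z)\<^sup>2 + (fst (snd z) - y) * (2 * h z * h' z))"
  have cont: "continuous_on ({0..T} \<times> {xL..xR} \<times> {0..1}) U" "continuous_on ({0..T} \<times> {xL..xR} \<times> {0..1}) U'"
    unfolding U_def U'_def by (intro continuous_intros h)+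
  have dU: "((\<lambda>s. U (t, s, v)) has_real_derivative U' (t, x, v)) (at x within {xL..xR})"
    if "t \<in> {0..T}" "x \<in> {xL..xR}" "v \<in> {0..1}" for t x v
    unfolding U_def U'_def fst_conv snd_conv
    by (rule derivative_eq_intros deriv[OF that] refl | simp)+
  have int: "(LINT z:TDV T xL xR|lborel. U' z)
      = (LINT (t, v):{0<..<T} \<times> \<Omega>plus|lborel. U (t, xR, v) - U (t, xL, v))"
    using assms(2) cont dU by (intro set_integral_TDV_dx) auto
  have "X * sqint ({0<..<T} \<times> \<Omega>plus) (\<lambda>(t, v). h (t, s, v))
      = \<bar>LINT (t, v):{0<..<T} \<times> \<Omega>plus|lborel. U (t, xR, v) - U (t, xL, v)\<bar>"
  proof -
    have "U (t, xR, v) - U (t, xL, v) = X * (h (t, s, v))\<^sup>2" for t v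
      using y(3) by (auto simp: U_def X_def algebra_simps)
    then show ?thesis using X sqint_nonneg[of "{0<..<T} \<times> \<Omega>plus" "\<lambda>(t, v). h (t, s, v)"]
      by (simp add: sqint_def split_beta' abs_mult)
  qed
  also have "\<dots> = \<bar>LINT z:TDV T xL xR|lborel. U' z\<bar>" using int by simp
  also have "\<dots> \<le> (LINT z:TDV T xL xR|lborel. \<bar>U' z\<bar>)"
    using integral_abs_bound[of lborel "\<lambda>z. indicator (TDV T xL xR) z *\<^sub>R U' z"]
    by (simp add: set_lebesgue_integral_def abs_mult)
  also have "\<dots> \<le> (LINT z:TDV T xL xR|lborel. (1 + X) * ((h z)\<^sup>2 + (h' z)\<^sup>2))"
  proof (intro set_integral_mono set_integrable_TDV continuous_intros cont h)
    fix z assume "z \<in> TDV T xL xR"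
    then have "fst (snd z) \<in> {xL..xR}" by (auto simp: TDV_def)
    then have 1: "\<bar>fst (snd z) - y\<bar> \<le> X" using y(1) by (auto simp: X_def)
    have "2 * (\<bar>h z\<bar> * \<bar>h' z\<bar>) \<le> (h z)\<^sup>2 + (h' z)\<^sup>2"
      using zero_le_power2[of "\<bar>h z\<bar> - \<bar>h' z\<bar>"] by (simp add: power2_diff)
    then have "\<bar>fst (snd z) - y\<bar> * (2 * (\<bar>h z\<bar> * \<bar>h' z\<bar>)) \<le> X * ((h z)\<^sup>2 + (h' z)\<^sup>2)"
      using 1 X by (intro mult_mono) auto
    moreover have "\<bar>U' z\<bar> \<le> (h z)\<^sup>2 + \<bar>fst (snd z) - y\<bar> * (2 * (\<bar>h z\<bar> * \<bar>h' z\<bar>))"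
      unfolding U'_def by (rule order_trans[OF abs_triangle_ineq]) (simp add: abs_mult)
    moreover have "0 \<le> (h' z)\<^sup>2" by simp
    ultimately show "\<bar>U' z\<bar> \<le> (1 + X) * ((h z)\<^sup>2 + (h' z)\<^sup>2)"
      unfolding distrib_right mult_1 by linarith
  qed
  also have "\<dots> = (1 + X) * (sqint (TDV T xL xR) h + sqint (TDV T xL xR) h')"
    using L2_onD(2)[OF L2_on_TDV[OF h(1)]] L2_onD(2)[OF L2_on_TDV[OF h(2)]]
    by (simp add: sqint_def set_integral_add)
  also have "1 + X = X * (1 + 1 / X)" using X by (simp add: field_simps)
  finally show ?thesis using X unfolding X_def[symmetric] mult.assoc by simp
qed

text \<open>Extend \<open>h\<close> as constant in \<open>v\<close>; all norms are preserved since
  \<open>\<Omega>plus\<close> has measure 1.\<close>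

lemma trace_inequality2:
  assumes "0 < T" "xL < xR" "s \<in> {xL, xR}"
    and h: "continuous_on ({0..T} \<times> {xL..xR}) h" "continuous_on ({0..T} \<times> {xL..xR}) h'"
    and deriv: "\<And>t x. t \<in> {0..T} \<Longrightarrow> x \<in> {xL..xR} \<Longrightarrow>
      ((\<lambda>s. h (t, s)) has_real_derivative h' (t, x)) (at x within {xL..xR})"
  shows "sqint {0<..<T} (\<lambda>t. h (t, s))
    \<le> (1 + 1 / (xR - xL)) * (sqint (TD T xL xR) h + sqint (TD T xL xR) h')"
proof -
  have "L2_on {0<..<T} (\<lambda>t. h (t, s))"
    using assms(2,3) by (intro L2_on_lines(2)[OF h(1)]) auto
  then have "sqint {0<..<T} (\<lambda>t. h (t, s)) = sqint ({0<..<T} \<times> \<Omega>plus) (\<lambda>(t, v). h (t, s))"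
    by (simp add: L2_on_lift(2))
  also have "\<dots> \<le> (1 + 1 / (xR - xL)) * (sqint (TDV T xL xR) (\<lambda>(t, x, v). h (t, x))
      + sqint (TDV T xL xR) (\<lambda>(t, x, v). h' (t, x)))"
    using trace_inequality[of T xL xR s "\<lambda>(t, x, v). h (t, x)" "\<lambda>(t, x, v). h' (t, x)"]
      assms(1-3) h[THEN continuous_on_lift] deriv
    by (simp add: split_beta')
  finally show ?thesis
    using h[THEN L2_on_TD] by (simp add: L2_on_TDV_lift(2))
qed

text \<open>Both approximations are close to \<open>u\<close> together with one derivative, so
  \<open>\<Phi> - \<Psi>\<close> and its derivative have squared norm at most
  \<open>4 * \<delta>\<close> each. The trace inequality gives \<open>8 * K * \<delta>\<close> on
  the face; the triangle inequality through \<open>\<Psi>\<close> doubles this and adds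
  \<open>2 * \<delta>\<close>.\<close>

lemma sqint_trace_transfer:
  assumes trace: "sqint F (\<lambda>y. \<Phi> (\<gamma> y) - \<Psi> (\<gamma> y))
      \<le> K * (sqint S (\<lambda>z. \<Phi> z - \<Psi> z) + sqint S (\<lambda>z. \<Phi>' z - \<Psi>' z))" and "0 \<le> K"
    and F: "L2_on F (\<lambda>y. \<Phi> (\<gamma> y))" "L2_on F (\<lambda>y. \<Psi> (\<gamma> y))" "L2_on F g"
    and S: "L2_on S \<Phi>" "L2_on S \<Psi>" "L2_on S u" "L2_on S \<Phi>'" "L2_on S \<Psi>'" "L2_on S u'"
    and \<delta>: "sqint S (\<lambda>z. \<Phi> z - u z) < \<delta>" "sqint S (\<lambda>z. \<Psi> z - u z) < \<delta>"
      "sqint S (\<lambda>z. \<Phi>' z - u' z) < \<delta>" "sqint S (\<lambda>z. \<Psi>' z - u' z) < \<delta>"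
      "sqint F (\<lambda>y. \<Psi> (\<gamma> y) - g y) < \<delta>"
  shows "sqint F (\<lambda>y. \<Phi> (\<gamma> y) - g y) < (16 * K + 2) * \<delta>"
proof -
  have "sqint S (\<lambda>z. \<Phi> z - \<Psi> z) \<le> 4 * \<delta>" "sqint S (\<lambda>z. \<Phi>' z - \<Psi>' z) \<le> 4 * \<delta>"
    using sqint_triangle[OF S(1,3,2)] sqint_triangle[OF S(4,6,5)] \<delta>(1-4)
    by (simp_all add: sqint_diff_commute[of S u] sqint_diff_commute[of S u'])
  then have "K * (sqint S (\<lambda>z. \<Phi> z - \<Psi> z) + sqint S (\<lambda>z. \<Phi>' z - \<Psi>' z)) \<le> K * (8 * \<delta>)"
    using \<open>0 \<le> K\<close> by (intro mult_left_mono) auto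
  with trace have "sqint F (\<lambda>y. \<Phi> (\<gamma> y) - \<Psi> (\<gamma> y)) \<le> 8 * K * \<delta>" by simp
  with sqint_triangle[OF F] \<delta>(5) show ?thesis by (simp add: distrib_right)
qed

text \<open>Each trace comes with its own approximating sequence. By the trace inequality, the sequence for the
  face \<open>t = 0\<close> also attains the traces on the lateral faces.\<close>

lemma initial_boundary_approx2:
  assumes T: "0 < T" and x: "xL < xR" and I: "initial_data2 T xL xR u gI"
    and B: "boundary_data2 T xL xR u gB" and "0 < \<delta>"
  obtains \<Phi> where "C1_near ({0..T} \<times> {xL..xR}) \<Phi>" "sqint (TD T xL xR) (\<lambda>z. \<Phi> z - u z) < \<delta>"
    "\<And>b. b \<in> Basis \<Longrightarrow> sqint (TD T xL xR) (\<lambda>z. pderiv_at b \<Phi> z - weak_deriv (TD T xL xR) b u z) < \<delta>"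
    "sqint {xL<..<xR} (\<lambda>x. \<Phi> (0, x) - gI x) < \<delta>"
    "\<And>s. s \<in> {xL, xR} \<Longrightarrow> sqint {0<..<T} (\<lambda>t. \<Phi> (t, s) - gB (t, s)) < \<delta>"
proof -
  let ?K = "1 + 1 / (xR - xL)" and ?D = "{0..T} \<times> {xL..xR}"
  \<comment> \<open>The tolerance is divided by the loss factor of
    \<open>sqint_trace_transfer\<close>.\<close>
  define \<eta> where "\<eta> = \<delta> / (16 * ?K + 2)"
  have K: "0 \<le> ?K" using x by simp
  moreover have "1 \<le> 16 * k + 2" if "0 \<le> k" for k :: real using that by simp
  ultimately have "1 \<le> 16 * ?K + 2" by blast
  moreover have "0 < \<delta> / c \<and> c * (\<delta> / c) = \<delta> \<and> \<delta> / c \<le> \<delta>" if "1 \<le> c" for c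
    using that \<open>0 < \<delta>\<close> by (simp add: divide_le_eq)
  ultimately have \<eta>: "0 < \<eta>" "(16 * ?K + 2) * \<eta> = \<delta>" "\<eta> \<le> \<delta>"
    unfolding \<eta>_def by blast+
  have u: "in_H1 (TD T xL xR) u" using I by (simp add: initial_data2_def has_trace_def)
  obtain \<Phi> where \<Phi>: "test_function UNIV \<Phi>" "sqint (TD T xL xR) (\<lambda>z. \<Phi> z - u z) < \<eta>"
    "\<And>b. b \<in> Basis \<Longrightarrow> sqint (TD T xL xR) (\<lambda>z. pderiv_at b \<Phi> z - weak_deriv (TD T xL xR) b u z) < \<eta>"
    "sqint {xL<..<xR} (\<lambda>x. \<Phi> (0, x) - gI x) < \<eta>"
    using has_trace_approx[OF I[unfolded initial_data2_def] \<eta>(1)] by blast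
  note C\<Phi> = test_function_imp_C1_near[OF \<Phi>(1), of ?D]
  have "sqint {0<..<T} (\<lambda>t. \<Phi> (t, s) - gB (t, s)) < \<delta>" if s: "s \<in> {xL, xR}" for s
  proof -
    have s': "s \<in> {xL..xR}" using s x by auto
    have tr: "has_trace (TD T xL xR) u (\<lambda>t. (t, s)) {0<..<T} (\<lambda>t. gB (t, s))"
      using B s by (auto simp: boundary_data2_def)
    obtain \<Psi> where \<Psi>: "test_function UNIV \<Psi>" "sqint (TD T xL xR) (\<lambda>z. \<Psi> z - u z) < \<eta>"
      "\<And>b. b \<in> Basis \<Longrightarrow> sqint (TD T xL xR) (\<lambda>z. pderiv_at b \<Psi> z - weak_deriv (TD T xL xR) b u z) < \<eta>"
      "sqint {0<..<T} (\<lambda>t. \<Psi> (t, s) - gB (t, s)) < \<eta>"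
      using has_trace_approx[OF tr \<eta>(1)] by blast
    note C\<Psi> = test_function_imp_C1_near[OF \<Psi>(1), of ?D]
    note cont = C1_near_imp_continuous_on[OF C\<Phi>] C1_near_imp_continuous_on[OF C\<Psi>]
      C1_nearD2(2)[OF C\<Phi>] C1_nearD2(2)[OF C\<Psi>]
    have "sqint {0<..<T} (\<lambda>t. \<Phi> (t, s) - \<Psi> (t, s)) \<le> ?K * (sqint (TD T xL xR) (\<lambda>z. \<Phi> z - \<Psi> z)
        + sqint (TD T xL xR) (\<lambda>z. pderiv_at dx2 \<Phi> z - pderiv_at dx2 \<Psi> z))"
      using C1_nearD2(4)[OF C\<Phi>] C1_nearD2(4)[OF C\<Psi>]
      by (intro trace_inequality2 T x s DERIV_diff continuous_on_diff cont)
    then show ?thesis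
      unfolding \<eta>(2)[symmetric]
      using K cont[THEN L2_on_TD] L2_on_lines(2)[OF cont(1) s'] L2_on_lines(2)[OF cont(2) s'] in_H1D[OF u]
        \<Phi>(2) \<Psi>(2) \<Phi>(3)[of dx2] \<Psi>(3)[of dx2] \<Psi>(4) tr
      by (intro sqint_trace_transfer[where \<gamma> = "\<lambda>t. (t, s)" and \<Phi> = \<Phi> and \<Psi> = \<Psi>
            and \<Phi>' = "pderiv_at dx2 \<Phi>" and \<Psi>' = "pderiv_at dx2 \<Psi>" and S = "TD T xL xR"
            and u = u and u' = "weak_deriv (TD T xL xR) dx2 u" and g = "\<lambda>t. gB (t, s)"])
        (simp_all add: has_trace_def)
  qed
  with that[OF C\<Phi>] \<Phi> \<eta>(3) show ?thesis by force
qed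

lemma initial_boundary_approx3:
  assumes T: "0 < T" and x: "xL < xR" and I: "initial_data3 T xL xR u gI"
    and B: "boundary_data3 T xL xR u gB" and "0 < \<delta>"
  obtains \<Phi> where "C1_near ({0..T} \<times> {xL..xR} \<times> {0..1}) \<Phi>" "sqint (TDV T xL xR) (\<lambda>z. \<Phi> z - u z) < \<delta>"
    "\<And>b. b \<in> Basis \<Longrightarrow> sqint (TDV T xL xR) (\<lambda>z. pderiv_at b \<Phi> z - weak_deriv (TDV T xL xR) b u z) < \<delta>"
    "sqint ({xL<..<xR} \<times> \<Omega>plus) (\<lambda>(x, v). \<Phi> (0, x, v) - gI (x, v)) < \<delta>"
    "\<And>s. s \<in> {xL, xR} \<Longrightarrow> sqint ({0<..<T} \<times> \<Omega>plus) (\<lambda>(t, v). \<Phi> (t, s, v) - gB (t, s, v)) < \<delta>"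
proof -
  let ?K = "1 + 1 / (xR - xL)" and ?D = "{0..T} \<times> {xL..xR} \<times> {0..1::real}"
  \<comment> \<open>The same loss factor \<open>16 * ?K + 2\<close> of the transfer between
    approximating sequences.\<close>
  define \<eta> where "\<eta> = \<delta> / (16 * ?K + 2)"
  have K: "0 \<le> ?K" using x by simp
  moreover have "1 \<le> 16 * k + 2" if "0 \<le> k" for k :: real using that by simp
  ultimately have "1 \<le> 16 * ?K + 2" by blast
  moreover have "0 < \<delta> / c \<and> c * (\<delta> / c) = \<delta> \<and> \<delta> / c \<le> \<delta>" if "1 \<le> c" for c
    using that \<open>0 < \<delta>\<close> by (simp add: divide_le_eq)
  ultimately have \<eta>: "0 < \<eta>" "(16 * ?K + 2) * \<eta> = \<delta>" "\<eta> \<le> \<delta>"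
    unfolding \<eta>_def by blast+
  have u: "in_H1 (TDV T xL xR) u" using I by (simp add: initial_data3_def has_trace_def)
  obtain \<Phi> where \<Phi>: "test_function UNIV \<Phi>" "sqint (TDV T xL xR) (\<lambda>z. \<Phi> z - u z) < \<eta>"
    "\<And>b. b \<in> Basis \<Longrightarrow> sqint (TDV T xL xR) (\<lambda>z. pderiv_at b \<Phi> z - weak_deriv (TDV T xL xR) b u z) < \<eta>"
    and "sqint ({xL<..<xR} \<times> \<Omega>plus) (\<lambda>y. \<Phi> ((\<lambda>(x, v). (0, x, v)) y) - gI y) < \<eta>"
    using has_trace_approx[OF I[unfolded initial_data3_def] \<eta>(1)] by blast
  then have \<Phi>4: "sqint ({xL<..<xR} \<times> \<Omega>plus) (\<lambda>(x, v). \<Phi> (0, x, v) - gI (x, v)) < \<eta>"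
    by (simp add: split_beta')
  note C\<Phi> = test_function_imp_C1_near[OF \<Phi>(1), of ?D]
  have "sqint ({0<..<T} \<times> \<Omega>plus) (\<lambda>(t, v). \<Phi> (t, s, v) - gB (t, s, v)) < \<delta>" if s: "s \<in> {xL, xR}" for s
  proof -
    let ?\<gamma> = "\<lambda>(t, v). (t, s, v)"
    have s': "s \<in> {xL..xR}" using s x by auto
    have tr: "has_trace (TDV T xL xR) u ?\<gamma> ({0<..<T} \<times> \<Omega>plus) (\<lambda>(t, v). gB (t, s, v))"
      using B s by (auto simp: boundary_data3_def)
    obtain \<Psi> where \<Psi>: "test_function UNIV \<Psi>" "sqint (TDV T xL xR) (\<lambda>z. \<Psi> z - u z) < \<eta>"
      "\<And>b. b \<in> Basis \<Longrightarrow> sqint (TDV T xL xR) (\<lambda>z. pderiv_at b \<Psi> z - weak_deriv (TDV T xL xR) b u z) < \<eta>"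
      "sqint ({0<..<T} \<times> \<Omega>plus) (\<lambda>y. \<Psi> (?\<gamma> y) - (\<lambda>(t, v). gB (t, s, v)) y) < \<eta>"
      using has_trace_approx[OF tr \<eta>(1)] by blast
    note C\<Psi> = test_function_imp_C1_near[OF \<Psi>(1), of ?D]
    note cont = C1_near_imp_continuous_on[OF C\<Phi>] C1_near_imp_continuous_on[OF C\<Psi>]
      C1_nearD3(2)[OF C\<Phi>] C1_nearD3(2)[OF C\<Psi>]
    have "sqint ({0<..<T} \<times> \<Omega>plus) (\<lambda>(t, v). \<Phi> (t, s, v) - \<Psi> (t, s, v))
        \<le> ?K * (sqint (TDV T xL xR) (\<lambda>z. \<Phi> z - \<Psi> z)
          + sqint (TDV T xL xR) (\<lambda>z. pderiv_at dx3 \<Phi> z - pderiv_at dx3 \<Psi> z))"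
      using C1_nearD3(4)[OF C\<Phi>] C1_nearD3(4)[OF C\<Psi>]
      by (intro trace_inequality T x s DERIV_diff continuous_on_diff cont)
    moreover have "L2_on ({0<..<T} \<times> \<Omega>plus) (\<lambda>y. f (?\<gamma> y))" if "continuous_on ?D f" for f
      using L2_on_faces(2)[OF that s'] by (simp add: split_beta')
    ultimately have "sqint ({0<..<T} \<times> \<Omega>plus) (\<lambda>y. \<Phi> (?\<gamma> y) - (\<lambda>(t, v). gB (t, s, v)) y)
        < (16 * ?K + 2) * \<eta>"
      using K cont[THEN L2_on_TDV] cont in_H1D[OF u]
        \<Phi>(2) \<Psi>(2) \<Phi>(3)[of dx3] \<Psi>(3)[of dx3] \<Psi>(4) tr
      by (intro sqint_trace_transfer[where \<gamma> = ?\<gamma> and \<Phi> = \<Phi> and \<Psi> = \<Psi>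
            and \<Phi>' = "pderiv_at dx3 \<Phi>" and \<Psi>' = "pderiv_at dx3 \<Psi>" and S = "TDV T xL xR"
            and u = u and u' = "weak_deriv (TDV T xL xR) dx3 u"])
        (simp_all add: has_trace_def split_beta')
    then show ?thesis unfolding \<eta>(2) by (simp add: split_beta')
  qed
  with that[OF C\<Phi>] \<Phi> \<Phi>4 \<eta>(3) show ?thesis by force
qed

section \<open>Residuals of the approximations\<close>

lemma vavg_diff:
  assumes "set_integrable lborel \<Omega>plus f" "set_integrable lborel \<Omega>plus g"
  shows "vavg (\<lambda>v. f v - g v) = vavg f - vavg g"
  unfolding vavg_def using assms by simp

lemma L2_on_vmult:
  assumes "L2_on (TDV T xL xR) q"
  shows "L2_on (TDV T xL xR) (\<lambda>z. snd (snd z) * q z)"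
    and "sqint (TDV T xL xR) (\<lambda>z. snd (snd z) * q z) \<le> sqint (TDV T xL xR) q"
proof -
  have m: "(\<lambda>z::real \<times> real \<times> real. snd (snd z)) \<in> borel_measurable borel"
    by (intro borel_measurable_continuous_onI continuous_intros)
  have le: "\<bar>snd (snd z)\<bar> \<le> 1" if "z \<in> TDV T xL xR" for z
    using that by (auto simp: TDV_def)
  show "L2_on (TDV T xL xR) (\<lambda>z. snd (snd z) * q z)"
    "sqint (TDV T xL xR) (\<lambda>z. snd (snd z) * q z) \<le> sqint (TDV T xL xR) q"
    using L2_on_mult_bounded[OF assms m le] by blast+
qed

text \<open>Needed to combine an identity for velocity averages, valid for almost every
  \<open>(t, x)\<close>, with an equation valid for almost every \<open>(t, x, v)\<close>.\<close>

lemma AE_lift_TD: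
  assumes "AE y in lborel. P y"
  shows "AE z in (lborel :: (real \<times> real \<times> real) measure). P (fst z, fst (snd z))"
proof (rule AE_lborel_assoc)
  show "AE z in lborel. P (fst (fst (fst z), snd (fst z), snd z),
      fst (snd (fst (fst z), snd (fst z), snd (z :: (real \<times> real) \<times> real))))"
    using AE_lborel_fst[OF assms] by simp
qed

text \<open>\<open>\<rho>\<close>, \<open>j\<close>, \<open>w\<close> are exact, the suffix
  \<open>N\<close> marks the networks and the suffix \<open>A\<close> smooth approximations of the
  exact solution. The smooth fields are instantiated twice: \<open>N\<close> supplies the residuals
  in the loss, and \<open>A\<close>, with the differences of approximations and networks, supplies
  the energy estimate.\<close>

locale approximation =
  fixes T xL xR \<epsilon> :: real and \<rho> :: "real \<times> real \<Rightarrow> real" and j w :: "real \<times> real \<times> real \<Rightarrow> real"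
    and \<rho>N :: "real \<times> real \<Rightarrow> real" and jN wN :: "real \<times> real \<times> real \<Rightarrow> real"
    and \<rho>A :: "real \<times> real \<Rightarrow> real" and jA wA :: "real \<times> real \<times> real \<Rightarrow> real"
  assumes T: "0 < T" and x: "xL < xR" and \<epsilon>: "0 < \<epsilon>" "\<epsilon> \<le> 1"
    and exact: "exact_solution T xL xR \<epsilon> \<rho> j w"
    and C1_N: "C1_near ({0..T} \<times> {xL..xR}) \<rho>N" "C1_near ({0..T} \<times> {xL..xR} \<times> {0..1}) jN"
      "C1_near ({0..T} \<times> {xL..xR} \<times> {0..1}) wN"
    and C1_A: "C1_near ({0..T} \<times> {xL..xR}) \<rho>A" "C1_near ({0..T} \<times> {xL..xR} \<times> {0..1}) jA"
      "C1_near ({0..T} \<times> {xL..xR} \<times> {0..1}) wA"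
begin

abbreviation "D2 \<equiv> TD T xL xR"
abbreviation "D3 \<equiv> TDV T xL xR"

lemma H1: "in_H1 D2 \<rho>" "in_H1 D3 j" "in_H1 D3 w"
  using exact by (simp_all add: exact_solution_def)

sublocale N: smooth_fields T xL xR \<epsilon> \<rho>N "pderiv_at dt2 \<rho>N" "pderiv_at dx2 \<rho>N"
  jN "pderiv_at dt3 jN" "pderiv_at dx3 jN" wN "pderiv_at dt3 wN" "pderiv_at dx3 wN"
  by (intro smooth_fields.intro T x \<epsilon> C1_N[THEN C1_near_imp_continuous_on] C1_nearD2[OF C1_N(1)]
      C1_nearD3[OF C1_N(2)] C1_nearD3[OF C1_N(3)])

sublocale A: smooth_fields T xL xR \<epsilon> "\<lambda>z. \<rho>A z - \<rho>N z"
  "\<lambda>z. pderiv_at dt2 \<rho>A z - pderiv_at dt2 \<rho>N z" "\<lambda>z. pderiv_at dx2 \<rho>A z - pderiv_at dx2 \<rho>N z"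
  "\<lambda>z. jA z - jN z"
  "\<lambda>z. pderiv_at dt3 jA z - pderiv_at dt3 jN z" "\<lambda>z. pderiv_at dx3 jA z - pderiv_at dx3 jN z"
  "\<lambda>z. wA z - wN z"
  "\<lambda>z. pderiv_at dt3 wA z - pderiv_at dt3 wN z" "\<lambda>z. pderiv_at dx3 wA z - pderiv_at dx3 wN z"
  by (intro smooth_fields.intro T x \<epsilon> continuous_on_diff DERIV_diff
      C1_N[THEN C1_near_imp_continuous_on] C1_nearD2[OF C1_N(1)]
      C1_nearD3[OF C1_N(2)] C1_nearD3[OF C1_N(3)] C1_A[THEN C1_near_imp_continuous_on]
      C1_nearD2[OF C1_A(1)] C1_nearD3[OF C1_A(2)] C1_nearD3[OF C1_A(3)])

text \<open>These nine functions compare the approximations with the exact solution, with classical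
  derivatives against weak ones. Their squared norms can be made arbitrarily small.\<close>

definition "\<rho>E = (\<lambda>z. \<rho>A z - \<rho> z)"
definition "\<rho>E\<^sub>t = (\<lambda>z. pderiv_at dt2 \<rho>A z - weak_deriv D2 dt2 \<rho> z)"
definition "\<rho>E\<^sub>x = (\<lambda>z. pderiv_at dx2 \<rho>A z - weak_deriv D2 dx2 \<rho> z)"
definition "jE = (\<lambda>z. jA z - j z)"
definition "jE\<^sub>t = (\<lambda>z. pderiv_at dt3 jA z - weak_deriv D3 dt3 j z)"
definition "jE\<^sub>x = (\<lambda>z. pderiv_at dx3 jA z - weak_deriv D3 dx3 j z)"
definition "wE = (\<lambda>z. wA z - w z)"
definition "wE\<^sub>t = (\<lambda>z. pderiv_at dt3 wA z - weak_deriv D3 dt3 w z)"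
definition "wE\<^sub>x = (\<lambda>z. pderiv_at dx3 wA z - weak_deriv D3 dx3 w z)"

lemmas E_defs = \<rho>E_def \<rho>E\<^sub>t_def \<rho>E\<^sub>x_def jE_def jE\<^sub>t_def jE\<^sub>x_def wE_def wE\<^sub>t_def wE\<^sub>x_def

lemma L2_E: "L2_on D2 \<rho>E" "L2_on D2 \<rho>E\<^sub>t" "L2_on D2 \<rho>E\<^sub>x" "L2_on D3 jE" "L2_on D3 jE\<^sub>t" "L2_on D3 jE\<^sub>x"
  "L2_on D3 wE" "L2_on D3 wE\<^sub>t" "L2_on D3 wE\<^sub>x"
proof -
  note A = C1_A[THEN C1_near_imp_continuous_on] C1_nearD2(1,2)[OF C1_A(1)]
    C1_nearD3(1,2)[OF C1_A(2)] C1_nearD3(1,2)[OF C1_A(3)]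
  show "L2_on D2 \<rho>E" "L2_on D2 \<rho>E\<^sub>t" "L2_on D2 \<rho>E\<^sub>x" "L2_on D3 jE" "L2_on D3 jE\<^sub>t" "L2_on D3 jE\<^sub>x"
    "L2_on D3 wE" "L2_on D3 wE\<^sub>t" "L2_on D3 wE\<^sub>x"
    unfolding E_defs by (intro L2_on_diff L2_on_TD L2_on_TDV in_H1D H1 Basis_directions A)+
qed

definition vE :: "real \<times> real \<Rightarrow> real" where
  "vE = (\<lambda>y. vavg (\<lambda>v. v * jE\<^sub>x (fst y, snd y, v)))"

lemma vE: "L2_on D2 vE" "sqint D2 vE \<le> sqint D3 jE\<^sub>x"
proof -
  note v = L2_on_TD_vavg[OF L2_on_vmult(1)[OF L2_E(6)]]
  show "L2_on D2 vE" using v(1) by (simp add: vE_def split_beta')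
  show "sqint D2 vE \<le> sqint D3 jE\<^sub>x"
    using v(2) L2_on_vmult(2)[OF L2_E(6)] by (simp add: vE_def split_beta')
qed

text \<open>Splitting the average is legitimate only where \<open>v\<close> times the weak
  derivative is integrable in \<open>v\<close>, hence for almost every
  \<open>(t, x)\<close>.\<close>

lemma vavg_flux:
  "AE (t, x) in lborel. (t, x) \<in> D2 \<longrightarrow>
     vavg (\<lambda>v. v * (pderiv_at dx3 jA (t, x, v) - pderiv_at dx3 jN (t, x, v)))
      = vE (t, x) + vavg (\<lambda>v. v * weak_deriv D3 dx3 j (t, x, v))
        - vavg (\<lambda>v. v * pderiv_at dx3 jN (t, x, v))"
proof -
  have "L2_on D3 (\<lambda>z. snd (snd z) * weak_deriv D3 dx3 j z)"
    by (intro L2_on_vmult in_H1D H1 Basis_directions)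
  from L2_on_TD_vavg(3)[OF this] show ?thesis
  proof eventually_elim
    case (elim y)
    obtain t x where y: "y = (t, x)" by (cases y)
    show ?case
      unfolding y split
    proof
      assume tx: "(t, x) \<in> D2"
      then have "L2_on \<Omega>plus (\<lambda>v. v * weak_deriv D3 dx3 j (t, x, v))"
        using elim by (simp add: y)
      then have 1: "set_integrable lborel \<Omega>plus (\<lambda>v. v * weak_deriv D3 dx3 j (t, x, v))"
        by (rule L2_on_imp_set_integrable) simp_all
      have c: "set_integrable lborel \<Omega>plus (\<lambda>v. v * h (t, x, v))"
        if "continuous_on ({0..T} \<times> {xL..xR} \<times> {0..1}) h" for h :: "real \<times> real \<times> real \<Rightarrow> real"
        using continuous_on_slice[OF that, of t x] tx
        by (intro set_integrable_compact_subset[of \<Omega>plus] continuous_intros) (auto simp: TD_def)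
      note 2 = c[OF C1_nearD3(2)[OF C1_A(2)]] and 3 = c[OF C1_nearD3(2)[OF C1_N(2)]]
      show "vavg (\<lambda>v. v * (pderiv_at dx3 jA (t, x, v) - pderiv_at dx3 jN (t, x, v)))
        = vE (t, x) + vavg (\<lambda>v. v * weak_deriv D3 dx3 j (t, x, v))
          - vavg (\<lambda>v. v * pderiv_at dx3 jN (t, x, v))"
        using 1 2 3 by (simp add: vE_def jE\<^sub>x_def right_diff_distrib vavg_diff)
    qed
  qed
qed

text \<open>The operator is linear and vanishes on the exact solution, so the residual of
  approximation minus network is a small approximation error minus the residual of the
  network.\<close>

lemma residual1: "sqint D2 A.e1 \<le> 2 * sqint D2 N.e1 + 4 * (sqint D2 \<rho>E\<^sub>t + sqint D3 jE\<^sub>x)"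
proof -
  have L: "L2_on D2 (\<lambda>y. \<rho>E\<^sub>t y + vE y)" "L2_on D2 N.e1" "L2_on D2 A.e1"
    by (intro L2_on_add L2_E vE L2_on_TD N.cont_e1 A.cont_e1)+
  have ex: "AE (t, x) in lborel. (t, x) \<in> D2 \<longrightarrow>
      lhs1 (weak_deriv D2 dt2 \<rho>) (weak_deriv D3 dx3 j) t x = 0"
    using exact by (simp add: exact_solution_def)
  have "AE y in lborel. y \<in> D2 \<longrightarrow> A.e1 y = (\<rho>E\<^sub>t y + vE y) - N.e1 y"
    using ex vavg_flux
    by eventually_elim (auto simp: A.e1_def N.e1_def lhs1_def \<rho>E\<^sub>t_def)
  then have "sqint D2 A.e1 = sqint D2 (\<lambda>y. (\<rho>E\<^sub>t y + vE y) - N.e1 y)"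
    by (intro sqint_cong_AE L L2_on_diff)
  also have "\<dots> \<le> 2 * sqint D2 (\<lambda>y. \<rho>E\<^sub>t y + vE y) + 2 * sqint D2 N.e1"
    by (intro sqint_diff_le L)
  finally show ?thesis using sqint_add_le[OF L2_E(2) vE(1)] vE(2) unfolding distrib_left by linarith
qed

lemma sqint_scale_le:
  assumes "\<bar>k\<bar> \<le> 1" shows "sqint S (\<lambda>z. k * f z) \<le> sqint S f"
  using assms by (simp add: sqint_cmult mult_left_le_one_le abs_square_le_1)

lemma eps2: "\<bar>\<epsilon>\<^sup>2\<bar> \<le> 1" "\<bar>\<epsilon>\<bar> \<le> 1"
  using \<epsilon> by (simp_all add: power_le_one)

text \<open>As for \<open>residual1\<close>; the four error terms are split pairwise, which gives
  the factor 8, and both \<open>\<epsilon>\<close> and \<open>v\<close> are at most 1 in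
  modulus.\<close>

lemma residual2:
  "sqint D3 A.e2 \<le> 2 * sqint D3 N.e2 + 8 * (sqint D3 jE\<^sub>t + sqint D2 \<rho>E\<^sub>x + sqint D3 wE\<^sub>x + sqint D3 jE)"
proof -
  let ?p = "\<lambda>z. \<epsilon>\<^sup>2 * jE\<^sub>t z" and ?q = "\<lambda>z. snd (snd z) * (\<lambda>(t, x, v). \<rho>E\<^sub>x (t, x)) z"
    and ?r = "\<lambda>z. \<epsilon>\<^sup>2 * (snd (snd z) * wE\<^sub>x z)"
  note lift = L2_on_TDV_lift[OF L2_E(3)]
  have L: "L2_on D3 ?p" "L2_on D3 ?q" "L2_on D3 ?r"
    by (intro L2_on_cmult L2_E L2_on_vmult(1) lift(1))+
  have L1: "L2_on D3 (\<lambda>z. ?p z + ?q z)" "L2_on D3 (\<lambda>z. ?r z + jE z)"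
    by (intro L2_on_add L L2_E)+
  have L2: "L2_on D3 (\<lambda>z. (?p z + ?q z) + (?r z + jE z))" by (rule L2_on_add[OF L1])
  have LN: "L2_on D3 N.e2" "L2_on D3 A.e2" by (intro L2_on_TDV N.cont_e2 A.cont_e2)+
  have le: "sqint D3 ?p \<le> sqint D3 jE\<^sub>t" "sqint D3 ?q \<le> sqint D2 \<rho>E\<^sub>x" "sqint D3 ?r \<le> sqint D3 wE\<^sub>x"
    using sqint_scale_le[OF eps2(1)] L2_on_vmult(2)[OF lift(1)] lift(2)
      order_trans[OF sqint_scale_le[OF eps2(1)] L2_on_vmult(2)[OF L2_E(9)]]
    by simp_all
  have ex: "AE (t, x, v) in lborel. (t, x, v) \<in> D3 \<longrightarrow>
      lhs2 \<epsilon> (weak_deriv D3 dt3 j) (weak_deriv D2 dx2 \<rho>) (weak_deriv D3 dx3 w) j t x v = 0"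
    using exact by (simp add: exact_solution_def)
  then have "AE z in lborel. z \<in> D3 \<longrightarrow> A.e2 z = ((?p z + ?q z) + (?r z + jE z)) - N.e2 z"
    by eventually_elim (auto simp: A.e2_def N.e2_def lhs2_def E_defs algebra_simps)
  then have "sqint D3 A.e2 = sqint D3 (\<lambda>z. ((?p z + ?q z) + (?r z + jE z)) - N.e2 z)"
    by (intro sqint_cong_AE LN L2 L2_on_diff)
  also have "\<dots> \<le> 2 * sqint D3 (\<lambda>z. (?p z + ?q z) + (?r z + jE z)) + 2 * sqint D3 N.e2"
    by (intro sqint_diff_le L2 LN)
  finally show ?thesis
    using sqint_add_le[OF L1] sqint_add_le[OF L(1,2)] sqint_add_le[OF L(3) L2_E(4)] le
    unfolding distrib_left by linarith
qed

text \<open>As for \<open>residual2\<close>, with the factor 16 because \<open>jE\<^sub>x\<close>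
  enters twice, directly and through its average.\<close>

lemma residual3:
  "sqint D3 A.e3 \<le> 2 * sqint D3 N.e3 + 16 * (sqint D3 wE\<^sub>t + sqint D3 wE + sqint D3 jE\<^sub>x)"
proof -
  let ?p = "\<lambda>z. \<epsilon>\<^sup>2 * wE\<^sub>t z" and ?q = "\<lambda>z. snd (snd z) * jE\<^sub>x z" and ?r = "\<lambda>(t, x, v). vE (t, x)"
  note lift = L2_on_TDV_lift[OF vE(1)]
  have L: "L2_on D3 ?p" "L2_on D3 ?q"
    by (intro L2_on_cmult L2_E L2_on_vmult(1))+
  have L1: "L2_on D3 (\<lambda>z. ?p z + wE z)" "L2_on D3 (\<lambda>z. ?q z - ?r z)"
    by (intro L2_on_add L2_on_diff L L2_E lift(1))+
  have L2: "L2_on D3 (\<lambda>z. (?p z + wE z) + (?q z - ?r z))" by (rule L2_on_add[OF L1])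
  have LN: "L2_on D3 N.e3" "L2_on D3 A.e3" by (intro L2_on_TDV N.cont_e3 A.cont_e3)+
  have le: "sqint D3 ?p \<le> sqint D3 wE\<^sub>t" "sqint D3 ?q \<le> sqint D3 jE\<^sub>x" "sqint D3 ?r \<le> sqint D3 jE\<^sub>x"
    using sqint_scale_le[OF eps2(1)] L2_on_vmult(2)[OF L2_E(6)] lift(2) vE(2)
    by simp_all
  have ex: "AE (t, x, v) in lborel. (t, x, v) \<in> D3 \<longrightarrow>
      lhs3 \<epsilon> (weak_deriv D3 dt3 w) w (weak_deriv D3 dx3 j) t x v = 0"
    using exact by (simp add: exact_solution_def)
  have "AE z in lborel. z \<in> D3 \<longrightarrow> A.e3 z = ((?p z + wE z) + (?q z - ?r z)) - N.e3 z"
    using ex AE_lift_TD[OF vavg_flux]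
  proof eventually_elim
    case (elim z)
    obtain t x v where z: "z = (t, x, v)" by (metis prod.exhaust)
    show ?case
    proof
      assume "z \<in> D3"
      then have "(t, x) \<in> D2" by (auto simp: z TD_def TDV_def)
      with elim \<open>z \<in> D3\<close> show "A.e3 z = ((?p z + wE z) + (?q z - ?r z)) - N.e3 z"
        by (simp add: z A.e3_def N.e3_def lhs3_def E_defs algebra_simps)
    qed
  qed
  then have "sqint D3 A.e3 = sqint D3 (\<lambda>z. ((?p z + wE z) + (?q z - ?r z)) - N.e3 z)"
    by (intro sqint_cong_AE LN L2 L2_on_diff)
  also have "\<dots> \<le> 2 * sqint D3 (\<lambda>z. (?p z + wE z) + (?q z - ?r z)) + 2 * sqint D3 N.e3"
    by (intro sqint_diff_le L2 LN)
  moreover have "0 \<le> sqint D3 wE" "0 \<le> sqint D3 wE\<^sub>t" by simp_all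
  ultimately show ?thesis
    using sqint_add_le[OF L1] sqint_add_le[OF L(1) L2_E(7)] sqint_diff_le[OF L(2) lift(1)] le
    unfolding distrib_left by linarith
qed

text \<open>Exact minus network is approximation minus network up to the reconstruction of the
  approximation errors.\<close>

lemma total_error:
  "sqint D3 (\<lambda>z. recon \<epsilon> \<rho> j w z - recon \<epsilon> \<rho>N jN wN z)
    \<le> 2 * sqint D3 (recon \<epsilon> (\<lambda>z. \<rho>A z - \<rho>N z) (\<lambda>z. jA z - jN z) (\<lambda>z. wA z - wN z))
      + 8 * (sqint D2 \<rho>E + sqint D3 jE + sqint D3 wE)"
proof -
  let ?a = "recon \<epsilon> (\<lambda>z. \<rho>A z - \<rho>N z) (\<lambda>z. jA z - jN z) (\<lambda>z. wA z - wN z)"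
  let ?p = "\<lambda>(t, x, v). \<rho>E (t, x)" and ?q = "\<lambda>z. \<epsilon> * jE z" and ?r = "\<lambda>z. \<epsilon>\<^sup>2 * wE z"
  note lift = L2_on_TDV_lift[OF L2_E(1)]
  have L: "L2_on D3 ?q" "L2_on D3 ?r" by (intro L2_on_cmult L2_E)+
  have L1: "L2_on D3 (\<lambda>z. ?p z + ?q z)" by (rule L2_on_add[OF lift(1) L(1)])
  have L2: "L2_on D3 (\<lambda>z. (?p z + ?q z) + ?r z)" by (rule L2_on_add[OF L1 L(2)])
  have La: "L2_on D3 ?a"
    unfolding recon_def split_beta' prod.collapse
    by (intro L2_on_TDV continuous_intros A.cont_b A.cont_c A.cont_lifted)
  have eq: "recon \<epsilon> \<rho> j w z - recon \<epsilon> \<rho>N jN wN z = ?a z - ((?p z + ?q z) + ?r z)" for z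
    by (simp add: recon_def E_defs split_beta' algebra_simps)
  have "sqint D3 (\<lambda>z. recon \<epsilon> \<rho> j w z - recon \<epsilon> \<rho>N jN wN z)
      \<le> 2 * sqint D3 ?a + 2 * sqint D3 (\<lambda>z. (?p z + ?q z) + ?r z)"
    unfolding eq by (rule sqint_diff_le[OF La L2])
  moreover have "sqint D3 ?p = sqint D2 \<rho>E" "sqint D3 ?q \<le> sqint D3 jE" "sqint D3 ?r \<le> sqint D3 wE"
    "0 \<le> sqint D3 wE"
    using lift(2) sqint_scale_le[OF eps2(1)] sqint_scale_le[OF eps2(2)] by simp_all
  ultimately show ?thesis
    using sqint_add_le[OF L1 L(2)] sqint_add_le[OF lift(1) L(1)] unfolding distrib_left by linarith
qed

end

section \<open>Replacing the approximations by the initial and boundary data\<close>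

lemma sqint_triangle_swapped:
  assumes "L2_on S f" "L2_on S g" "L2_on S h"
  shows "sqint S (\<lambda>z. f z - h z) \<le> 2 * sqint S (\<lambda>z. f z - g z) + 2 * sqint S (\<lambda>z. h z - g z)"
  using sqint_triangle[OF assms] by (simp add: sqint_diff_commute[of S g h])

context approximation
begin

lemma initial_error_le:
  assumes "L2_on {xL<..<xR} \<rho>IC" "L2_on ({xL<..<xR} \<times> \<Omega>plus) jIC" "L2_on ({xL<..<xR} \<times> \<Omega>plus) wIC"
    and \<delta>: "sqint {xL<..<xR} (\<lambda>x. \<rho>A (0, x) - \<rho>IC x) < \<delta>"
      "sqint ({xL<..<xR} \<times> \<Omega>plus) (\<lambda>(x, v). jA (0, x, v) - jIC (x, v)) < \<delta>"
      "sqint ({xL<..<xR} \<times> \<Omega>plus) (\<lambda>(x, v). wA (0, x, v) - wIC (x, v)) < \<delta>"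
  shows "A.initial_error \<le> 2 * (sqint {xL<..<xR} (\<lambda>x. \<rho>N (0, x) - \<rho>IC x)
      + \<epsilon>\<^sup>2 * sqint ({xL<..<xR} \<times> \<Omega>plus) (\<lambda>(x, v). jN (0, x, v) - jIC (x, v))
      + \<epsilon> ^ 4 * sqint ({xL<..<xR} \<times> \<Omega>plus) (\<lambda>(x, v). wN (0, x, v) - wIC (x, v))) + 6 * \<delta>"
proof -
  let ?XV = "{xL<..<xR} \<times> \<Omega>plus"
  have t0: "0 \<in> {0..T}" using T by simp
  note cN = C1_N[THEN C1_near_imp_continuous_on] and cA = C1_A[THEN C1_near_imp_continuous_on]
  note j = sqint_triangle_swapped[OF L2_on_faces(1)[OF cA(2) t0] assms(2) L2_on_faces(1)[OF cN(2) t0]]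
    and w = sqint_triangle_swapped[OF L2_on_faces(1)[OF cA(3) t0] assms(3) L2_on_faces(1)[OF cN(3) t0]]
  have "\<epsilon>\<^sup>2 * sqint ?XV (\<lambda>(x, v). jA (0, x, v) - jN (0, x, v))
      \<le> \<epsilon>\<^sup>2 * (2 * sqint ?XV (\<lambda>(x, v). jN (0, x, v) - jIC (x, v))) + 2 * \<delta>"
    "\<epsilon> ^ 4 * sqint ?XV (\<lambda>(x, v). wA (0, x, v) - wN (0, x, v))
      \<le> \<epsilon> ^ 4 * (2 * sqint ?XV (\<lambda>(x, v). wN (0, x, v) - wIC (x, v))) + 2 * \<delta>"
  proof -
    \<comment> \<open>The power of \<open>\<epsilon>\<close> must stay on the data term, to match
      the loss, but may be dropped on the approximation error.\<close>
    have *: "k * a \<le> k * (2 * c) + 2 * \<delta>" if "a \<le> 2 * b + 2 * c" "b < \<delta>" "0 \<le> b" "0 \<le> k" "k \<le> 1" for a b c k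
    proof -
      have "k * a \<le> k * (2 * b + 2 * c)" using that by (intro mult_left_mono)
      moreover have "k * b \<le> 1 * \<delta>" using that by (intro mult_mono) auto
      ultimately show ?thesis by (simp add: algebra_simps)
    qed
    show "\<epsilon>\<^sup>2 * sqint ?XV (\<lambda>(x, v). jA (0, x, v) - jN (0, x, v))
      \<le> \<epsilon>\<^sup>2 * (2 * sqint ?XV (\<lambda>(x, v). jN (0, x, v) - jIC (x, v))) + 2 * \<delta>"
      using j \<delta>(2) \<epsilon> by (intro *) (auto simp: split_beta' power_le_one)
    show "\<epsilon> ^ 4 * sqint ?XV (\<lambda>(x, v). wA (0, x, v) - wN (0, x, v))
      \<le> \<epsilon> ^ 4 * (2 * sqint ?XV (\<lambda>(x, v). wN (0, x, v) - wIC (x, v))) + 2 * \<delta>"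
      using w \<delta>(3) \<epsilon> by (intro *) (auto simp: split_beta' power_le_one)
  qed
  then show ?thesis
    using sqint_triangle_swapped[OF L2_on_lines(1)[OF cA(1) t0] assms(1) L2_on_lines(1)[OF cN(1) t0]] \<delta>(1)
    unfolding A.initial_error_def distrib_left by linarith
qed

lemma face_error_le:
  assumes s: "s \<in> {xL, xR}"
    and "L2_on {0<..<T} (\<lambda>t. \<rho>BC (t, s))" "L2_on ({0<..<T} \<times> \<Omega>plus) (\<lambda>(t, v). jBC (t, s, v))"
      "L2_on ({0<..<T} \<times> \<Omega>plus) (\<lambda>(t, v). wBC (t, s, v))"
    and \<delta>: "sqint {0<..<T} (\<lambda>t. \<rho>A (t, s) - \<rho>BC (t, s)) < \<delta>"
      "sqint ({0<..<T} \<times> \<Omega>plus) (\<lambda>(t, v). jA (t, s, v) - jBC (t, s, v)) < \<delta>"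
      "sqint ({0<..<T} \<times> \<Omega>plus) (\<lambda>(t, v). wA (t, s, v) - wBC (t, s, v)) < \<delta>"
  shows "A.face_error s \<le> 2 * (sqint {0<..<T} (\<lambda>t. \<rho>N (t, s) - \<rho>BC (t, s))
      + sqint ({0<..<T} \<times> \<Omega>plus) (\<lambda>(t, v). jN (t, s, v) - jBC (t, s, v))
      + sqint ({0<..<T} \<times> \<Omega>plus) (\<lambda>(t, v). wN (t, s, v) - wBC (t, s, v))) + 6 * \<delta>"
proof -
  have s': "s \<in> {xL..xR}" using s x by auto
  note cN = C1_N[THEN C1_near_imp_continuous_on] and cA = C1_A[THEN C1_near_imp_continuous_on]
  note j = sqint_triangle_swapped[OF L2_on_faces(2)[OF cA(2) s'] assms(3) L2_on_faces(2)[OF cN(2) s']]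
    and w = sqint_triangle_swapped[OF L2_on_faces(2)[OF cA(3) s'] assms(4) L2_on_faces(2)[OF cN(3) s']]
    and a = sqint_triangle_swapped[OF L2_on_lines(2)[OF cA(1) s'] assms(2) L2_on_lines(2)[OF cN(1) s']]
  show ?thesis
    using a j w \<delta> unfolding A.face_error_def distrib_left split_beta' by linarith
qed

section \<open>The loss in terms of squared norms\<close>

lemma R_residual_eq:
  "R_residual T xL xR \<epsilon> \<rho>N jN wN
    = (sqint D2 N.e1 + sqint D3 N.e2 + sqint D3 N.e3) / (T * (xR - xL))"
proof -
  have m: "measure lborel D2 = T * (xR - xL)" "measure lborel D3 = T * (xR - xL)"
    using T x by (simp_all add: TD_def TDV_def measure_def emeasure_lborel_Times borel_Times flip: ennreal_mult)
  have "(LBINT t:{0<..<T}. LBINT x:{xL<..<xR}. (d1 \<rho>N jN t x)\<^sup>2) = sqint D2 N.e1"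
    using set_integral_Times(1)[OF L2_onD(2)[OF L2_on_TD[OF N.cont_e1], unfolded TD_def]]
    by (simp add: sqint_def TD_def N.e1_def d1_def)
  moreover have "(LBINT t:{0<..<T}. LBINT x:{xL<..<xR}. LBINT v:\<Omega>plus.
      (d2 \<epsilon> \<rho>N jN wN t x v)\<^sup>2 + (d3 \<epsilon> jN wN t x v)\<^sup>2) = sqint D3 N.e2 + sqint D3 N.e3"
  proof -
    have "continuous_on ({0..T} \<times> {xL..xR} \<times> {0..1}) (\<lambda>z. (N.e2 z)\<^sup>2 + (N.e3 z)\<^sup>2)"
      by (intro continuous_intros N.cont_e2 N.cont_e3)
    from set_integral_TDV_iterated[OF this]
    show ?thesis
      using L2_onD(2)[OF L2_on_TDV[OF N.cont_e2]] L2_onD(2)[OF L2_on_TDV[OF N.cont_e3]]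
      by (simp add: set_integral_add sqint_def N.e2_def N.e3_def d2_def d3_def)
  qed
  ultimately show ?thesis
    unfolding R_residual_def m by (simp add: add_divide_distrib)
qed

end

lemma R_initial_eq:
  assumes "xL < xR"
    and j: "L2_on ({xL<..<xR} \<times> \<Omega>plus) (\<lambda>(x, v). jN (0, x, v) - jIC (x, v))"
    and w: "L2_on ({xL<..<xR} \<times> \<Omega>plus) (\<lambda>(x, v). wN (0, x, v) - wIC (x, v))"
  shows "R_initial xL xR lam1 lam2 \<epsilon> \<rho>IC jIC wIC \<rho>N jN wN
    = lam1 / (xR - xL) * sqint {xL<..<xR} (\<lambda>x. \<rho>N (0, x) - \<rho>IC x)
      + lam2 / (xR - xL) * (\<epsilon>\<^sup>2 * sqint ({xL<..<xR} \<times> \<Omega>plus) (\<lambda>(x, v). jN (0, x, v) - jIC (x, v))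
        + \<epsilon> ^ 4 * sqint ({xL<..<xR} \<times> \<Omega>plus) (\<lambda>(x, v). wN (0, x, v) - wIC (x, v)))"
proof -
  let ?j = "\<lambda>z. \<epsilon>\<^sup>2 * ((\<lambda>(x, v). jN (0, x, v) - jIC (x, v)) z)\<^sup>2"
  let ?w = "\<lambda>z. \<epsilon> ^ 4 * ((\<lambda>(x, v). wN (0, x, v) - wIC (x, v)) z)\<^sup>2"
  have m: "measure lborel {xL<..<xR} = xR - xL" "measure lborel ({xL<..<xR} \<times> \<Omega>plus) = xR - xL"
    using assms(1) by (simp_all add: measure_def emeasure_lborel_Times)
  have int: "set_integrable lborel ({xL<..<xR} \<times> \<Omega>plus) ?j" "set_integrable lborel ({xL<..<xR} \<times> \<Omega>plus) ?w"
    by (intro set_integrable_mult_right L2_onD(2) j w)+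
  have "(LBINT x:{xL<..<xR}. LBINT v:\<Omega>plus. ?j (x, v) + ?w (x, v))
      = (LINT z:{xL<..<xR} \<times> \<Omega>plus|lborel. ?j z + ?w z)"
    using set_integral_Times(1)[OF set_integral_add(1)[OF int]] by simp
  also have "\<dots> = \<epsilon>\<^sup>2 * sqint ({xL<..<xR} \<times> \<Omega>plus) (\<lambda>(x, v). jN (0, x, v) - jIC (x, v))
        + \<epsilon> ^ 4 * sqint ({xL<..<xR} \<times> \<Omega>plus) (\<lambda>(x, v). wN (0, x, v) - wIC (x, v))"
    unfolding set_integral_add(2)[OF int] by (simp add: sqint_def)
  finally show ?thesis
    unfolding R_initial_def m by (simp add: sqint_def)
qed

lemma R_boundary_eq:
  assumes "0 < T" "xL < xR"
    and \<rho>: "\<And>s. s \<in> {xL, xR} \<Longrightarrow> L2_on {0<..<T} (\<lambda>t. \<rho>N (t, s) - \<rho>BC (t, s))"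
    and j: "\<And>s. s \<in> {xL, xR} \<Longrightarrow>
      L2_on ({0<..<T} \<times> \<Omega>plus) (\<lambda>(t, v). jN (t, s, v) - jBC (t, s, v))"
    and w: "\<And>s. s \<in> {xL, xR} \<Longrightarrow>
      L2_on ({0<..<T} \<times> \<Omega>plus) (\<lambda>(t, v). wN (t, s, v) - wBC (t, s, v))"
  shows "R_boundary T xL xR lam3 lam4 \<rho>BC jBC wBC \<rho>N jN wN
    = lam3 / (2 * T) * (\<Sum>s\<in>{xL, xR}. sqint {0<..<T} (\<lambda>t. \<rho>N (t, s) - \<rho>BC (t, s)))
      + lam4 / (2 * T) * (\<Sum>s\<in>{xL, xR}.
          sqint ({0<..<T} \<times> \<Omega>plus) (\<lambda>(t, v). wN (t, s, v) - wBC (t, s, v))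
          + sqint ({0<..<T} \<times> \<Omega>plus) (\<lambda>(t, v). jN (t, s, v) - jBC (t, s, v)))"
proof -
  let ?IV = "{0<..<T} \<times> \<Omega>plus"
  define J where "J = (\<lambda>s z. ((\<lambda>(t, v). jN (t, s, v) - jBC (t, s, v)) z)\<^sup>2)"
  define W where "W = (\<lambda>s z. ((\<lambda>(t, v). wN (t, s, v) - wBC (t, s, v)) z)\<^sup>2)"
  have int: "set_integrable lborel ?IV (W s)" "set_integrable lborel ?IV (J s)" if "s \<in> {xL, xR}" for s
    unfolding J_def W_def by (rule L2_onD(2)[OF w[OF that]] L2_onD(2)[OF j[OF that]])+
  have face: "set_integrable lborel {0<..<T} (\<lambda>t. LBINT v:\<Omega>plus. W s (t, v) + J s (t, v))"
    "(LBINT t:{0<..<T}. LBINT v:\<Omega>plus. W s (t, v) + J s (t, v))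
      = (LINT z:?IV|lborel. W s z) + (LINT z:?IV|lborel. J s z)" if "s \<in> {xL, xR}" for s
    using set_integral_Times(1,3)[OF set_integral_add(1)[OF int[OF that]]]
      set_integral_add(2)[OF int[OF that]] by simp_all
  have "(LBINT t:{0<..<T}. \<Sum>s\<in>{xL, xR}. (\<rho>N (t, s) - \<rho>BC (t, s))\<^sup>2)
      = (\<Sum>s\<in>{xL, xR}. sqint {0<..<T} (\<lambda>t. \<rho>N (t, s) - \<rho>BC (t, s)))"
    using assms(2) L2_onD(2)[OF \<rho>[of xL]] L2_onD(2)[OF \<rho>[of xR]]
    by (simp add: set_integral_add sqint_def)
  moreover have "(LBINT t:{0<..<T}. \<Sum>s\<in>{xL, xR}. LBINT v:\<Omega>plus.
          (wN (t, s, v) - wBC (t, s, v))\<^sup>2 + (jN (t, s, v) - jBC (t, s, v))\<^sup>2)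
      = (\<Sum>s\<in>{xL, xR}. sqint ?IV (\<lambda>(t, v). wN (t, s, v) - wBC (t, s, v))
          + sqint ?IV (\<lambda>(t, v). jN (t, s, v) - jBC (t, s, v)))"
  proof -
    have "(LBINT t:{0<..<T}. \<Sum>s\<in>{xL, xR}. LBINT v:\<Omega>plus. W s (t, v) + J s (t, v))
      = (\<Sum>s\<in>{xL, xR}. (LINT z:?IV|lborel. W s z) + (LINT z:?IV|lborel. J s z))"
      using assms(2) face[of xL] face[of xR] by (simp add: set_integral_add)
    then show ?thesis by (simp add: W_def J_def sqint_def)
  qed
  moreover have "measure lborel {0<..<T} = T" "real (card {xL, xR}) = 2" "measure lborel \<Omega>plus = 1"
    using assms(1,2) by (simp_all add: measure_def)
  ultimately show ?thesis
    unfolding R_boundary_def by (simp add: mult.commute)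
qed

section \<open>Choice of the constant and passage to the limit\<close>

theorem theorem2p3:
  fixes T xL xR lam1 lam2 lam3 lam4 :: real
  assumes "T > 0" and "xL < xR"
    and "lam1 > 0" and "lam2 > 0" and "lam3 > 0" and "lam4 > 0"
  shows "\<exists>C>0. \<forall>\<epsilon>. 0 < \<epsilon> \<and> \<epsilon> \<le> 1 \<longrightarrow>
    (\<forall>\<rho> j w \<rho>IC jIC wIC \<rho>BC jBC wBC \<rho>N jN wN.
       exact_solution T xL xR \<epsilon> \<rho> j w \<longrightarrow>
       initial_data2 T xL xR \<rho> \<rho>IC \<longrightarrow>
       initial_data3 T xL xR j jIC \<longrightarrow>
       initial_data3 T xL xR w wIC \<longrightarrow>
       boundary_data2 T xL xR \<rho> \<rho>BC \<longrightarrow>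
       boundary_data3 T xL xR j jBC \<longrightarrow>
       boundary_data3 T xL xR w wBC \<longrightarrow>
       smooth_up_to_boundary (TD T xL xR) \<rho>N \<longrightarrow>
       smooth_up_to_boundary (TDV T xL xR) jN \<longrightarrow>
       smooth_up_to_boundary (TDV T xL xR) wN \<longrightarrow>
       R_total T xL xR \<epsilon> \<rho> j w \<rho>N jN wN
         \<le> C / \<epsilon> * R_APNN T xL xR lam1 lam2 lam3 lam4 \<epsilon> \<rho>IC jIC wIC \<rho>BC jBC wBC \<rho>N jN wN)"
proof -
  define X where "X = xR - xL"
  have X: "0 < X" using assms by (simp add: X_def)
  define C0 where "C0 = 8 * exp (4 * T + 2)"
  \<comment> \<open>This undoes the normalisations: \<open>T * X\<close> is the measure of both
    slabs, \<open>X\<close> that of the initial set and \<open>2 * T\<close> that of the two lateral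
    faces. Adding the reciprocals of the penalty weights serves both weights of each loss term at
    once.\<close>
  define K where "K = T * X + X * (1 / lam1 + 1 / lam2) + 2 * T * (1 / lam3 + 1 / lam4)"
  have C0: "0 < C0" by (simp add: C0_def)
  have "0 < T * X" "0 \<le> X * (1 / lam1 + 1 / lam2)" "0 \<le> 2 * T * (1 / lam3 + 1 / lam4)"
    using assms X by simp_all
  then have K: "0 < K" "T * X \<le> K" "X * (1 / lam1 + 1 / lam2) \<le> K" "2 * T * (1 / lam3 + 1 / lam4) \<le> K"
    unfolding K_def by linarith+
  have bound: "R_total T xL xR \<epsilon> \<rho> j w \<rho>N jN wN
      \<le> 4 * C0 * K / \<epsilon> * R_APNN T xL xR lam1 lam2 lam3 lam4 \<epsilon> \<rho>IC jIC wIC \<rho>BC jBC wBC \<rho>N jN wN"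
    if \<epsilon>: "0 < \<epsilon>" "\<epsilon> \<le> 1" and exact: "exact_solution T xL xR \<epsilon> \<rho> j w"
      and I: "initial_data2 T xL xR \<rho> \<rho>IC" "initial_data3 T xL xR j jIC" "initial_data3 T xL xR w wIC"
      and B: "boundary_data2 T xL xR \<rho> \<rho>BC" "boundary_data3 T xL xR j jBC" "boundary_data3 T xL xR w wBC"
      and N: "smooth_up_to_boundary (TD T xL xR) \<rho>N" "smooth_up_to_boundary (TDV T xL xR) jN"
        "smooth_up_to_boundary (TDV T xL xR) wN"
    for \<epsilon> \<rho> j w \<rho>IC jIC wIC \<rho>BC jBC wBC \<rho>N jN wN
  proof -
    let ?XV = "{xL<..<xR} \<times> \<Omega>plus" and ?IV = "{0<..<T} \<times> \<Omega>plus"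
    let ?R = "R_APNN T xL xR lam1 lam2 lam3 lam4 \<epsilon> \<rho>IC jIC wIC \<rho>BC jBC wBC \<rho>N jN wN"
    define ini where "ini = sqint {xL<..<xR} (\<lambda>x. \<rho>N (0, x) - \<rho>IC x)
      + \<epsilon>\<^sup>2 * sqint ?XV (\<lambda>(x, v). jN (0, x, v) - jIC (x, v))
      + \<epsilon> ^ 4 * sqint ?XV (\<lambda>(x, v). wN (0, x, v) - wIC (x, v))"
    define face where "face = (\<lambda>s. sqint {0<..<T} (\<lambda>t. \<rho>N (t, s) - \<rho>BC (t, s))
      + sqint ?IV (\<lambda>(t, v). jN (t, s, v) - jBC (t, s, v))
      + sqint ?IV (\<lambda>(t, v). wN (t, s, v) - wBC (t, s, v)))"
    define res where "res = T * X * R_residual T xL xR \<epsilon> \<rho>N jN wN"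
    have C1_N: "C1_near ({0..T} \<times> {xL..xR}) \<rho>N" "C1_near ({0..T} \<times> {xL..xR} \<times> {0..1}) jN"
      "C1_near ({0..T} \<times> {xL..xR} \<times> {0..1}) wN"
      using N[THEN smooth_up_to_boundary_imp_C1_near] assms(1,2) by (simp_all add: closure_TD closure_TDV)
    have IC: "L2_on {xL<..<xR} \<rho>IC" "L2_on ?XV jIC" "L2_on ?XV wIC"
      using I by (simp_all add: initial_data2_def initial_data3_def has_trace_def)
    have BC: "L2_on {0<..<T} (\<lambda>t. \<rho>BC (t, s))" "L2_on ?IV (\<lambda>(t, v). jBC (t, s, v))"
      "L2_on ?IV (\<lambda>(t, v). wBC (t, s, v))" if "s \<in> {xL, xR}" for s
      using B that by (auto simp: boundary_data2_def boundary_data3_def has_trace_def)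
    \<comment> \<open>Nonnegativity of the residual loss is carried along because its expression by
      squared norms, \<open>R_residual_eq\<close>, is available only inside the interpretation made
      here with concrete approximations.\<close>
    have approx: "R_total T xL xR \<epsilon> \<rho> j w \<rho>N jN wN
          \<le> 4 * C0 * (res + ini + face xL + face xR) + (2 * C0 * 106 + 24) * \<delta>
        \<and> 0 \<le> R_residual T xL xR \<epsilon> \<rho>N jN wN" if \<delta>: "0 < \<delta>" for \<delta>
    proof -
      obtain \<rho>A where \<rho>A: "C1_near ({0..T} \<times> {xL..xR}) \<rho>A" "sqint (TD T xL xR) (\<lambda>z. \<rho>A z - \<rho> z) < \<delta>"
        "\<And>b. b \<in> Basis \<Longrightarrow> sqint (TD T xL xR) (\<lambda>z. pderiv_at b \<rho>A z - weak_deriv (TD T xL xR) b \<rho> z) < \<delta>"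
        "sqint {xL<..<xR} (\<lambda>x. \<rho>A (0, x) - \<rho>IC x) < \<delta>"
        "\<And>s. s \<in> {xL, xR} \<Longrightarrow> sqint {0<..<T} (\<lambda>t. \<rho>A (t, s) - \<rho>BC (t, s)) < \<delta>"
        using initial_boundary_approx2[OF assms(1,2) I(1) B(1) \<delta>] by blast
      obtain jA where jA: "C1_near ({0..T} \<times> {xL..xR} \<times> {0..1}) jA" "sqint (TDV T xL xR) (\<lambda>z. jA z - j z) < \<delta>"
        "\<And>b. b \<in> Basis \<Longrightarrow> sqint (TDV T xL xR) (\<lambda>z. pderiv_at b jA z - weak_deriv (TDV T xL xR) b j z) < \<delta>"
        "sqint ?XV (\<lambda>(x, v). jA (0, x, v) - jIC (x, v)) < \<delta>"
        "\<And>s. s \<in> {xL, xR} \<Longrightarrow> sqint ?IV (\<lambda>(t, v). jA (t, s, v) - jBC (t, s, v)) < \<delta>"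
        using initial_boundary_approx3[OF assms(1,2) I(2) B(2) \<delta>] by blast
      obtain wA where wA: "C1_near ({0..T} \<times> {xL..xR} \<times> {0..1}) wA" "sqint (TDV T xL xR) (\<lambda>z. wA z - w z) < \<delta>"
        "\<And>b. b \<in> Basis \<Longrightarrow> sqint (TDV T xL xR) (\<lambda>z. pderiv_at b wA z - weak_deriv (TDV T xL xR) b w z) < \<delta>"
        "sqint ?XV (\<lambda>(x, v). wA (0, x, v) - wIC (x, v)) < \<delta>"
        "\<And>s. s \<in> {xL, xR} \<Longrightarrow> sqint ?IV (\<lambda>(t, v). wA (t, s, v) - wBC (t, s, v)) < \<delta>"
        using initial_boundary_approx3[OF assms(1,2) I(3) B(3) \<delta>] by blast
      interpret approximation T xL xR \<epsilon> \<rho> j w \<rho>N jN wN \<rho>A jA wA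
        by (intro approximation.intro assms \<epsilon> exact C1_N \<rho>A(1) jA(1) wA(1))
      have small: "sqint D2 \<rho>E < \<delta>" "sqint D2 \<rho>E\<^sub>t < \<delta>" "sqint D2 \<rho>E\<^sub>x < \<delta>" "sqint D3 jE < \<delta>"
        "sqint D3 jE\<^sub>t < \<delta>" "sqint D3 jE\<^sub>x < \<delta>" "sqint D3 wE < \<delta>" "sqint D3 wE\<^sub>t < \<delta>" "sqint D3 wE\<^sub>x < \<delta>"
        unfolding E_defs by (intro \<rho>A jA wA Basis_directions)+
      have res: "res = sqint D2 N.e1 + sqint D3 N.e2 + sqint D3 N.e3"
        unfolding res_def R_residual_eq X_def[symmetric] using assms(1) X by simp
      \<comment> \<open>The three residual lemmas contribute \<open>4 * 2\<close>,
        \<open>8 * 4\<close> and \<open>16 * 3\<close> errors of size \<open>\<delta>\<close>,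
        together 88.\<close>
      have 1: "sqint D2 A.e1 + sqint D3 A.e2 + sqint D3 A.e3 \<le> 2 * res + 88 * \<delta>"
        using residual1 residual2 residual3 small unfolding res distrib_left by linarith
      have 2: "A.initial_error \<le> 2 * ini + 6 * \<delta>"
        unfolding ini_def by (rule initial_error_le[OF IC \<rho>A(4) jA(4) wA(4)])
      have 3: "A.face_error s \<le> 2 * face s + 6 * \<delta>" if "s \<in> {xL, xR}" for s
        unfolding face_def
        by (rule face_error_le[OF that BC[OF that] \<rho>A(5)[OF that] jA(5)[OF that] wA(5)[OF that]])
      \<comment> \<open>The number 106 is 88 plus 6 from the initial time and from each of the two
        faces.\<close>
      have "sqint D2 A.e1 + sqint D3 A.e2 + sqint D3 A.e3 + A.initial_error + A.face_error xL + A.face_error xR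
          \<le> 2 * (res + ini + face xL + face xR) + 106 * \<delta>"
        using 1 2 3[of xL] 3[of xR] unfolding distrib_left by simp
      then have "C0 * (sqint D2 A.e1 + sqint D3 A.e2 + sqint D3 A.e3
            + A.initial_error + A.face_error xL + A.face_error xR)
          \<le> C0 * (2 * (res + ini + face xL + face xR) + 106 * \<delta>)"
        using C0 by (intro mult_left_mono) auto
      with A.energy_estimate
      have "sqint D3 (recon \<epsilon> (\<lambda>z. \<rho>A z - \<rho>N z) (\<lambda>z. jA z - jN z) (\<lambda>z. wA z - wN z))
          \<le> C0 * (2 * (res + ini + face xL + face xR) + 106 * \<delta>)"
        unfolding C0_def by linarith
      with total_error small(1,4,7)
      have "R_total T xL xR \<epsilon> \<rho> j w \<rho>N jN wN
          \<le> 2 * (C0 * (2 * (res + ini + face xL + face xR) + 106 * \<delta>)) + 8 * (\<delta> + \<delta> + \<delta>)"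
        unfolding R_total_def L2_norm_on_power2 distrib_left[of 2] distrib_left[of 8] by linarith
      moreover have "0 \<le> R_residual T xL xR \<epsilon> \<rho>N jN wN"
        unfolding R_residual_eq using assms(1,2) by simp
      ultimately show ?thesis by (simp add: algebra_simps)
    qed
    have le: "R_total T xL xR \<epsilon> \<rho> j w \<rho>N jN wN \<le> 4 * C0 * (res + ini + face xL + face xR)"
    proof (rule field_le_epsilon)
      fix e :: real assume "0 < e"
      \<comment> \<open>\<open>M\<close> is the coefficient of \<open>\<delta>\<close> in
        \<open>approx\<close>, so that \<open>\<delta> = e / M\<close> leaves exactly the error
        \<open>e\<close>.\<close>
      define M where "M = 2 * C0 * 106 + 24"
      have "0 < M" using C0 by (simp add: M_def)
      then have "(2 * C0 * 106 + 24) * (e / M) = e" unfolding M_def by simp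
      with approx[of "e / M"] \<open>0 < M\<close> \<open>0 < e\<close>
      show "R_total T xL xR \<epsilon> \<rho> j w \<rho>N jN wN \<le> 4 * C0 * (res + ini + face xL + face xR) + e"
        by simp
    qed
    have pos: "0 \<le> R_residual T xL xR \<epsilon> \<rho>N jN wN" using approx[of 1] by simp
    note cN = C1_N[THEN C1_near_imp_continuous_on]
    have t0: "0 \<in> {0..T}" using assms(1) by simp
    have ini_le: "ini \<le> X * (1 / lam1 + 1 / lam2) * R_initial xL xR lam1 lam2 \<epsilon> \<rho>IC jIC wIC \<rho>N jN wN"
      and ini_pos: "0 \<le> R_initial xL xR lam1 lam2 \<epsilon> \<rho>IC jIC wIC \<rho>N jN wN"
    proof -
      define a where "a = sqint {xL<..<xR} (\<lambda>x. \<rho>N (0, x) - \<rho>IC x)"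
      define b where "b = \<epsilon>\<^sup>2 * sqint ?XV (\<lambda>(x, v). jN (0, x, v) - jIC (x, v))
        + \<epsilon> ^ 4 * sqint ?XV (\<lambda>(x, v). wN (0, x, v) - wIC (x, v))"
      have ab: "0 \<le> a" "0 \<le> b" by (simp_all add: a_def b_def)
      have R: "R_initial xL xR lam1 lam2 \<epsilon> \<rho>IC jIC wIC \<rho>N jN wN = lam1 / X * a + lam2 / X * b"
        unfolding a_def b_def X_def
        using L2_on_diff[OF L2_on_faces(1)[OF cN(2) t0] IC(2)] L2_on_diff[OF L2_on_faces(1)[OF cN(3) t0] IC(3)]
        by (intro R_initial_eq assms(2)) (simp_all add: split_beta')
      show "0 \<le> R_initial xL xR lam1 lam2 \<epsilon> \<rho>IC jIC wIC \<rho>N jN wN"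
        unfolding R using ab assms X by simp
      \<comment> \<open>Expanding the product reproduces \<open>a + b\<close>; the cross terms are
        nonnegative and are dropped.\<close>
      have "X * (1 / lam1 + 1 / lam2) * (lam1 / X * a + lam2 / X * b)
          = a + b + (lam2 / lam1 * b + lam1 / lam2 * a)"
        using assms X by (simp add: field_simps)
      moreover have "0 \<le> lam2 / lam1 * b + lam1 / lam2 * a" using ab assms by simp
      moreover have "ini = a + b" by (simp add: ini_def a_def b_def)
      ultimately show "ini \<le> X * (1 / lam1 + 1 / lam2) * R_initial xL xR lam1 lam2 \<epsilon> \<rho>IC jIC wIC \<rho>N jN wN"
        unfolding R by linarith
    qed
    have face_le: "face xL + face xR
        \<le> 2 * T * (1 / lam3 + 1 / lam4) * R_boundary T xL xR lam3 lam4 \<rho>BC jBC wBC \<rho>N jN wN"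
      and face_pos: "0 \<le> R_boundary T xL xR lam3 lam4 \<rho>BC jBC wBC \<rho>N jN wN"
    proof -
      define a where "a = (\<Sum>s\<in>{xL, xR}. sqint {0<..<T} (\<lambda>t. \<rho>N (t, s) - \<rho>BC (t, s)))"
      define b where "b = (\<Sum>s\<in>{xL, xR}. sqint ?IV (\<lambda>(t, v). wN (t, s, v) - wBC (t, s, v))
          + sqint ?IV (\<lambda>(t, v). jN (t, s, v) - jBC (t, s, v)))"
      have ab: "0 \<le> a" "0 \<le> b" unfolding a_def b_def by (auto intro!: sum_nonneg)
      have s: "s \<in> {xL..xR}" if "s \<in> {xL, xR}" for s using that assms(2) by auto
      have R: "R_boundary T xL xR lam3 lam4 \<rho>BC jBC wBC \<rho>N jN wN = lam3 / (2 * T) * a + lam4 / (2 * T) * b"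
        unfolding a_def b_def
      proof (rule R_boundary_eq[OF assms(1,2)])
        fix s assume "s \<in> {xL, xR}"
        note s' = this s[OF this]
        show "L2_on {0<..<T} (\<lambda>t. \<rho>N (t, s) - \<rho>BC (t, s))"
          by (rule L2_on_diff[OF L2_on_lines(2)[OF cN(1) s'(2)] BC(1)[OF s'(1)]])
        show "L2_on ?IV (\<lambda>(t, v). jN (t, s, v) - jBC (t, s, v))"
          using L2_on_diff[OF L2_on_faces(2)[OF cN(2) s'(2)] BC(2)[OF s'(1)]] by (simp add: split_beta')
        show "L2_on ?IV (\<lambda>(t, v). wN (t, s, v) - wBC (t, s, v))"
          using L2_on_diff[OF L2_on_faces(2)[OF cN(3) s'(2)] BC(3)[OF s'(1)]] by (simp add: split_beta')
      qed
      show "0 \<le> R_boundary T xL xR lam3 lam4 \<rho>BC jBC wBC \<rho>N jN wN"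
        unfolding R using ab assms by simp
      have "2 * T * (1 / lam3 + 1 / lam4) * (lam3 / (2 * T) * a + lam4 / (2 * T) * b)
          = a + b + (lam4 / lam3 * b + lam3 / lam4 * a)"
        using assms by (simp add: field_simps)
      moreover have "0 \<le> lam4 / lam3 * b + lam3 / lam4 * a" using ab assms by simp
      moreover have "face xL + face xR = a + b" using assms(2) by (simp add: face_def a_def b_def)
      ultimately show "face xL + face xR
          \<le> 2 * T * (1 / lam3 + 1 / lam4) * R_boundary T xL xR lam3 lam4 \<rho>BC jBC wBC \<rho>N jN wN"
        unfolding R by linarith
    qed
    have "res \<le> K * R_residual T xL xR \<epsilon> \<rho>N jN wN"
      unfolding res_def using K(2) pos by (rule mult_right_mono)
    moreover have "ini \<le> K * R_initial xL xR lam1 lam2 \<epsilon> \<rho>IC jIC wIC \<rho>N jN wN"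
      using ini_le mult_right_mono[OF K(3) ini_pos] by linarith
    moreover have "face xL + face xR \<le> K * R_boundary T xL xR lam3 lam4 \<rho>BC jBC wBC \<rho>N jN wN"
      using face_le mult_right_mono[OF K(4) face_pos] by linarith
    ultimately have "res + ini + face xL + face xR \<le> K * ?R"
      unfolding R_APNN_def distrib_left by linarith
    then have "4 * C0 * (res + ini + face xL + face xR) \<le> 4 * C0 * (K * ?R)"
      using C0 by (intro mult_left_mono) auto
    also have "\<dots> \<le> 4 * C0 * (K * ?R) / \<epsilon>"
    proof -
      have "0 \<le> 4 * C0 * (K * ?R)"
        unfolding R_APNN_def using C0 K(1) pos ini_pos face_pos by simp
      then show ?thesis using \<epsilon> by (simp add: le_divide_eq mult_left_le)
    qed
    finally show ?thesis using le by (simp add: mult.assoc)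
  qed
  show ?thesis
    using C0 K(1) bound by (intro exI[of _ "4 * C0 * K"]) auto
qed

end
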